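(* Let $\mathsf P$ be a Gray presentation. Then the presented $3$-precategory $\overline{\mathsf P}$ is canonically a lax Gray category, i.e. $\overline{\mathsf P}$ equipped with the interchangers given by the (classes of the) $3$-cells $X_{\phi,\psi}$, for $0$-composable $2$-cells $\phi,\psi$, satisfies the axioms of lax Gray categories.
   Context: **Precategories.** An $n$-precategory is an $n$-globular set $C$ (sets $C_0,\dots,C_n$ with source/target maps $\partial^-_i,\partial^+_i:C_{i+1}\to C_i$ satisfying the globular identities; $\partial^\epsilon_i$ also denotes iterated source/target) with identities $\mathrm{id}:C_{k-1}\to C_k$ and compositions $u\ast_i v\in C_{\max(k,l)}$ for $u\in C_k$, $v\in C_l$, $k,l>0$, $i=\min(k,l)-1$, $\partial^+_i(u)=\partial^-_i(v)$ ("$i$-composable"), such that: $\partial^\pm(\mathrm{id}_u)=u$; $\partial^\epsilon(u\ast_i v)$ is $u\ast_i\partial^\epsilon v$ if $k<l$, $\partial^\epsilon u\ast_i v$ if $k>l$, and $\partial^-u$ (resp. $\partial^+v$) for $\epsilon=-$ (resp. $+$) if $k=l$; composing with an identity on a cell of dimension $i$ via $\ast_i$ is trivial, and $\mathrm{id}_u\ast_i v=\mathrm{id}_{u\ast_i v}$, $v\ast_i\mathrm{id}_u=\mathrm{id}_{v\ast_i u}$ when $\dim u>i$ and $\dim v=i+1$; each $\ast_i$ is associative whenever both sides are defined; for $i<j$ and $u$ of dimension $i+1$, $u\ast_i(v\ast_j v')=(u\ast_i v)\ast_j(u\ast_i v')$ and $(v\ast_j v')\ast_i u=(v\ast_i u)\ast_j(v'\ast_i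 u)$ whenever the left sides are defined. (No exchange law is required.) Morphisms preserve all the structure. **Prepolygraphs.** A $0$-prepolygraph is a set $\mathsf P_0$, with $\mathsf P^*_0=\mathsf P_0$. An $(n+1)$-prepolygraph is an $n$-prepolygraph $(\mathsf P_0,\dots,\mathsf P_n)$, generating a free $n$-precategory with $i$-cells $\mathsf P^*_i$, together with a set $\mathsf P_{n+1}$ of $(n+1)$-generators with source and target in $\mathsf P^*_n$ (parallel if $n\ge1$); its free $(n+1)$-precategory $\mathsf P^*$ is obtained by freely adjoining the elements of $\mathsf P_{n+1}$ as $(n+1)$-cells. $\mathsf P_{\le k}$ is the underlying $k$-prepolygraph. Every $2$-cell of $\mathsf P^*$ is uniquely a $\ast_1$-composite of whiskers $l\ast_0\alpha\ast_0 r$ with $\alpha\in\mathsf P_2$, $l,r\in\mathsf P^*_1$. **Presented precategory.** A congruence on an $n$-precategory $C$ is an equivalence relation on $C_n$ relating only cells with the same source and target and stable under $u\mapsto v\ast_i u\ast_i w$ for all $i<n$ and $v,w\in C_{i+1}$. For an $(n+1)$-prepolygraph $\mathsf P$, $\overline{\mathsf P}=(\mathsf P_{\le n})^*/{\sim^{\mathsf P}}$ where $\sim^{\mathsf P}$ is the smallest congruence with $\partial^-(A)\sim^{\mathsf P}\partial^+(A)$ for all $A\in\mathsf P_{n+1}$. **Gray presentation.** A $4$-prepolygraph $\mathsf P$ containing the following distinguished generators. (a) For $\alpha:f\Rightarrow f'$, $\beta:h\Rightarrow h'$ in $\mathsf P_2$ and $g\in\mathsf P^*_1$ with $\alpha,g,\beta$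 $0$-composable, a $3$-generator (interchange generator) $X_{\alpha,g,\beta}:(\alpha\ast_0 g\ast_0 h)\ast_1(f'\ast_0 g\ast_0\beta)\Rrightarrow(f\ast_0 g\ast_0\beta)\ast_1(\alpha\ast_0 g\ast_0 h')$. (b) For $A:\phi\Rrightarrow\phi'$, $B:\psi\Rrightarrow\psi'$ in $\mathsf P_3$, $e,h,e',h'\in\mathsf P^*_1$, $\chi\in\mathsf P^*_2$ such that $(e\ast_0\phi\ast_0 h)\ast_1\chi\ast_1(e'\ast_0\psi\ast_0 h')$ is defined, a $4$-generator (independence generator) from $((e\ast_0 A\ast_0 h)\ast_1\chi\ast_1(e'\ast_0\psi\ast_0 h'))\ast_2((e\ast_0\phi'\ast_0 h)\ast_1\chi\ast_1(e'\ast_0 B\ast_0 h'))$ to $((e\ast_0\phi\ast_0 h)\ast_1\chi\ast_1(e'\ast_0 B\ast_0 h'))\ast_2((e\ast_0 A\ast_0 h)\ast_1\chi\ast_1(e'\ast_0\psi'\ast_0 h'))$. (c) For $0$-composable $A,g,\beta$ with $A:\phi\Rrightarrow\phi':f\Rightarrow f'$ in $\mathsf P_3$, $g\in\mathsf P^*_1$, $\beta:h\Rightarrow h'$ in $\mathsf P_2$, a $4$-generator (interchange naturality generator) from $((A\ast_0 g\ast_0 h)\ast_1(f'\ast_0 g\ast_0\beta))\ast_2 X_{\phi',g\ast_0\beta}$ to $X_{\phi,g\ast_0\beta}\ast_2((f\ast_0 g\ast_0\beta)\ast_1(A\ast_0 g\ast_0 h'))$; and for $0$-composable $\alpha,g,B$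 with $\alpha:f\Rightarrow f'$ in $\mathsf P_2$, $B:\psi\Rrightarrow\psi':h\Rightarrow h'$ in $\mathsf P_3$, a $4$-generator from $((\alpha\ast_0 g\ast_0 h)\ast_1(f'\ast_0 g\ast_0 B))\ast_2 X_{\alpha\ast_0 g,\psi'}$ to $X_{\alpha\ast_0 g,\psi}\ast_2((f\ast_0 g\ast_0 B)\ast_1(\alpha\ast_0 g\ast_0 h'))$. Here, for $0$-composable $\phi,\psi\in\mathsf P^*_2$ with whisker decompositions $\phi=\phi_1\ast_1\cdots\ast_1\phi_k$, $\psi=\psi_1\ast_1\cdots\ast_1\psi_{k'}$, $\phi_i=f_i\ast_0\alpha_i\ast_0 g_i$, $\psi_j=f'_j\ast_0\beta_j\ast_0 g'_j$, the $3$-cell $X_{\phi,\psi}:(\phi\ast_0\partial^-_1\psi)\ast_1(\partial^+_1\phi\ast_0\psi)\Rrightarrow(\partial^-_1\phi\ast_0\psi)\ast_1(\phi\ast_0\partial^+_1\psi)$ is the $\ast_2$-composite of $kk'$ elementary swaps, which first move $\phi_k$ successively past $\psi_1,\dots,\psi_{k'}$, then $\phi_{k-1}$ past $\psi_1,\dots,\psi_{k'}$, and so on; the elementary swap of consecutive $\phi_i,\psi_j$ in an interleaving is $\lambda\ast_1(f_i\ast_0 X_{\alpha_i,\,g_i\ast_0 f'_j,\,\beta_j}\ast_0 g'_j)\ast_1\rho$, where $\lambda,\rho$ are the parts of the interleaving before and after (an empty composite of swaps is an identity). **Lax Gray category.** A $3$-precategory $C$ with, for every $0$-composable pair of $2$-cells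 $\phi:f\Rightarrow f'$, $\psi:g\Rightarrow g'$, a $3$-cell (interchanger) $X_{\phi,\psi}:(\phi\ast_0 g)\ast_1(f'\ast_0\psi)\Rrightarrow(f\ast_0\psi)\ast_1(\phi\ast_0 g')$ such that, whenever meaningful: (i) $X_{\mathrm{id}_f,\psi}=\mathrm{id}_{f\ast_0\psi}$, $X_{\phi,\mathrm{id}_g}=\mathrm{id}_{\phi\ast_0 g}$, $X_{\phi\ast_1\phi',\psi}=((\phi\ast_0 g)\ast_1X_{\phi',\psi})\ast_2(X_{\phi,\psi}\ast_1(\phi'\ast_0 g'))$, $X_{\phi,\psi\ast_1\psi'}=(X_{\phi,\psi}\ast_1(f'\ast_0\psi'))\ast_2((f\ast_0\psi)\ast_1X_{\phi,\psi'})$, and, for $1$-cells $e,h,m$, $X_{e\ast_0\phi,\psi}=e\ast_0X_{\phi,\psi}$, $X_{\phi,\psi\ast_0 h}=X_{\phi,\psi}\ast_0 h$, $X_{\phi\ast_0 m,\psi}=X_{\phi,m\ast_0\psi}$; (ii) for $1$-composable $A:\phi\Rrightarrow\phi'$, $B:\psi\Rrightarrow\psi'$ in $C_3$, $(A\ast_1\psi)\ast_2(\phi'\ast_1B)=(\phi\ast_1B)\ast_2(A\ast_1\psi')$; (iii) for $0$-composable $A:\phi\Rrightarrow\phi':u\Rightarrow u'$, $B:\psi\Rrightarrow\psi':v\Rightarrow v'$ in $C_3$, $((A\ast_0 v)\ast_1(u'\ast_0\psi))\ast_2X_{\phi',\psi}=X_{\phi,\psi}\ast_2((u\ast_0\psi)\ast_1(A\ast_0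 v'))$ and $((\phi\ast_0 v)\ast_1(u'\ast_0 B))\ast_2X_{\phi,\psi'}=X_{\phi,\psi}\ast_2((u\ast_0 B)\ast_1(\phi\ast_0 v'))$. (Equivalently, a category enriched in $2$-categories with the lax Gray tensor product.) *)

theory Defs
  imports Main
begin

section \<open>Precategories\<close>

text \<open>
  The sets of \<open>k\<close>-cells are taken pairwise disjoint: there is one set of cells, and every cell
  has a dimension.  The fields \<open>bd\<close> and \<open>idc\<close> are the one-step boundary maps and the identity
  maps, \<open>cmp i\<close> is the composition \<open>\<star>\<^sub>i\<close>.
\<close>

datatype side = Src | Tgt

record 'c precat =
  car :: "'c set"
  dm  :: "'c \<Rightarrow> nat"
  bd  :: "side \<Rightarrow> 'c \<Rightarrow> 'c"
  idc :: "'c \<Rightarrow> 'c"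
  cmp :: "nat \<Rightarrow> 'c \<Rightarrow> 'c \<Rightarrow> 'c"

definition cells :: "'c precat \<Rightarrow> nat \<Rightarrow> 'c set" where
  "cells C k = {u \<in> car C. dm C u = k}"

definition bdi :: "'c precat \<Rightarrow> side \<Rightarrow> nat \<Rightarrow> 'c \<Rightarrow> 'c" where
  "bdi C e i u = (bd C e ^^ (dm C u - i)) u"

text \<open>
  \<open>joinable C i u v\<close> is the matching condition at dimension \<open>i\<close>, for cells of any dimension
  above \<open>i\<close>; the composite \<open>cmp C i u v\<close> exists only if moreover \<open>i = min (dm u) (dm v) - 1\<close>.
  For instance two 2-cells can be joinable at 0, but they have no composite \<open>\<star>\<^sub>0\<close>.
\<close>

definition joinable :: "'c precat \<Rightarrow> nat \<Rightarrow> 'c \<Rightarrow> 'c \<Rightarrow> bool" where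
  "joinable C i u v \<longleftrightarrow> u \<in> car C \<and> v \<in> car C \<and> i < dm C u \<and> i < dm C v \<and>
     bdi C Tgt i u = bdi C Src i v"

definition composable :: "'c precat \<Rightarrow> nat \<Rightarrow> 'c \<Rightarrow> 'c \<Rightarrow> bool" where
  "composable C i u v \<longleftrightarrow> joinable C i u v \<and> Suc i = min (dm C u) (dm C v)"

locale precategory =
  fixes n :: nat and C :: "'c precat"
  assumes dm_le: "u \<in> car C \<Longrightarrow> dm C u \<le> n"
    and bd_cells: "u \<in> cells C (Suc k) \<Longrightarrow> bd C e u \<in> cells C k"
    and globular: "u \<in> cells C (Suc (Suc k)) \<Longrightarrow> bd C e (bd C Src u) = bd C e (bd C Tgt u)"
    and idc_cells: "u \<in> cells C k \<Longrightarrow> k < n \<Longrightarrow> idc C u \<in> cells C (Suc k)"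
    and cmp_cells: "composable C i u v \<Longrightarrow> cmp C i u v \<in> cells C (max (dm C u) (dm C v))"
    and bd_idc: "u \<in> cells C k \<Longrightarrow> k < n \<Longrightarrow> bd C e (idc C u) = u"
    and bd_cmp_less: "composable C i u v \<Longrightarrow> dm C u < dm C v \<Longrightarrow>
          bd C e (cmp C i u v) = cmp C i u (bd C e v)"
    and bd_cmp_greater: "composable C i u v \<Longrightarrow> dm C v < dm C u \<Longrightarrow>
          bd C e (cmp C i u v) = cmp C i (bd C e u) v"
    and src_cmp_eq: "composable C i u v \<Longrightarrow> dm C u = dm C v \<Longrightarrow>
          bd C Src (cmp C i u v) = bd C Src u"
    and tgt_cmp_eq: "composable C i u v \<Longrightarrow> dm C u = dm C v \<Longrightarrow>
          bd C Tgt (cmp C i u v) = bd C Tgt v"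
    and cmp_idc_left: "x \<in> cells C i \<Longrightarrow> i < n \<Longrightarrow> composable C i (idc C x) v \<Longrightarrow>
          cmp C i (idc C x) v = v"
    and cmp_idc_right: "x \<in> cells C i \<Longrightarrow> i < n \<Longrightarrow> composable C i v (idc C x) \<Longrightarrow>
          cmp C i v (idc C x) = v"
    and idc_cmp: "composable C i u v \<Longrightarrow> dm C u < n \<Longrightarrow> dm C v = Suc i \<Longrightarrow>
          cmp C i (idc C u) v = idc C (cmp C i u v)"
    and cmp_idc: "composable C i v u \<Longrightarrow> dm C u < n \<Longrightarrow> dm C v = Suc i \<Longrightarrow>
          cmp C i v (idc C u) = idc C (cmp C i v u)"
    and assoc: "composable C i u v \<Longrightarrow> composable C i (cmp C i u v) w \<Longrightarrow>
          composable C i v w \<Longrightarrow> composable C i u (cmp C i v w) \<Longrightarrow>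
          cmp C i (cmp C i u v) w = cmp C i u (cmp C i v w)"
    and distrib_left: "i < j \<Longrightarrow> dm C u = Suc i \<Longrightarrow> composable C j v v' \<Longrightarrow>
          composable C i u (cmp C j v v') \<Longrightarrow>
          cmp C i u (cmp C j v v') = cmp C j (cmp C i u v) (cmp C i u v')"
    and distrib_right: "i < j \<Longrightarrow> dm C u = Suc i \<Longrightarrow> composable C j v v' \<Longrightarrow>
          composable C i (cmp C j v v') u \<Longrightarrow>
          cmp C i (cmp C j v v') u = cmp C j (cmp C i v u) (cmp C i v' u)"
begin

abbreviation src where "src u \<equiv> bd C Src u"
abbreviation tgt where "tgt u \<equiv> bd C Tgt u"
abbreviation comp0 (infixl "\<star>\<^sub>0" 77) where "u \<star>\<^sub>0 v \<equiv> cmp C 0 u v"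
abbreviation comp1 (infixl "\<star>\<^sub>1" 75) where "u \<star>\<^sub>1 v \<equiv> cmp C 1 u v"
abbreviation comp2 (infixl "\<star>\<^sub>2" 73) where "u \<star>\<^sub>2 v \<equiv> cmp C 2 u v"

end


section \<open>Freely adjoining \<open>(n+1)\<close>-cells\<close>

text \<open>
  Given an \<open>n\<close>-precategory \<open>C\<close> and a set \<open>G\<close> of generators with boundaries \<open>d e g\<close> in the \<open>n\<close>-cells
  of \<open>C\<close>, the \<open>(n+1)\<close>-cells of the free extension are formal expressions modulo the smallest
  congruence containing those axioms of \<open>(n+1)\<close>-precategories that equate \<open>(n+1)\<close>-cells.
  \<open>Unit x\<close> is the identity on the \<open>n\<close>-cell \<open>x\<close>, \<open>Cat\<close> is \<open>\<star>\<^sub>n\<close>, and \<open>LWh u a\<close>, \<open>RWh a u\<close> are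
  the compositions of \<open>a\<close> with a cell \<open>u\<close> of \<open>C\<close>, along dimension \<open>dm u - 1\<close>.
\<close>

datatype ('c, 'g) fterm =
    Gen 'g
  | Unit 'c
  | Cat "('c, 'g) fterm" "('c, 'g) fterm"
  | LWh 'c "('c, 'g) fterm"
  | RWh "('c, 'g) fterm" 'c

primrec tbd :: "'c precat \<Rightarrow> (side \<Rightarrow> 'g \<Rightarrow> 'c) \<Rightarrow> side \<Rightarrow> ('c, 'g) fterm \<Rightarrow> 'c" where
  "tbd C d e (Gen g) = d e g"
| "tbd C d e (Unit x) = x"
| "tbd C d e (Cat a b) = (case e of Src \<Rightarrow> tbd C d e a | Tgt \<Rightarrow> tbd C d e b)"
| "tbd C d e (LWh u a) = cmp C (dm C u - 1) u (tbd C d e a)"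
| "tbd C d e (RWh a u) = cmp C (dm C u - 1) (tbd C d e a) u"

text \<open>
  A cell \<open>u\<close> of dimension at most \<open>n\<close> is composable with the \<open>(n+1)\<close>-cell \<open>a\<close> iff it is
  composable with the \<open>n\<close>-cells bounding \<open>a\<close> (the two are parallel).
\<close>

primrec twf :: "nat \<Rightarrow> 'c precat \<Rightarrow> 'g set \<Rightarrow> (side \<Rightarrow> 'g \<Rightarrow> 'c) \<Rightarrow> ('c, 'g) fterm \<Rightarrow> bool" where
  "twf n C G d (Gen g) \<longleftrightarrow> g \<in> G"
| "twf n C G d (Unit x) \<longleftrightarrow> x \<in> cells C n"
| "twf n C G d (Cat a b) \<longleftrightarrow> twf n C G d a \<and> twf n C G d b \<and> tbd C d Tgt a = tbd C d Src b"
| "twf n C G d (LWh u a) \<longleftrightarrow> twf n C G d a \<and> composable C (dm C u - 1) u (tbd C d Src a)"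
| "twf n C G d (RWh a u) \<longleftrightarrow> twf n C G d a \<and> composable C (dm C u - 1) (tbd C d Tgt a) u"

inductive tax :: "nat \<Rightarrow> 'c precat \<Rightarrow> ('c, 'g) fterm \<Rightarrow> ('c, 'g) fterm \<Rightarrow> bool"
  for n :: nat and C :: "'c precat" where
  tax_unit_cat: "tax n C (Cat (Unit x) a) a"
| tax_cat_unit: "tax n C (Cat a (Unit x)) a"
| tax_idc_lwh: "x \<in> car C \<Longrightarrow> dm C x < n \<Longrightarrow> tax n C (LWh (idc C x) a) a"
| tax_rwh_idc: "x \<in> car C \<Longrightarrow> dm C x < n \<Longrightarrow> tax n C (RWh a (idc C x)) a"
| tax_lwh_unit: "tax n C (LWh u (Unit x)) (Unit (cmp C (dm C u - 1) u x))"
| tax_unit_rwh: "tax n C (RWh (Unit x) u) (Unit (cmp C (dm C u - 1) x u))"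
| tax_cat_cat: "tax n C (Cat (Cat a b) c) (Cat a (Cat b c))"
| tax_lwh_lwh: "dm C u = Suc i \<Longrightarrow> dm C v = Suc i \<Longrightarrow> composable C i u v \<Longrightarrow>
    tax n C (LWh (cmp C i u v) a) (LWh u (LWh v a))"
| tax_rwh_rwh: "dm C u = Suc i \<Longrightarrow> dm C v = Suc i \<Longrightarrow> composable C i u v \<Longrightarrow>
    tax n C (RWh (RWh a u) v) (RWh a (cmp C i u v))"
| tax_lwh_rwh: "dm C u = dm C v \<Longrightarrow> tax n C (RWh (LWh u a) v) (LWh u (RWh a v))"
| tax_lwh_cat: "tax n C (LWh u (Cat a b)) (Cat (LWh u a) (LWh u b))"
| tax_cat_rwh: "tax n C (RWh (Cat a b) u) (Cat (RWh a u) (RWh b u))"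
| tax_lwh_over_lwh: "dm C u = Suc i \<Longrightarrow> Suc i < dm C v \<Longrightarrow>
    tax n C (LWh u (LWh v a)) (LWh (cmp C i u v) (LWh u a))"
| tax_lwh_over_rwh: "dm C u = Suc i \<Longrightarrow> Suc i < dm C v \<Longrightarrow>
    tax n C (LWh u (RWh a v)) (RWh (LWh u a) (cmp C i u v))"
| tax_rwh_over_lwh: "dm C u = Suc i \<Longrightarrow> Suc i < dm C v \<Longrightarrow>
    tax n C (RWh (LWh v a) u) (LWh (cmp C i v u) (RWh a u))"
| tax_rwh_over_rwh: "dm C u = Suc i \<Longrightarrow> Suc i < dm C v \<Longrightarrow>
    tax n C (RWh (RWh a v) u) (RWh (RWh a u) (cmp C i v u))"

inductive teq :: "nat \<Rightarrow> 'c precat \<Rightarrow> 'g set \<Rightarrow> (side \<Rightarrow> 'g \<Rightarrow> 'c) \<Rightarrow>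
    ('c, 'g) fterm \<Rightarrow> ('c, 'g) fterm \<Rightarrow> bool"
  for n :: nat and C :: "'c precat" and G :: "'g set" and d :: "side \<Rightarrow> 'g \<Rightarrow> 'c" where
  teq_ax: "tax n C a b \<Longrightarrow> twf n C G d a \<Longrightarrow> twf n C G d b \<Longrightarrow> teq n C G d a b"
| teq_refl: "twf n C G d a \<Longrightarrow> teq n C G d a a"
| teq_sym: "teq n C G d a b \<Longrightarrow> teq n C G d b a"
| teq_trans: "teq n C G d a b \<Longrightarrow> teq n C G d b c \<Longrightarrow> teq n C G d a c"
| teq_cat: "teq n C G d a a' \<Longrightarrow> teq n C G d b b' \<Longrightarrow> twf n C G d (Cat a b) \<Longrightarrow>
    teq n C G d (Cat a b) (Cat a' b')"
| teq_lwh: "teq n C G d a a' \<Longrightarrow> twf n C G d (LWh u a) \<Longrightarrow> teq n C G d (LWh u a) (LWh u a')"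
| teq_rwh: "teq n C G d a a' \<Longrightarrow> twf n C G d (RWh a u) \<Longrightarrow> teq n C G d (RWh a u) (RWh a' u)"

definition tclass :: "nat \<Rightarrow> 'c precat \<Rightarrow> 'g set \<Rightarrow> (side \<Rightarrow> 'g \<Rightarrow> 'c) \<Rightarrow>
    ('c, 'g) fterm \<Rightarrow> ('c, 'g) fterm set" where
  "tclass n C G d t = {t'. teq n C G d t t'}"

definition rep :: "'x set \<Rightarrow> 'x" where
  "rep U = (SOME x. x \<in> U)"

datatype ('c, 'g) ext = Old 'c | New "('c, 'g) fterm set"

definition free_ext :: "nat \<Rightarrow> 'c precat \<Rightarrow> 'g set \<Rightarrow> (side \<Rightarrow> 'g \<Rightarrow> 'c) \<Rightarrow>
    ('c, 'g) ext precat" where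
  "free_ext n C G d = \<lparr>
     car = Old ` car C \<union> (\<lambda>t. New (tclass n C G d t)) ` {t. twf n C G d t},
     dm = (\<lambda>c. case c of Old x \<Rightarrow> dm C x | New T \<Rightarrow> Suc n),
     bd = (\<lambda>e c. case c of Old x \<Rightarrow> Old (bd C e x) | New T \<Rightarrow> Old (tbd C d e (rep T))),
     idc = (\<lambda>c. case c of
         Old x \<Rightarrow> if dm C x = n then New (tclass n C G d (Unit x)) else Old (idc C x)
       | New T \<Rightarrow> undefined),
     cmp = (\<lambda>i c c'. case c of
         Old u \<Rightarrow> (case c' of
             Old v \<Rightarrow> Old (cmp C i u v)
           | New T' \<Rightarrow> New (tclass n C G d (LWh u (rep T'))))
       | New T \<Rightarrow> (case c' of
             Old v \<Rightarrow> New (tclass n C G d (RWh (rep T) v))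
           | New T' \<Rightarrow> New (tclass n C G d (Cat (rep T) (rep T')))))\<rparr>"

definition gen :: "nat \<Rightarrow> 'c precat \<Rightarrow> 'g set \<Rightarrow> (side \<Rightarrow> 'g \<Rightarrow> 'c) \<Rightarrow> 'g \<Rightarrow> ('c, 'g) ext" where
  "gen n C G d g = New (tclass n C G d (Gen g))"


section \<open>Prepolygraphs\<close>

definition generators :: "nat \<Rightarrow> 'c precat \<Rightarrow> 'g set \<Rightarrow> (side \<Rightarrow> 'g \<Rightarrow> 'c) \<Rightarrow> bool" where
  "generators n C G d \<longleftrightarrow> (\<forall>g\<in>G. (\<forall>e. d e g \<in> cells C n) \<and>
     (n \<ge> 1 \<longrightarrow> (\<forall>e. bd C e (d Src g) = bd C e (d Tgt g))))"

definition discrete :: "'a set \<Rightarrow> 'a precat" where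
  "discrete S = \<lparr>car = S, dm = (\<lambda>_. 0), bd = (\<lambda>_. undefined), idc = undefined, cmp = (\<lambda>_. undefined)\<rparr>"

text \<open>
  \<open>('a, 'b) ext\<close>, \<open>('a, 'b, 'c) cell2\<close> and \<open>('a, 'b, 'c, 'd) cell3\<close> are the types of cells of the
  free 1-, 2- and 3-precategories on a prepolygraph.
\<close>

type_synonym ('a, 'b, 'c) cell2 = "(('a, 'b) ext, 'c) ext"
type_synonym ('a, 'b, 'c, 'd) cell3 = "((('a, 'b) ext, 'c) ext, 'd) ext"

record ('a, 'b, 'c, 'd, 'e) prepoly4 =
  P0 :: "'a set"
  P1 :: "'b set"
  P2 :: "'c set"
  P3 :: "'d set"
  P4 :: "'e set"
  d1 :: "side \<Rightarrow> 'b \<Rightarrow> 'a"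
  d2 :: "side \<Rightarrow> 'c \<Rightarrow> ('a, 'b) ext"
  d3 :: "side \<Rightarrow> 'd \<Rightarrow> ('a, 'b, 'c) cell2"
  d4 :: "side \<Rightarrow> 'e \<Rightarrow> ('a, 'b, 'c, 'd) cell3"

definition F1 :: "('a, 'b, 'c, 'd, 'e) prepoly4 \<Rightarrow> ('a, 'b) ext precat" where
  "F1 P = free_ext 0 (discrete (P0 P)) (P1 P) (d1 P)"

definition F2 :: "('a, 'b, 'c, 'd, 'e) prepoly4 \<Rightarrow> ('a, 'b, 'c) cell2 precat" where
  "F2 P = free_ext 1 (F1 P) (P2 P) (d2 P)"

definition F3 :: "('a, 'b, 'c, 'd, 'e) prepoly4 \<Rightarrow> ('a, 'b, 'c, 'd) cell3 precat" where
  "F3 P = free_ext 2 (F2 P) (P3 P) (d3 P)"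

definition prepolygraph4 :: "('a, 'b, 'c, 'd, 'e) prepoly4 \<Rightarrow> bool" where
  "prepolygraph4 P \<longleftrightarrow>
     generators 0 (discrete (P0 P)) (P1 P) (d1 P) \<and>
     generators 1 (F1 P) (P2 P) (d2 P) \<and>
     generators 2 (F2 P) (P3 P) (d3 P) \<and>
     generators 3 (F3 P) (P4 P) (d4 P)"


section \<open>Presented precategories\<close>

definition congruence :: "nat \<Rightarrow> 'c precat \<Rightarrow> ('c \<times> 'c) set \<Rightarrow> bool" where
  "congruence n C R \<longleftrightarrow> equiv (cells C n) R \<and>
     (\<forall>u u' e. (u, u') \<in> R \<longrightarrow> bd C e u = bd C e u') \<and>
     (\<forall>u u' i. (u, u') \<in> R \<longrightarrow> i < n \<longrightarrow>
       (\<forall>v\<in>cells C (Suc i). \<forall>w\<in>cells C (Suc i).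
          composable C i v u \<longrightarrow> composable C i (cmp C i v u) w \<longrightarrow>
          (cmp C i (cmp C i v u) w, cmp C i (cmp C i v u') w) \<in> R))"

definition presented_congruence :: "nat \<Rightarrow> 'c precat \<Rightarrow> 'g set \<Rightarrow> (side \<Rightarrow> 'g \<Rightarrow> 'c) \<Rightarrow> ('c \<times> 'c) set" where
  "presented_congruence n C G d =
     \<Inter> {R. congruence n C R \<and> (\<forall>A\<in>G. (d Src A, d Tgt A) \<in> R)}"

text \<open>In the quotient, a cell \<open>x\<close> of dimension below \<open>n\<close> is represented by the singleton \<open>{x}\<close>.\<close>

definition qclass :: "nat \<Rightarrow> 'c precat \<Rightarrow> ('c \<times> 'c) set \<Rightarrow> 'c \<Rightarrow> 'c set" where
  "qclass n C R x = (if dm C x = n then R `` {x} else {x})"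

definition quotient_precat :: "nat \<Rightarrow> 'c precat \<Rightarrow> ('c \<times> 'c) set \<Rightarrow> 'c set precat" where
  "quotient_precat n C R = \<lparr>
     car = qclass n C R ` car C,
     dm = (\<lambda>U. dm C (rep U)),
     bd = (\<lambda>e U. qclass n C R (bd C e (rep U))),
     idc = (\<lambda>U. qclass n C R (idc C (rep U))),
     cmp = (\<lambda>i U V. qclass n C R (cmp C i (rep U) (rep V)))\<rparr>"

definition pcong :: "('a, 'b, 'c, 'd, 'e) prepoly4 \<Rightarrow>
    (('a, 'b, 'c, 'd) cell3 \<times> ('a, 'b, 'c, 'd) cell3) set" where
  "pcong P = presented_congruence 3 (F3 P) (P4 P) (d4 P)"

definition presented3 :: "('a, 'b, 'c, 'd, 'e) prepoly4 \<Rightarrow> ('a, 'b, 'c, 'd) cell3 set precat" where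
  "presented3 P = quotient_precat 3 (F3 P) (pcong P)"


section \<open>Gray presentations\<close>

text \<open>
  All cells are taken in the free 3-precategory \<open>F3 P\<close>; \<open>gen2\<close> and \<open>gen3\<close> are the inclusions of the
  generators.  \<open>X \<alpha> g \<beta>\<close> is the interchange generator.
\<close>

locale gray_data =
  fixes P :: "('a, 'b, 'c, 'd, 'e) prepoly4"
    and X :: "'c \<Rightarrow> ('a, 'b, 'c, 'd) cell3 \<Rightarrow> 'c \<Rightarrow> 'd"
begin

abbreviation F where "F \<equiv> F3 P"
abbreviation src where "src u \<equiv> bd F Src u"
abbreviation tgt where "tgt u \<equiv> bd F Tgt u"
abbreviation comp0 (infixl "\<star>\<^sub>0" 77) where "u \<star>\<^sub>0 v \<equiv> cmp F 0 u v"
abbreviation comp1 (infixl "\<star>\<^sub>1" 75) where "u \<star>\<^sub>1 v \<equiv> cmp F 1 u v"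
abbreviation comp2 (infixl "\<star>\<^sub>2" 73) where "u \<star>\<^sub>2 v \<equiv> cmp F 2 u v"

definition gen2 :: "'c \<Rightarrow> ('a, 'b, 'c, 'd) cell3" where
  "gen2 \<alpha> = Old (gen 1 (F1 P) (P2 P) (d2 P) \<alpha>)"

definition gen3 :: "'d \<Rightarrow> ('a, 'b, 'c, 'd) cell3" where
  "gen3 A = gen 2 (F2 P) (P3 P) (d3 P) A"

fun whisker :: "('a, 'b, 'c, 'd) cell3 \<times> 'c \<times> ('a, 'b, 'c, 'd) cell3 \<Rightarrow> ('a, 'b, 'c, 'd) cell3" where
  "whisker (f, \<alpha>, g) = f \<star>\<^sub>0 gen2 \<alpha> \<star>\<^sub>0 g"

fun is_whisker :: "('a, 'b, 'c, 'd) cell3 \<times> 'c \<times> ('a, 'b, 'c, 'd) cell3 \<Rightarrow> bool" where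
  "is_whisker (f, \<alpha>, g) \<longleftrightarrow> f \<in> cells F 1 \<and> \<alpha> \<in> P2 P \<and> g \<in> cells F 1 \<and>
     joinable F 0 f (gen2 \<alpha>) \<and> joinable F 0 (gen2 \<alpha>) g"

text \<open>The 1-cell argument is the source, needed for the empty composite.\<close>

primrec whisker_path :: "('a, 'b, 'c, 'd) cell3 \<Rightarrow>
    (('a, 'b, 'c, 'd) cell3 \<times> 'c \<times> ('a, 'b, 'c, 'd) cell3) list \<Rightarrow> bool" where
  "whisker_path f [] \<longleftrightarrow> f \<in> cells F 1"
| "whisker_path f (w # ws) \<longleftrightarrow>
     is_whisker w \<and> src (whisker w) = f \<and> whisker_path (tgt (whisker w)) ws"

primrec paste :: "('a, 'b, 'c, 'd) cell3 \<Rightarrow>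
    (('a, 'b, 'c, 'd) cell3 \<times> 'c \<times> ('a, 'b, 'c, 'd) cell3) list \<Rightarrow> ('a, 'b, 'c, 'd) cell3" where
  "paste f [] = idc F f"
| "paste f (w # ws) = whisker w \<star>\<^sub>1 paste (tgt (whisker w)) ws"

definition decomp :: "('a, 'b, 'c, 'd) cell3 \<Rightarrow>
    (('a, 'b, 'c, 'd) cell3 \<times> 'c \<times> ('a, 'b, 'c, 'd) cell3) list" where
  "decomp \<phi> = (THE ws. whisker_path (src \<phi>) ws \<and> paste (src \<phi>) ws = \<phi>)"

text \<open>
  The elementary swap of \<open>\<phi>\<^sub>i\<close> with \<open>\<psi>\<^sub>j\<close> (indices from 0) in the interleaving
  \<open>\<phi>\<^sub>0 \<dots> \<phi>\<^sub>i\<^sub>-\<^sub>1 \<psi>\<^sub>0 \<dots> \<psi>\<^sub>j\<^sub>-\<^sub>1 \<phi>\<^sub>i \<psi>\<^sub>j \<dots> \<phi>\<^sub>i\<^sub>+\<^sub>1 \<dots>\<close>.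
\<close>

definition elem_swap :: "('a, 'b, 'c, 'd) cell3 \<Rightarrow> ('a, 'b, 'c, 'd) cell3 \<Rightarrow> nat \<Rightarrow> nat \<Rightarrow>
    ('a, 'b, 'c, 'd) cell3" where
  "elem_swap \<phi> \<psi> i j =
    (let ws = decomp \<phi>; vs = decomp \<psi>;
         (f, \<alpha>, g) = ws ! i; (f', \<beta>, g') = vs ! j;
         \<phi>i = whisker (ws ! i); \<psi>j = whisker (vs ! j);
         lam = (paste (src \<phi>) (take i ws) \<star>\<^sub>0 src \<psi>) \<star>\<^sub>1 (src \<phi>i \<star>\<^sub>0 paste (src \<psi>) (take j vs));
         rho = (tgt \<phi>i \<star>\<^sub>0 paste (tgt \<psi>j) (drop (Suc j) vs)) \<star>\<^sub>1
               (paste (tgt \<phi>i) (drop (Suc i) ws) \<star>\<^sub>0 tgt \<psi>)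
     in lam \<star>\<^sub>1 (f \<star>\<^sub>0 gen3 (X \<alpha> (g \<star>\<^sub>0 f') \<beta>) \<star>\<^sub>0 g') \<star>\<^sub>1 rho)"

text \<open>The 3-cell \<open>X\<^bsub>\<phi>,\<psi>\<^esub>\<close>.\<close>

definition XX :: "('a, 'b, 'c, 'd) cell3 \<Rightarrow> ('a, 'b, 'c, 'd) cell3 \<Rightarrow> ('a, 'b, 'c, 'd) cell3" where
  "XX \<phi> \<psi> = foldl (\<star>\<^sub>2) (idc F ((\<phi> \<star>\<^sub>0 src \<psi>) \<star>\<^sub>1 (tgt \<phi> \<star>\<^sub>0 \<psi>)))
     [elem_swap \<phi> \<psi> i j. i \<leftarrow> rev [0..<length (decomp \<phi>)], j \<leftarrow> [0..<length (decomp \<psi>)]]"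

definition has_gen4 :: "('a, 'b, 'c, 'd) cell3 \<Rightarrow> ('a, 'b, 'c, 'd) cell3 \<Rightarrow> bool" where
  "has_gen4 U V \<longleftrightarrow> (\<exists>\<Gamma>\<in>P4 P. d4 P Src \<Gamma> = U \<and> d4 P Tgt \<Gamma> = V)"

definition presented_XX :: "('a, 'b, 'c, 'd) cell3 set \<Rightarrow> ('a, 'b, 'c, 'd) cell3 set \<Rightarrow>
    ('a, 'b, 'c, 'd) cell3 set" where
  "presented_XX \<Phi> \<Psi> = qclass 3 F (pcong P) (XX (rep \<Phi>) (rep \<Psi>))"

end

locale gray_presentation = gray_data P X
  for P :: "('a, 'b, 'c, 'd, 'e) prepoly4"
    and X :: "'c \<Rightarrow> ('a, 'b, 'c, 'd) cell3 \<Rightarrow> 'c \<Rightarrow> 'd" +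
  assumes prepolygraph: "prepolygraph4 P"
    and interchange_gen: "\<And>\<alpha> g \<beta> f f' h h'.
      \<lbrakk>\<alpha> \<in> P2 P; \<beta> \<in> P2 P; g \<in> cells F 1; joinable F 0 (gen2 \<alpha>) g; joinable F 0 g (gen2 \<beta>);
       f = src (gen2 \<alpha>); f' = tgt (gen2 \<alpha>); h = src (gen2 \<beta>); h' = tgt (gen2 \<beta>)\<rbrakk> \<Longrightarrow>
      X \<alpha> g \<beta> \<in> P3 P \<and>
      src (gen3 (X \<alpha> g \<beta>)) = (gen2 \<alpha> \<star>\<^sub>0 g \<star>\<^sub>0 h) \<star>\<^sub>1 (f' \<star>\<^sub>0 g \<star>\<^sub>0 gen2 \<beta>) \<and>
      tgt (gen3 (X \<alpha> g \<beta>)) = (f \<star>\<^sub>0 g \<star>\<^sub>0 gen2 \<beta>) \<star>\<^sub>1 (gen2 \<alpha> \<star>\<^sub>0 g \<star>\<^sub>0 h')"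
    and independence_gen: "\<And>A B e h e' h' \<chi> \<phi> \<phi>' \<psi> \<psi>'.
      \<lbrakk>A \<in> P3 P; B \<in> P3 P; \<phi> = src (gen3 A); \<phi>' = tgt (gen3 A); \<psi> = src (gen3 B); \<psi>' = tgt (gen3 B);
       e \<in> cells F 1; h \<in> cells F 1; e' \<in> cells F 1; h' \<in> cells F 1; \<chi> \<in> cells F 2;
       composable F 0 e \<phi>; composable F 0 (e \<star>\<^sub>0 \<phi>) h;
       composable F 0 e' \<psi>; composable F 0 (e' \<star>\<^sub>0 \<psi>) h';
       composable F 1 (e \<star>\<^sub>0 \<phi> \<star>\<^sub>0 h) \<chi>;
       composable F 1 ((e \<star>\<^sub>0 \<phi> \<star>\<^sub>0 h) \<star>\<^sub>1 \<chi>) (e' \<star>\<^sub>0 \<psi> \<star>\<^sub>0 h')\<rbrakk> \<Longrightarrow>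
      has_gen4
        (((e \<star>\<^sub>0 gen3 A \<star>\<^sub>0 h) \<star>\<^sub>1 \<chi> \<star>\<^sub>1 (e' \<star>\<^sub>0 \<psi> \<star>\<^sub>0 h')) \<star>\<^sub>2
         ((e \<star>\<^sub>0 \<phi>' \<star>\<^sub>0 h) \<star>\<^sub>1 \<chi> \<star>\<^sub>1 (e' \<star>\<^sub>0 gen3 B \<star>\<^sub>0 h')))
        (((e \<star>\<^sub>0 \<phi> \<star>\<^sub>0 h) \<star>\<^sub>1 \<chi> \<star>\<^sub>1 (e' \<star>\<^sub>0 gen3 B \<star>\<^sub>0 h')) \<star>\<^sub>2
         ((e \<star>\<^sub>0 gen3 A \<star>\<^sub>0 h) \<star>\<^sub>1 \<chi> \<star>\<^sub>1 (e' \<star>\<^sub>0 \<psi>' \<star>\<^sub>0 h')))"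
    and naturality_gen_left: "\<And>A g \<beta> \<phi> \<phi>' f f' h h'.
      \<lbrakk>A \<in> P3 P; \<beta> \<in> P2 P; g \<in> cells F 1; joinable F 0 (gen3 A) g; joinable F 0 g (gen2 \<beta>);
       \<phi> = src (gen3 A); \<phi>' = tgt (gen3 A); f = src \<phi>; f' = tgt \<phi>;
       h = src (gen2 \<beta>); h' = tgt (gen2 \<beta>)\<rbrakk> \<Longrightarrow>
      has_gen4
        (((gen3 A \<star>\<^sub>0 g \<star>\<^sub>0 h) \<star>\<^sub>1 (f' \<star>\<^sub>0 g \<star>\<^sub>0 gen2 \<beta>)) \<star>\<^sub>2 XX \<phi>' (g \<star>\<^sub>0 gen2 \<beta>))
        (XX \<phi> (g \<star>\<^sub>0 gen2 \<beta>) \<star>\<^sub>2 ((f \<star>\<^sub>0 g \<star>\<^sub>0 gen2 \<beta>) \<star>\<^sub>1 (gen3 A \<star>\<^sub>0 g \<star>\<^sub>0 h')))"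
    and naturality_gen_right: "\<And>\<alpha> g B \<psi> \<psi>' f f' h h'.
      \<lbrakk>\<alpha> \<in> P2 P; B \<in> P3 P; g \<in> cells F 1; joinable F 0 (gen2 \<alpha>) g; joinable F 0 g (gen3 B);
       f = src (gen2 \<alpha>); f' = tgt (gen2 \<alpha>);
       \<psi> = src (gen3 B); \<psi>' = tgt (gen3 B); h = src \<psi>; h' = tgt \<psi>\<rbrakk> \<Longrightarrow>
      has_gen4
        (((gen2 \<alpha> \<star>\<^sub>0 g \<star>\<^sub>0 h) \<star>\<^sub>1 (f' \<star>\<^sub>0 g \<star>\<^sub>0 gen3 B)) \<star>\<^sub>2 XX (gen2 \<alpha> \<star>\<^sub>0 g) \<psi>')
        (XX (gen2 \<alpha> \<star>\<^sub>0 g) \<psi> \<star>\<^sub>2 ((f \<star>\<^sub>0 g \<star>\<^sub>0 gen3 B) \<star>\<^sub>1 (gen2 \<alpha> \<star>\<^sub>0 g \<star>\<^sub>0 h')))"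


section \<open>Lax Gray categories\<close>

locale lax_gray_category = precategory 3 C
  for C :: "'c precat" +
  fixes X :: "'c \<Rightarrow> 'c \<Rightarrow> 'c"
  assumes X_cell: "\<lbrakk>\<phi> \<in> cells C 2; \<psi> \<in> cells C 2; joinable C 0 \<phi> \<psi>\<rbrakk> \<Longrightarrow>
        X \<phi> \<psi> \<in> cells C 3 \<and>
        src (X \<phi> \<psi>) = (\<phi> \<star>\<^sub>0 src \<psi>) \<star>\<^sub>1 (tgt \<phi> \<star>\<^sub>0 \<psi>) \<and>
        tgt (X \<phi> \<psi>) = (src \<phi> \<star>\<^sub>0 \<psi>) \<star>\<^sub>1 (\<phi> \<star>\<^sub>0 tgt \<psi>)"
    and X_idc_left: "\<lbrakk>f \<in> cells C 1; \<psi> \<in> cells C 2; joinable C 0 f \<psi>\<rbrakk> \<Longrightarrow>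
        X (idc C f) \<psi> = idc C (f \<star>\<^sub>0 \<psi>)"
    and X_idc_right: "\<lbrakk>\<phi> \<in> cells C 2; g \<in> cells C 1; joinable C 0 \<phi> g\<rbrakk> \<Longrightarrow>
        X \<phi> (idc C g) = idc C (\<phi> \<star>\<^sub>0 g)"
    and X_comp_left: "\<lbrakk>\<phi> \<in> cells C 2; \<phi>' \<in> cells C 2; \<psi> \<in> cells C 2;
          composable C 1 \<phi> \<phi>'; joinable C 0 \<phi> \<psi>\<rbrakk> \<Longrightarrow>
        X (\<phi> \<star>\<^sub>1 \<phi>') \<psi> = ((\<phi> \<star>\<^sub>0 src \<psi>) \<star>\<^sub>1 X \<phi>' \<psi>) \<star>\<^sub>2 (X \<phi> \<psi> \<star>\<^sub>1 (\<phi>' \<star>\<^sub>0 tgt \<psi>))"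
    and X_comp_right: "\<lbrakk>\<phi> \<in> cells C 2; \<psi> \<in> cells C 2; \<psi>' \<in> cells C 2;
          composable C 1 \<psi> \<psi>'; joinable C 0 \<phi> \<psi>\<rbrakk> \<Longrightarrow>
        X \<phi> (\<psi> \<star>\<^sub>1 \<psi>') = (X \<phi> \<psi> \<star>\<^sub>1 (tgt \<phi> \<star>\<^sub>0 \<psi>')) \<star>\<^sub>2 ((src \<phi> \<star>\<^sub>0 \<psi>) \<star>\<^sub>1 X \<phi> \<psi>')"
    and X_whisker_left: "\<lbrakk>e \<in> cells C 1; \<phi> \<in> cells C 2; \<psi> \<in> cells C 2;
          joinable C 0 e \<phi>; joinable C 0 \<phi> \<psi>\<rbrakk> \<Longrightarrow>
        X (e \<star>\<^sub>0 \<phi>) \<psi> = e \<star>\<^sub>0 X \<phi> \<psi>"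
    and X_whisker_right: "\<lbrakk>\<phi> \<in> cells C 2; \<psi> \<in> cells C 2; h \<in> cells C 1;
          joinable C 0 \<phi> \<psi>; joinable C 0 \<psi> h\<rbrakk> \<Longrightarrow>
        X \<phi> (\<psi> \<star>\<^sub>0 h) = X \<phi> \<psi> \<star>\<^sub>0 h"
    and X_whisker_middle: "\<lbrakk>\<phi> \<in> cells C 2; m \<in> cells C 1; \<psi> \<in> cells C 2;
          joinable C 0 \<phi> m; joinable C 0 m \<psi>\<rbrakk> \<Longrightarrow>
        X (\<phi> \<star>\<^sub>0 m) \<psi> = X \<phi> (m \<star>\<^sub>0 \<psi>)"
    and exchange: "\<lbrakk>A \<in> cells C 3; B \<in> cells C 3; joinable C 1 A B;
          \<phi> = src A; \<phi>' = tgt A; \<psi> = src B; \<psi>' = tgt B\<rbrakk> \<Longrightarrow>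
        (A \<star>\<^sub>1 \<psi>) \<star>\<^sub>2 (\<phi>' \<star>\<^sub>1 B) = (\<phi> \<star>\<^sub>1 B) \<star>\<^sub>2 (A \<star>\<^sub>1 \<psi>')"
    and X_natural_left: "\<lbrakk>A \<in> cells C 3; B \<in> cells C 3; joinable C 0 A B;
          \<phi> = src A; \<phi>' = tgt A; u = src \<phi>; u' = tgt \<phi>; \<psi> = src B; v = src \<psi>; v' = tgt \<psi>\<rbrakk> \<Longrightarrow>
        ((A \<star>\<^sub>0 v) \<star>\<^sub>1 (u' \<star>\<^sub>0 \<psi>)) \<star>\<^sub>2 X \<phi>' \<psi> = X \<phi> \<psi> \<star>\<^sub>2 ((u \<star>\<^sub>0 \<psi>) \<star>\<^sub>1 (A \<star>\<^sub>0 v'))"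
    and X_natural_right: "\<lbrakk>A \<in> cells C 3; B \<in> cells C 3; joinable C 0 A B;
          \<phi> = src A; u = src \<phi>; u' = tgt \<phi>; \<psi> = src B; \<psi>' = tgt B; v = src \<psi>; v' = tgt \<psi>\<rbrakk> \<Longrightarrow>
        ((\<phi> \<star>\<^sub>0 v) \<star>\<^sub>1 (u' \<star>\<^sub>0 B)) \<star>\<^sub>2 X \<phi> \<psi>' = X \<phi> \<psi> \<star>\<^sub>2 ((u \<star>\<^sub>0 B) \<star>\<^sub>1 (\<phi> \<star>\<^sub>0 v'))"

end

theory Submission
  imports Defs
begin

text \<open>
  Interchangers only have to be controlled on generators.  Reading off the list of whiskers of a
  formal composite is invariant under the axioms of precategories, so every 2-cell of the free
  3-precategory decomposes uniquely; therefore \<open>X\<^bsub>\<phi>,\<psi>\<^esub>\<close> obeys a strict recursion on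
  the whiskers of \<open>\<phi>\<close> and, when \<open>\<phi>\<close> is a single whisker, on those of \<open>\<psi>\<close>.
  In the quotient, the independence generators give the exchange law for all 3-cells, by
  induction on 3-cells presented as \<open>\<star>\<^sub>2\<close>-composites of \<open>\<lambda> \<star>\<^sub>1 (e \<star>\<^sub>0 A \<star>\<^sub>0 h) \<star>\<^sub>1 \<rho>\<close>.
  The law for \<open>X\<^bsub>\<phi>,\<psi> \<star>\<^sub>1 \<psi>'\<^esub>\<close> compares two orders of the elementary
  swaps, which differ by exchanges, and naturality extends from generators by pasting squares.
\<close>

section \<open>Boundaries of composites\<close>

text \<open>The free precategories are quotients of formal terms, so the laws of a precategory have
  to be proved for them before anything can be computed there; terms are controlled through their
  boundaries, which live one dimension lower, where the laws already hold. The list of whiskers is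
  an invariant of a 2-cell because no axiom permutes two consecutive whiskers: the absence of an
  exchange law is what makes interchangers definable on cells rather than on terms. The order of the
  elementary swaps treats the two arguments differently: splitting the first one cuts the list of
  swaps in two blocks, splitting the second one tears these blocks apart. The strict recursions are
  proved in the free 3-precategory; the remaining argument is carried out in an arbitrary
  3-precategory spanned by generators and is then instantiated with the quotient. This transfer
  works because the quotient identifies only 3-cells: 2-cells keep their decompositions, and
  equations between low boundaries lift back.\<close>

text \<open>
  The axioms on boundaries alone suffice to transport composability along associativity and
  distributivity; they are available for a free extension before those laws are.
\<close>

locale precat_boundary =
  fixes n :: nat and C :: "'c precat"
  assumes dm_le': "u \<in> car C \<Longrightarrow> dm C u \<le> n"
    and bd_cells': "u \<in> cells C (Suc k) \<Longrightarrow> bd C e u \<in> cells C k"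
    and globular': "u \<in> cells C (Suc (Suc k)) \<Longrightarrow> bd C e (bd C Src u) = bd C e (bd C Tgt u)"
    and cmp_cells': "composable C i u v \<Longrightarrow> cmp C i u v \<in> cells C (max (dm C u) (dm C v))"
    and bd_cmp_less': "composable C i u v \<Longrightarrow> dm C u < dm C v \<Longrightarrow>
          bd C e (cmp C i u v) = cmp C i u (bd C e v)"
    and bd_cmp_greater': "composable C i u v \<Longrightarrow> dm C v < dm C u \<Longrightarrow>
          bd C e (cmp C i u v) = cmp C i (bd C e u) v"
    and src_cmp_eq': "composable C i u v \<Longrightarrow> dm C u = dm C v \<Longrightarrow>
          bd C Src (cmp C i u v) = bd C Src u"
    and tgt_cmp_eq': "composable C i u v \<Longrightarrow> dm C u = dm C v \<Longrightarrow>
          bd C Tgt (cmp C i u v) = bd C Tgt v"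

sublocale precategory \<subseteq> precat_boundary
  by unfold_locales
    (fact dm_le bd_cells globular cmp_cells bd_cmp_less bd_cmp_greater src_cmp_eq tgt_cmp_eq)+

lemma cells_iff: "u \<in> cells C k \<longleftrightarrow> u \<in> car C \<and> dm C u = k"
  by (auto simp: cells_def)

lemma bdi_dm [simp]: "bdi C e (dm C u) u = u"
  by (simp add: bdi_def)

text \<open>Only the dimensions of \<open>u\<close> and of its boundary enter, and no boundary
  axiom: the free extension uses this before its own boundary axioms are available.\<close>

lemma bdi_bd_Suc: "dm C u = Suc k \<Longrightarrow> dm C (bd C e u) = k \<Longrightarrow> j \<le> k \<Longrightarrow>
  bdi C e j u = bdi C e j (bd C e u)"
  by (simp add: bdi_def Suc_diff_le funpow_Suc_right del: funpow.simps)

context precat_boundary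
begin

lemma bdi_Suc: "u \<in> cells C (Suc k) \<Longrightarrow> j \<le> k \<Longrightarrow> bdi C e j u = bdi C e j (bd C e u)"
  using bd_cells'[of u k e] by (intro bdi_bd_Suc) (auto simp: cells_iff)

lemma bdi_pred: "u \<in> cells C (Suc k) \<Longrightarrow> bdi C e k u = bd C e u"
  using bdi_Suc[of u k k e] bd_cells'[of u k e] bdi_dm[of C e "bd C e u"] by (auto simp: cells_iff)

lemma bdi_cells: "u \<in> car C \<Longrightarrow> j \<le> dm C u \<Longrightarrow> bdi C e j u \<in> cells C j"
proof (induction "dm C u" arbitrary: u)
  case 0
  then show ?case by (simp add: bdi_def cells_iff)
next
  case (Suc k)
  show ?case
  proof (cases "j = Suc k")
    case True
    then show ?thesis using Suc by (simp add: bdi_def cells_iff)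
  next
    case False
    have u: "u \<in> cells C (Suc k)" using Suc by (simp add: cells_iff)
    show ?thesis
      using Suc(1)[of "bd C e u"] Suc(2-4) bd_cells'[OF u, of e] bdi_Suc[OF u, of j e] False
      by (auto simp: cells_iff)
  qed
qed

text \<open>By globularity a further boundary forgets the side chosen at the step before, so only
  the last side taken matters. The strict inequality leaves room for that further step.\<close>

lemma bdi_bd: "u \<in> cells C (Suc k) \<Longrightarrow> j < k \<Longrightarrow> bdi C e j (bd C e' u) = bdi C e j u"
proof -
  assume u: "u \<in> cells C (Suc k)" and j: "j < k"
  then obtain m where m: "k = Suc m" by (cases k) auto
  have g: "bd C e (bd C e' u) = bd C e (bd C e u)"
    using globular'[of u m e] u m by (cases e; cases e') auto
  have "bdi C e j (bd C e'' u) = bdi C e j (bd C e (bd C e'' u))" for e''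
    using bd_cells'[OF u] m j by (intro bdi_Suc[of _ m]) auto
  then show ?thesis using bdi_Suc[OF u, of j e] j g by simp
qed

lemma bdi_bdi: "u \<in> car C \<Longrightarrow> i \<le> dm C u \<Longrightarrow> j < i \<Longrightarrow> bdi C e j (bdi C e' i u) = bdi C e j u"
proof (induction "dm C u" arbitrary: u)
  case 0
  then show ?case by simp
next
  case (Suc k)
  show ?case
  proof (cases "i = Suc k")
    case True
    then show ?thesis using Suc by (simp add: bdi_def)
  next
    case False
    have u: "u \<in> cells C (Suc k)" using Suc by (simp add: cells_iff)
    show ?thesis
      using Suc(1)[of "bd C e' u"] Suc(2-) bd_cells'[OF u, of e'] bdi_Suc[OF u, of i e']
        bdi_bd[OF u, of j e e'] False
      by (auto simp: cells_iff)
  qed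
qed

text \<open>The dimension \<open>i\<close> of the composition lies strictly below that of
  \<open>bd C e v\<close>, so replacing \<open>v\<close> by a boundary does not change its
  \<open>i\<close>-boundary.\<close>

lemma composable_bd_right:
  assumes "composable C i u v" "dm C u < dm C v"
  shows "composable C i u (bd C e v)"
proof -
  obtain k where v: "v \<in> cells C (Suc k)"
    using assms by (cases "dm C v") (auto simp: composable_def joinable_def cells_iff)
  have i: "i < k" "dm C u = Suc i" using assms v by (auto simp: composable_def joinable_def cells_iff)
  then show ?thesis using assms bd_cells'[OF v, of e] bdi_bd[OF v, of i Src e] v
    by (auto simp: composable_def joinable_def cells_iff)
qed

lemma composable_bd_left:
  assumes "composable C i u v" "dm C v < dm C u"
  shows "composable C i (bd C e u) v"
proof -
  obtain k where v: "u \<in> cells C (Suc k)"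
    using assms by (cases "dm C u") (auto simp: composable_def joinable_def cells_iff)
  have i: "i < k" "dm C v = Suc i" using assms v by (auto simp: composable_def joinable_def cells_iff)
  then show ?thesis using assms bd_cells'[OF v, of e] bdi_bd[OF v, of i Tgt e] v
    by (auto simp: composable_def joinable_def cells_iff)
qed

text \<open>Both boundaries factor through the common \<open>i\<close>-boundary along which the
  cells meet.\<close>

lemma composable_bdi_below:
  assumes "composable C i u v" "j < i"
  shows "bdi C e j v = bdi C e j u"
proof -
  have "bdi C e j u = bdi C e j (bdi C Tgt i u)"
    using assms by (subst bdi_bdi) (auto simp: composable_def joinable_def)
  also have "\<dots> = bdi C e j (bdi C Src i v)"
    using assms by (auto simp: composable_def joinable_def)
  also have "\<dots> = bdi C e j v"
    using assms by (subst bdi_bdi) (auto simp: composable_def joinable_def)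
  finally show ?thesis ..
qed

text \<open>Induction on the sum of the dimensions: one boundary step lowers the factor of larger
  dimension, and the pair stays composable at \<open>i\<close>. The descent ends when both factors
  have dimension \<open>Suc i\<close>, where the source comes from the left factor and the target
  from the right one. The last two clauses describe whiskering, in which the low factor survives in
  every boundary above \<open>i\<close>.\<close>

lemma bdi_cmp:
  assumes "composable C i u v"
  shows "(j < i \<longrightarrow> bdi C e j (cmp C i u v) = bdi C e j u) \<and>
    bdi C Src i (cmp C i u v) = bdi C Src i u \<and>
    bdi C Tgt i (cmp C i u v) = bdi C Tgt i v \<and>
    (i < j \<longrightarrow> dm C u = Suc i \<longrightarrow> j \<le> dm C v \<longrightarrow> bdi C e j (cmp C i u v) = cmp C i u (bdi C e j v)) \<and>
    (i < j \<longrightarrow> dm C v = Suc i \<longrightarrow> j \<le> dm C u \<longrightarrow> bdi C e j (cmp C i u v) = cmp C i (bdi C e j u) v)"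
  using assms
proof (induction "dm C u + dm C v" arbitrary: u v rule: less_induct)
  case less
  note comp = less.prems
  have c: "cmp C i u v \<in> cells C (max (dm C u) (dm C v))" by (rule cmp_cells'[OF comp])
  have uv: "u \<in> car C" "v \<in> car C" "i < dm C u" "i < dm C v" "bdi C Tgt i u = bdi C Src i v"
    "min (dm C u) (dm C v) = Suc i"
    using comp by (auto simp: composable_def joinable_def)
  consider "dm C u < dm C v" | "dm C v < dm C u" | "dm C u = dm C v" by linarith
  then show ?case
  proof cases
    case 1
    then obtain k where k: "dm C v = Suc k" by (cases "dm C v") auto
    have v: "v \<in> cells C (Suc k)" and ck: "cmp C i u v \<in> cells C (Suc k)"
      using uv k c 1 by (auto simp: cells_iff)
    have ik: "i < k" "dm C u = Suc i" using 1 uv k by auto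
    have b: "dm C (bd C e v) = k" for e using bd_cells'[OF v] by (simp add: cells_iff)
    have IH: "(j < i \<longrightarrow> bdi C e j (cmp C i u (bd C e' v)) = bdi C e j u) \<and>
      bdi C Src i (cmp C i u (bd C e' v)) = bdi C Src i u \<and>
      bdi C Tgt i (cmp C i u (bd C e' v)) = bdi C Tgt i (bd C e' v) \<and>
      (i < j \<longrightarrow> j \<le> k \<longrightarrow> bdi C e j (cmp C i u (bd C e' v)) = cmp C i u (bdi C e j (bd C e' v)))" for e'
      using less.hyps[OF _ composable_bd_right[OF comp 1, of e']] b k ik by auto
    have s: "bdi C e j (cmp C i u v) = bdi C e j (cmp C i u (bd C e v))" if "j \<le> k" for e j
      using bdi_Suc[OF ck that, of e] bd_cmp_less'[OF comp 1, of e] by simp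
    have "i < j \<longrightarrow> j \<le> dm C v \<longrightarrow> bdi C e j (cmp C i u v) = cmp C i u (bdi C e j v)"
    proof (cases "j = Suc k")
      case True
      have "bdi C e (Suc k) (cmp C i u v) = cmp C i u v" "bdi C e (Suc k) v = v"
        using ck v by (metis bdi_dm cells_iff)+
      then show ?thesis using True by simp
    next
      case False
      then show ?thesis using s[of j e] IH[of e] bdi_Suc[OF v, of j e] k by auto
    qed
    then show ?thesis
      using IH[of e] IH[of Src] IH[of Tgt] s[of j e] s[of i Src] s[of i Tgt] ik k
        bdi_Suc[OF v, of i Tgt] by auto
  next
    case 2
    then obtain k where k: "dm C u = Suc k" by (cases "dm C u") auto
    have u: "u \<in> cells C (Suc k)" and ck: "cmp C i u v \<in> cells C (Suc k)"
      using uv k c 2 by (auto simp: cells_iff)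
    have ik: "i < k" "dm C v = Suc i" using 2 uv k by auto
    have b: "dm C (bd C e u) = k" for e using bd_cells'[OF u] by (simp add: cells_iff)
    have IH: "(j < i \<longrightarrow> bdi C e j (cmp C i (bd C e' u) v) = bdi C e j (bd C e' u)) \<and>
      bdi C Src i (cmp C i (bd C e' u) v) = bdi C Src i (bd C e' u) \<and>
      bdi C Tgt i (cmp C i (bd C e' u) v) = bdi C Tgt i v \<and>
      (i < j \<longrightarrow> j \<le> k \<longrightarrow> bdi C e j (cmp C i (bd C e' u) v) = cmp C i (bdi C e j (bd C e' u)) v)" for e'
      using less.hyps[OF _ composable_bd_left[OF comp 2, of e']] b k ik by auto
    have s: "bdi C e j (cmp C i u v) = bdi C e j (cmp C i (bd C e u) v)" if "j \<le> k" for e j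
      using bdi_Suc[OF ck that, of e] bd_cmp_greater'[OF comp 2, of e] by simp
    have "i < j \<longrightarrow> j \<le> dm C u \<longrightarrow> bdi C e j (cmp C i u v) = cmp C i (bdi C e j u) v"
    proof (cases "j = Suc k")
      case True
      have "bdi C e (Suc k) (cmp C i u v) = cmp C i u v" "bdi C e (Suc k) u = u"
        using ck u by (metis bdi_dm cells_iff)+
      then show ?thesis using True by simp
    next
      case False
      then show ?thesis using s[of j e] IH[of e] bdi_Suc[OF u, of j e] k by auto
    qed
    then show ?thesis
      using IH[of e] IH[of Src] IH[of Tgt] s[of j e] s[of i Src] s[of i Tgt] ik k
        bdi_Suc[OF u, of i Src] bdi_Suc[OF u, of j e] by auto
  next
    case 3
    then have d: "dm C u = Suc i" "dm C v = Suc i" using uv by auto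
    have u: "u \<in> cells C (Suc i)" and v: "v \<in> cells C (Suc i)" and ck: "cmp C i u v \<in> cells C (Suc i)"
      using uv d c by (auto simp: cells_iff)
    have e: "bdi C e j w = w" if "j = Suc i" "w \<in> cells C (Suc i)" for w
      using that by (metis bdi_dm cells_iff)
    have b1: "j < i \<longrightarrow> bdi C e j (cmp C i u v) = bdi C e j u"
      using bdi_bd[OF ck, of j e Src] bdi_bd[OF u, of j e Src] src_cmp_eq'[OF comp 3] by simp
    have b2: "bdi C Src i (cmp C i u v) = bdi C Src i u"
      using src_cmp_eq'[OF comp 3] by (simp add: bdi_pred[OF u] bdi_pred[OF ck])
    have b3: "bdi C Tgt i (cmp C i u v) = bdi C Tgt i v"
      using tgt_cmp_eq'[OF comp 3] by (simp add: bdi_pred[OF v] bdi_pred[OF ck])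
    have b4: "i < j \<longrightarrow> j \<le> dm C v \<longrightarrow> bdi C e j (cmp C i u v) = cmp C i u (bdi C e j v)"
      using e[OF _ v] e[OF _ ck] d by (auto dest!: le_antisym[OF Suc_leI])
    have b5: "i < j \<longrightarrow> j \<le> dm C u \<longrightarrow> bdi C e j (cmp C i u v) = cmp C i (bdi C e j u) v"
      using e[OF _ u] e[OF _ ck] d by (auto dest!: le_antisym[OF Suc_leI])
    show ?thesis using b1 b2 b3 b4 b5 by blast
  qed
qed

lemma bdi_cmp_below: "composable C i u v \<Longrightarrow> j < i \<Longrightarrow> bdi C e j (cmp C i u v) = bdi C e j u"
  and bdi_src_cmp: "composable C i u v \<Longrightarrow> bdi C Src i (cmp C i u v) = bdi C Src i u"
  and bdi_tgt_cmp: "composable C i u v \<Longrightarrow> bdi C Tgt i (cmp C i u v) = bdi C Tgt i v"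
  and bdi_cmp_right: "composable C i u v \<Longrightarrow> i < j \<Longrightarrow> dm C u = Suc i \<Longrightarrow> j \<le> dm C v \<Longrightarrow>
    bdi C e j (cmp C i u v) = cmp C i u (bdi C e j v)"
  and bdi_cmp_left: "composable C i u v \<Longrightarrow> i < j \<Longrightarrow> dm C v = Suc i \<Longrightarrow> j \<le> dm C u \<Longrightarrow>
    bdi C e j (cmp C i u v) = cmp C i (bdi C e j u) v"
  using bdi_cmp by blast+

lemma composableD:
  assumes "composable C i u v"
  shows "u \<in> car C" "v \<in> car C" "i < dm C u" "i < dm C v" "bdi C Tgt i u = bdi C Src i v"
    "min (dm C u) (dm C v) = Suc i" "cmp C i u v \<in> car C" "dm C (cmp C i u v) = max (dm C u) (dm C v)"
  using assms cmp_cells'[OF assms] by (auto simp: composable_def joinable_def cells_iff)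

text \<open>Below \<open>j\<close> the cells \<open>v\<close>, \<open>v'\<close> and their composite
  have the same boundaries, so \<open>u\<close> meets all three. The distributivity law supposes
  only its left side to be defined; its right side is then defined too, by boundaries alone.\<close>

lemma composable_distrib_left:
  assumes "i < j" "dm C u = Suc i" "composable C j v v'" "composable C i u (cmp C j v v')"
  shows "composable C i u v" "composable C i u v'" "composable C j (cmp C i u v) (cmp C i u v')"
proof -
  have *: "bdi C Src i (cmp C j v v') = bdi C Src i v" "bdi C Src i v' = bdi C Src i v"
    using bdi_cmp_below[OF assms(3,1)] composable_bdi_below[OF assms(3,1)] by auto
  note D = composableD[OF assms(3)] composableD[OF assms(4)]
  show 1: "composable C i u v" "composable C i u v'"
    using D * assms(1,2) by (auto simp: composable_def joinable_def)
  have "bdi C Tgt j (cmp C i u v) = bdi C Src j (cmp C i u v')"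
    using bdi_cmp_right[OF 1(1) assms(1,2), of Tgt] bdi_cmp_right[OF 1(2) assms(1,2), of Src] D(3-5) by simp
  then show "composable C j (cmp C i u v) (cmp C i u v')"
    using D(1-6) assms(1,2) composableD(7,8)[OF 1(1)] composableD(7,8)[OF 1(2)]
    unfolding composable_def joinable_def by simp
qed

lemma composable_distrib_right:
  assumes "i < j" "dm C u = Suc i" "composable C j v v'" "composable C i (cmp C j v v') u"
  shows "composable C i v u" "composable C i v' u" "composable C j (cmp C i v u) (cmp C i v' u)"
proof -
  have *: "bdi C Tgt i (cmp C j v v') = bdi C Tgt i v" "bdi C Tgt i v' = bdi C Tgt i v"
    using bdi_cmp_below[OF assms(3,1)] composable_bdi_below[OF assms(3,1)] by auto
  note D = composableD[OF assms(3)] composableD[OF assms(4)]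
  show 1: "composable C i v u" "composable C i v' u"
    using D * assms(1,2) by (auto simp: composable_def joinable_def)
  have "bdi C Tgt j (cmp C i v u) = bdi C Src j (cmp C i v' u)"
    using bdi_cmp_left[OF 1(1) assms(1,2), of Tgt] bdi_cmp_left[OF 1(2) assms(1,2), of Src] D(3-5) by simp
  then show "composable C j (cmp C i v u) (cmp C i v' u)"
    using D(1-6) assms(1,2) composableD(7,8)[OF 1(1)] composableD(7,8)[OF 1(2)]
    unfolding composable_def joinable_def by simp
qed

end

section \<open>The free extension is a precategory\<close>

locale free_extension = precategory n C for n and C :: "'c precat" +
  fixes G :: "'g set" and d :: "side \<Rightarrow> 'g \<Rightarrow> 'c"
  assumes gens: "generators n C G d"
begin

abbreviation E where "E \<equiv> free_ext n C G d"
abbreviation wf where "wf \<equiv> twf n C G d"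
abbreviation tb where "tb \<equiv> tbd C d"
abbreviation eq where "eq \<equiv> teq n C G d"
definition cl where "cl t = (New (tclass n C G d t) :: ('c, 'g) ext)"

text \<open>Equality of the two boundaries is demanded in every dimension below \<open>n\<close>,
  not merely one step down, because whiskering by a cell of dimension \<open>Suc i\<close> looks at
  the \<open>i\<close>-boundary. Thus a cell composable with the one boundary that
  \<open>twf\<close> tests is composable with both, and the induction passes through
  whiskers.\<close>

lemma wf_tb_parallel:
  "wf a \<Longrightarrow> (\<forall>e. tb e a \<in> cells C n) \<and> (\<forall>e' j. j < n \<longrightarrow> bdi C e' j (tb Tgt a) = bdi C e' j (tb Src a))"
proof (induction a)
  case (Gen g)
  then have g: "d e g \<in> cells C n" "n \<ge> 1 \<Longrightarrow> bd C e (d Src g) = bd C e (d Tgt g)" for e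
    using gens by (auto simp: generators_def)
  have "bdi C e' j (d Tgt g) = bdi C e' j (d Src g)" if "j < n" for e' j
  proof -
    obtain k where k: "n = Suc k" using \<open>j < n\<close> by (cases n) auto
    then show ?thesis using g bdi_Suc[of "d Src g" k j e'] bdi_Suc[of "d Tgt g" k j e'] that by auto
  qed
  then show ?case using g by simp
next
  case (Unit x)
  then show ?case by simp
next
  case (Cat a b)
  then show ?case by (auto split: side.splits)
next
  case (LWh u a)
  define i where "i = dm C u - 1"
  have co: "composable C i u (tb Src a)" and IH: "\<And>e. tb e a \<in> cells C n"
    "\<And>e' j. j < n \<Longrightarrow> bdi C e' j (tb Tgt a) = bdi C e' j (tb Src a)"
    using LWh by (auto simp: i_def)
  have i: "dm C u = Suc i" using composableD(3)[OF co] by (simp add: i_def)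
  have un: "Suc i \<le> n" using i composableD(1)[OF co] dm_le by fastforce
  have co': "composable C i u (tb e a)" for e
    using co IH(1)[of e] IH(1)[of Src] IH(2)[of i Src] un
    by (cases e) (auto simp: composable_def joinable_def cells_iff)
  have "bdi C e' j (cmp C i u (tb Tgt a)) = bdi C e' j (cmp C i u (tb Src a))" if "j < n" for e' j
  proof -
    have "dm C (tb e a) = n" for e using IH(1) by (simp add: cells_iff)
    then show ?thesis
      using bdi_cmp[OF co'[of Src], of j e'] bdi_cmp[OF co'[of Tgt], of j e'] IH(2)[of j e'] IH(2)[of i Tgt] that un i
      by (cases e'; cases j i rule: linorder_cases) auto
  qed
  moreover have "cmp C i u (tb e a) \<in> cells C n" for e
    using cmp_cells[OF co', of e] IH(1)[of e] i un by (auto simp: cells_iff max_def)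
  ultimately show ?case by (simp add: i_def)
next
  case (RWh a u)
  define i where "i = dm C u - 1"
  have co: "composable C i (tb Tgt a) u" and IH: "\<And>e. tb e a \<in> cells C n"
    "\<And>e' j. j < n \<Longrightarrow> bdi C e' j (tb Tgt a) = bdi C e' j (tb Src a)"
    using RWh by (auto simp: i_def)
  have i: "dm C u = Suc i" using composableD(4)[OF co] by (simp add: i_def)
  have un: "Suc i \<le> n" using i composableD(2)[OF co] dm_le by fastforce
  have co': "composable C i (tb e a) u" for e
    using co IH(1)[of e] IH(1)[of Tgt] IH(2)[of i Tgt] un
    by (cases e) (auto simp: composable_def joinable_def cells_iff)
  have "bdi C e' j (cmp C i (tb Tgt a) u) = bdi C e' j (cmp C i (tb Src a) u)" if "j < n" for e' j
  proof -
    have "dm C (tb e a) = n" for e using IH(1) by (simp add: cells_iff)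
    then show ?thesis
      using bdi_cmp[OF co'[of Src], of j e'] bdi_cmp[OF co'[of Tgt], of j e'] IH(2)[of j e'] IH(2)[of i Src] that un i
      by (cases e'; cases j i rule: linorder_cases) auto
  qed
  moreover have "cmp C i (tb e a) u \<in> cells C n" for e
    using cmp_cells[OF co', of e] IH(1)[of e] i un by (auto simp: cells_iff max_def)
  ultimately show ?case by (simp add: i_def)
qed

lemma tb_cells: "wf a \<Longrightarrow> tb e a \<in> cells C n"
  using wf_tb_parallel by blast

lemma tb_parallel: "wf a \<Longrightarrow> j < n \<Longrightarrow> bdi C e' j (tb e a) = bdi C e' j (tb Src a)"
  by (cases e) (simp_all add: wf_tb_parallel)

lemma composable_tb_right:
  assumes "wf a" "u \<in> car C \<Longrightarrow> i < n" shows "composable C i u (tb e a) \<longleftrightarrow> composable C i u (tb Src a)"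
proof (cases "u \<in> car C")
  case True
  have "bdi C Src i (tb e a) = bdi C Src i (tb Src a)"
    using tb_parallel[OF assms(1), of i Src e] tb_parallel[OF assms(1), of i Src Src] assms(2) True by simp
  moreover have "tb e a \<in> car C" "dm C (tb e a) = n" for e
    using tb_cells[OF assms(1), of e] by (simp_all add: cells_iff)
  ultimately show ?thesis unfolding composable_def joinable_def by simp
next
  case False
  then show ?thesis by (simp add: composable_def joinable_def)
qed

lemma composable_tb_left:
  assumes "wf a" "u \<in> car C \<Longrightarrow> i < n" shows "composable C i (tb e a) u \<longleftrightarrow> composable C i (tb Tgt a) u"
proof (cases "u \<in> car C")
  case True
  have "bdi C Tgt i (tb e a) = bdi C Tgt i (tb Tgt a)"
    using tb_parallel[OF assms(1), of i Tgt e] tb_parallel[OF assms(1), of i Tgt Tgt] assms(2) True by simp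
  moreover have "tb e a \<in> car C" "dm C (tb e a) = n" for e
    using tb_cells[OF assms(1), of e] by (simp_all add: cells_iff)
  ultimately show ?thesis unfolding composable_def joinable_def by simp
next
  case False
  then show ?thesis by (simp add: composable_def joinable_def)
qed

text \<open>The truncated subtraction in \<open>twf\<close> does no harm, as composability at
  \<open>dm C u - 1\<close> forces \<open>u\<close> to have positive dimension. By parallelism the
  test on the source carries over to both boundaries.\<close>

lemma wf_LWh: "wf (LWh u a) \<longleftrightarrow> wf a \<and> (\<exists>i. dm C u = Suc i \<and> (\<forall>e. composable C i u (tb e a)))"
proof
  assume w: "wf (LWh u a)"
  have *: "dm C u = Suc (dm C u - 1)" using composableD(3) w by fastforce
  then have "u \<in> car C \<Longrightarrow> dm C u - 1 < n" using dm_le by fastforce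
  then show "wf a \<and> (\<exists>i. dm C u = Suc i \<and> (\<forall>e. composable C i u (tb e a)))"
    using w * composable_tb_right by (intro conjI exI[of _ "dm C u - 1"]) auto
qed auto

lemma wf_RWh: "wf (RWh a u) \<longleftrightarrow> wf a \<and> (\<exists>i. dm C u = Suc i \<and> (\<forall>e. composable C i (tb e a) u))"
proof
  assume w: "wf (RWh a u)"
  have *: "dm C u = Suc (dm C u - 1)" using composableD(4) w by fastforce
  then have "u \<in> car C \<Longrightarrow> dm C u - 1 < n" using dm_le by fastforce
  then show "wf a \<and> (\<exists>i. dm C u = Suc i \<and> (\<forall>e. composable C i (tb e a) u))"
    using w * composable_tb_left by (intro conjI exI[of _ "dm C u - 1"]) auto
qed auto

text \<open>Each axiom on terms, read on boundaries one dimension lower, is the corresponding axiom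
  of \<open>C\<close>; well-formedness of the terms supplies the composability that it asks
  for.\<close>

lemma tax_tb:
  assumes "tax n C a b" "wf a" "wf b"
  shows "tb e a = tb e b"
  using assms
proof (cases rule: tax.cases)
  case (tax_idc_lwh x)
  then have "idc C x \<in> cells C (Suc (dm C x))" using idc_cells[of x "dm C x"] by (simp add: cells_iff)
  then show ?thesis
    using tax_idc_lwh assms(2) cmp_idc_left[of x "dm C x" "tb e b"]
    by (auto simp: cells_iff wf_LWh simp del: twf.simps(4))
next
  case (tax_rwh_idc x)
  then have "idc C x \<in> cells C (Suc (dm C x))" using idc_cells[of x "dm C x"] by (simp add: cells_iff)
  then show ?thesis
    using tax_rwh_idc assms(2) cmp_idc_right[of x "dm C x" "tb e b"]
    by (auto simp: cells_iff wf_RWh simp del: twf.simps(5))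
next
  case (tax_lwh_lwh u i v a')
  have "dm C (cmp C i u v) = Suc i" using composableD(8)[OF tax_lwh_lwh(5)] tax_lwh_lwh by simp
  then show ?thesis
    using tax_lwh_lwh assms(2,3) assoc[of i u v "tb e a'"]
    by (auto simp: wf_LWh simp del: twf.simps(4))
next
  case (tax_rwh_rwh u i v a')
  have "dm C (cmp C i u v) = Suc i" using composableD(8)[OF tax_rwh_rwh(5)] tax_rwh_rwh by simp
  then show ?thesis
    using tax_rwh_rwh assms(2,3) assoc[of i "tb e a'" u v]
    by (auto simp: wf_RWh simp del: twf.simps(5))
next
  case (tax_lwh_rwh u v a')
  then show ?thesis
    using assms(2,3) assoc[of "dm C u - 1" u "tb e a'" v]
    by (auto simp: wf_LWh wf_RWh simp del: twf.simps(4,5))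
next
  case (tax_lwh_over_lwh u i v a')
  then obtain j where j: "dm C v = Suc j" "i < j" by (cases "dm C v") auto
  then have c: "composable C j v (tb e a')" "composable C i u (cmp C j v (tb e a'))"
    using tax_lwh_over_lwh assms(2) by (auto simp: wf_LWh simp del: twf.simps(4))
  \<comment> \<open>This identifies the level of the outer composition, which \<open>tbd\<close>
    recovers as the dimension of the whiskering cell minus one.\<close>
  have "dm C (cmp C i u v) = Suc j"
    using composableD(8)[OF composable_distrib_left(1)[OF j(2) tax_lwh_over_lwh(3) c]] j tax_lwh_over_lwh by simp
  then show ?thesis
    using distrib_left[OF j(2) tax_lwh_over_lwh(3) c] tax_lwh_over_lwh j by simp
next
  case (tax_lwh_over_rwh u i v a')
  then obtain j where j: "dm C v = Suc j" "i < j" by (cases "dm C v") auto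
  then have c: "composable C j (tb e a') v" "composable C i u (cmp C j (tb e a') v)"
    using tax_lwh_over_rwh assms(2) by (auto simp: wf_LWh wf_RWh simp del: twf.simps(4,5))
  have "dm C (cmp C i u v) = Suc j"
    using composableD(8)[OF composable_distrib_left(2)[OF j(2) tax_lwh_over_rwh(3) c]] j tax_lwh_over_rwh by simp
  then show ?thesis
    using distrib_left[OF j(2) tax_lwh_over_rwh(3) c] tax_lwh_over_rwh j by simp
next
  case (tax_rwh_over_lwh u i v a')
  then obtain j where j: "dm C v = Suc j" "i < j" by (cases "dm C v") auto
  then have c: "composable C j v (tb e a')" "composable C i (cmp C j v (tb e a')) u"
    using tax_rwh_over_lwh assms(2) by (auto simp: wf_LWh wf_RWh simp del: twf.simps(4,5))
  have "dm C (cmp C i v u) = Suc j"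
    using composableD(8)[OF composable_distrib_right(1)[OF j(2) tax_rwh_over_lwh(3) c]] j tax_rwh_over_lwh by simp
  then show ?thesis
    using distrib_right[OF j(2) tax_rwh_over_lwh(3) c] tax_rwh_over_lwh j by simp
next
  case (tax_rwh_over_rwh u i v a')
  then obtain j where j: "dm C v = Suc j" "i < j" by (cases "dm C v") auto
  then have c: "composable C j (tb e a') v" "composable C i (cmp C j (tb e a') v) u"
    using tax_rwh_over_rwh assms(2) by (auto simp: wf_RWh simp del: twf.simps(5))
  have "dm C (cmp C i v u) = Suc j"
    using composableD(8)[OF composable_distrib_right(2)[OF j(2) tax_rwh_over_rwh(3) c]] j tax_rwh_over_rwh by simp
  then show ?thesis
    using distrib_right[OF j(2) tax_rwh_over_rwh(3) c] tax_rwh_over_rwh j by simp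
qed (auto split: side.splits)

lemma eq_wf_tb: "eq a b \<Longrightarrow> wf a \<and> wf b \<and> (\<forall>e. tb e a = tb e b)"
proof (induction rule: teq.induct)
  case (teq_ax a b)
  then show ?case using tax_tb by blast
qed (auto split: side.splits)

text \<open>A well-formed term lies in its own class, because \<open>teq\<close> is reflexive
  exactly on well-formed terms; the converse is symmetry and transitivity.\<close>

lemma cl_eq_iff: "wf a \<Longrightarrow> cl a = cl b \<longleftrightarrow> eq a b"
proof
  assume w: "wf a" and "cl a = cl b"
  then have "tclass n C G d a = tclass n C G d b" by (simp add: cl_def)
  moreover have "a \<in> tclass n C G d a" using w by (simp add: tclass_def teq_refl)
  ultimately show "eq a b" by (simp add: tclass_def teq_sym)
next
  assume e: "eq a b"
  have "eq a t \<longleftrightarrow> eq b t" for t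
    using teq_trans[OF e, of t] teq_trans[OF teq_sym[OF e], of t] by blast
  then have "tclass n C G d a = tclass n C G d b" unfolding tclass_def by (intro Collect_cong)
  then show "cl a = cl b" by (simp add: cl_def)
qed

lemma cl_eqI: "eq a b \<Longrightarrow> cl a = cl b"
  using cl_eq_iff[of a b] eq_wf_tb[of a b] by simp

lemma rep_cl:
  assumes "wf a" shows "eq a (rep (tclass n C G d a))"
proof -
  have "a \<in> tclass n C G d a" by (simp add: tclass_def teq_refl assms)
  then have "rep (tclass n C G d a) \<in> tclass n C G d a" unfolding rep_def by (rule someI)
  then show ?thesis by (simp add: tclass_def)
qed

section \<open>Cells and operations of the extension\<close>

lemma E_car: "car E = Old ` car C \<union> cl ` {t. wf t}"
  by (auto simp: free_ext_def cl_def)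

lemma E_carE:
  assumes "c \<in> car E"
  obtains (Old) x where "c = Old x" "x \<in> car C" | (New) t where "c = cl t" "wf t"
  using assms by (auto simp: E_car)

lemma Old_car [simp]: "Old x \<in> car E \<longleftrightarrow> x \<in> car C"
  and cl_car [simp]: "wf t \<Longrightarrow> cl t \<in> car E"
  and Old_neq_cl [simp]: "Old x \<noteq> cl t" "cl t \<noteq> Old x"
  and dm_Old [simp]: "dm E (Old x) = dm C x"
  and dm_cl [simp]: "dm E (cl t) = Suc n"
  and bd_Old [simp]: "bd E e (Old x) = Old (bd C e x)"
  and idc_Old: "dm C x < n \<Longrightarrow> idc E (Old x) = Old (idc C x)"
  and cmp_Old_Old [simp]: "cmp E i (Old x) (Old y) = Old (cmp C i x y)"
  by (auto simp: E_car) (auto simp: free_ext_def cl_def)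

lemma idc_Old_top: "dm C x = n \<Longrightarrow> idc E (Old x) = cl (Unit x)"
  unfolding free_ext_def cl_def by simp

lemma bd_cl [simp]: "wf t \<Longrightarrow> bd E e (cl t) = Old (tb e t)"
  using eq_wf_tb[OF rep_cl, of t] by (auto simp: free_ext_def cl_def)

text \<open>\<open>free_ext\<close> composes with a chosen representative; stability of
  \<open>teq\<close> under whiskering makes the choice immaterial.\<close>

lemma cmp_Old_cl [simp]: "wf (LWh u t) \<Longrightarrow> cmp E i (Old u) (cl t) = cl (LWh u t)"
proof -
  assume w: "wf (LWh u t)"
  have "cmp E i (Old u) (cl t) = cl (LWh u (rep (tclass n C G d t)))"
    by (auto simp: free_ext_def cl_def)
  also have "\<dots> = cl (LWh u t)"
    using w by (intro cl_eqI teq_sym[OF teq_lwh] rep_cl) auto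
  finally show ?thesis .
qed

lemma cmp_cl_Old [simp]: "wf (RWh t u) \<Longrightarrow> cmp E i (cl t) (Old u) = cl (RWh t u)"
proof -
  assume w: "wf (RWh t u)"
  have "cmp E i (cl t) (Old u) = cl (RWh (rep (tclass n C G d t)) u)"
    by (auto simp: free_ext_def cl_def)
  also have "\<dots> = cl (RWh t u)"
    using w by (intro cl_eqI teq_sym[OF teq_rwh] rep_cl) auto
  finally show ?thesis .
qed

lemma cmp_cl_cl [simp]: "wf (Cat s t) \<Longrightarrow> cmp E i (cl s) (cl t) = cl (Cat s t)"
proof -
  assume w: "wf (Cat s t)"
  have "cmp E i (cl s) (cl t) = cl (Cat (rep (tclass n C G d s)) (rep (tclass n C G d t)))"
    by (auto simp: free_ext_def cl_def)
  also have "\<dots> = cl (Cat s t)"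
    using w by (intro cl_eqI teq_sym[OF teq_cat] rep_cl) auto
  finally show ?thesis .
qed

lemma bd_iter_Old: "(bd E e ^^ k) (Old x) = Old ((bd C e ^^ k) x)"
  by (induction k) auto

lemma bdi_Old [simp]: "bdi E e i (Old x) = Old (bdi C e i x)"
  by (simp add: bdi_def bd_iter_Old)

lemma bdi_cl: "wf t \<Longrightarrow> i \<le> n \<Longrightarrow> bdi E e i (cl t) = Old (bdi C e i (tb e t))"
  using tb_cells[of t e] by (subst bdi_bd_Suc[of _ _ n]) (auto simp: cells_iff)

lemma composable_Old_Old [simp]: "composable E i (Old u) (Old v) \<longleftrightarrow> composable C i u v"
  by (simp add: composable_def joinable_def)

lemma composable_Old_cl:
  assumes "wf t" shows "composable E i (Old u) (cl t) \<longleftrightarrow> dm C u = Suc i \<and> wf (LWh u t)"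
proof (cases "u \<in> car C \<and> dm C u = Suc i")
  case True
  have t: "tb Src t \<in> car C" "dm C (tb Src t) = n"
    using tb_cells[OF assms, of Src] by (simp_all add: cells_iff)
  have "i < n" using True dm_le by fastforce
  then show ?thesis using True t assms
    by (simp add: composable_def joinable_def bdi_cl)
next
  case False
  have "u \<in> car C \<Longrightarrow> min (dm C u) (Suc n) = dm C u" using dm_le by fastforce
  then show ?thesis using False
    by (auto simp: composable_def joinable_def min.commute)
qed

lemma composable_cl_Old:
  assumes "wf t" shows "composable E i (cl t) (Old u) \<longleftrightarrow> dm C u = Suc i \<and> wf (RWh t u)"
proof (cases "u \<in> car C \<and> dm C u = Suc i")
  case True
  have t: "tb Tgt t \<in> car C" "dm C (tb Tgt t) = n"
    using tb_cells[OF assms, of Tgt] by (simp_all add: cells_iff)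
  have "i < n" using True dm_le by fastforce
  then show ?thesis using True t assms
    by (simp add: composable_def joinable_def bdi_cl)
next
  case False
  have "u \<in> car C \<Longrightarrow> min (dm C u) (Suc n) = dm C u" using dm_le by fastforce
  then show ?thesis using False
    by (auto simp: composable_def joinable_def min.commute)
qed

lemma composable_cl_cl:
  assumes "wf s" "wf t" shows "composable E i (cl s) (cl t) \<longleftrightarrow> i = n \<and> wf (Cat s t)"
proof -
  have "dm C (tb Tgt s) = n" "dm C (tb Src t) = n"
    using tb_cells[OF assms(1), of Tgt] tb_cells[OF assms(2), of Src] by (auto simp: cells_iff)
  then have "bdi C Tgt n (tb Tgt s) = tb Tgt s" "bdi C Src n (tb Src t) = tb Src t"
    using bdi_dm[of C Tgt "tb Tgt s"] bdi_dm[of C Src "tb Src t"] by auto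
  then show ?thesis using assms by (auto simp: composable_def joinable_def bdi_cl)
qed

lemmas E_composable = composable_Old_cl composable_cl_Old composable_cl_cl

lemma E_cells_le: "k \<le> n \<Longrightarrow> cells E k = Old ` cells C k"
  by (auto simp: cells_iff elim!: E_carE)

lemma E_cells_top: "cells E (Suc n) = cl ` {t. wf t}"
  using dm_le by (fastforce simp: cells_iff elim!: E_carE)

lemma E_composableE:
  assumes "composable E i u v"
  obtains (Old_Old) x y where "u = Old x" "v = Old y" "composable C i x y"
  | (Old_cl) x t where "u = Old x" "v = cl t" "dm C x = Suc i" "i < n" "wf t" "wf (LWh x t)"
  | (cl_Old) s x where "u = cl s" "v = Old x" "dm C x = Suc i" "i < n" "wf s" "wf (RWh s x)"
  | (cl_cl) s t where "u = cl s" "v = cl t" "i = n" "wf s" "wf t" "wf (Cat s t)"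
proof -
  have le: "dm C x = Suc i \<Longrightarrow> x \<in> car C \<Longrightarrow> i < n" for x using dm_le by fastforce
  have "u \<in> car E" "v \<in> car E" using assms by (auto simp: composable_def joinable_def)
  then show ?thesis
  proof (elim E_carE)
    fix x y assume "u = Old x" "v = Old y"
    then show ?thesis using assms that(1) by simp
  next
    fix x t assume a: "u = Old x" "x \<in> car C" "v = cl t" "wf t"
    then have "dm C x = Suc i" "wf (LWh x t)" using assms by (simp_all add: composable_Old_cl del: twf.simps)
    then show ?thesis using a that(2) le by blast
  next
    fix s x assume a: "u = cl s" "wf s" "v = Old x" "x \<in> car C"
    then have "dm C x = Suc i" "wf (RWh s x)" using assms by (simp_all add: composable_cl_Old del: twf.simps)
    then show ?thesis using a that(3) le by blast
  next
    fix s t assume a: "u = cl s" "wf s" "v = cl t" "wf t"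
    then have "i = n" "wf (Cat s t)" using assms by (simp_all add: composable_cl_cl del: twf.simps)
    then show ?thesis using a that(4) by blast
  qed
qed

lemma E_boundary: "precat_boundary (Suc n) E"
proof (intro precat_boundary.intro, goal_cases)
  case (1 u)
  then show ?case by (cases rule: E_carE) (auto dest: dm_le)
next
  case (2 u k e)
  then have "u \<in> car E" by (simp add: cells_iff)
  then show ?case
  proof (cases rule: E_carE)
    case (Old x)
    then show ?thesis using 2 bd_cells[of x k e] by (auto simp: cells_iff)
  next
    case (New t)
    then have "k = n" using 2 by (simp add: cells_iff)
    then show ?thesis using New tb_cells[of t e] by (simp add: cells_iff)
  qed
next
  case (3 u k e)
  then have "u \<in> car E" by (simp add: cells_iff)
  then show ?case
  proof (cases rule: E_carE)
    case (Old x)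
    then show ?thesis using 3 globular[of x k e] by (auto simp: cells_iff)
  next
    case (New t)
    then have "n = Suc k" using 3 by (auto simp: cells_iff)
    then have "bd C e (tb Src t) = bd C e (tb Tgt t)"
      using New tb_parallel[of t k e Tgt] bdi_pred[of "tb Src t" k e] bdi_pred[of "tb Tgt t" k e]
        tb_cells[of t Src] tb_cells[of t Tgt] by simp
    then show ?thesis using New by simp
  qed
next
  case (4 i u v)
  then show ?case
    by (cases rule: E_composableE) (use cmp_cells in \<open>auto simp: cells_iff max_def simp del: twf.simps\<close>)
next
  case (5 i u v e)
  from 5(1) show ?case
    by (cases rule: E_composableE) (use 5(2) bd_cmp_less in \<open>auto simp del: twf.simps\<close>)
next
  case (6 i u v e)
  from 6(1) show ?case
    by (cases rule: E_composableE) (use 6(2) bd_cmp_greater in \<open>auto simp del: twf.simps\<close>)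
next
  case (7 i u v)
  from 7(1) show ?case
    by (cases rule: E_composableE) (use 7(2) src_cmp_eq in \<open>auto simp del: twf.simps\<close>)
next
  case (8 i u v)
  from 8(1) show ?case
    by (cases rule: E_composableE) (use 8(2) tgt_cmp_eq in \<open>auto simp del: twf.simps\<close>)
qed

end

sublocale free_extension \<subseteq> ext: precat_boundary "Suc n" E
  by (rule E_boundary)

section \<open>Laws of composition in the extension\<close>

context free_extension
begin

lemma cl_taxI: "tax n C a b \<Longrightarrow> wf a \<Longrightarrow> wf b \<Longrightarrow> cl a = cl b"
  by (intro cl_eqI teq_ax)

lemma E_idc:
  assumes "u \<in> cells E k" "k < Suc n"
  shows "idc E u \<in> cells E (Suc k) \<and> bd E e (idc E u) = u"
proof -
  obtain x where x: "u = Old x" "x \<in> cells C k" using assms E_cells_le[of k] by auto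
  show ?thesis
  proof (cases "k = n")
    case True
    then show ?thesis using x by (simp add: cells_iff idc_Old_top)
  next
    case False
    then show ?thesis using x assms(2) idc_cells[of x k] bd_idc[of x k e]
      by (simp add: cells_iff idc_Old)
  qed
qed

lemma E_cmp_idc_left:
  assumes "x \<in> cells E i" "i < Suc n" "composable E i (idc E x) v"
  shows "cmp E i (idc E x) v = v"
proof -
  obtain y where y: "x = Old y" "y \<in> cells C i" using assms E_cells_le[of i] by auto
  have v: "v \<in> car E" using assms(3) by (simp add: composable_def joinable_def)
  show ?thesis
  proof (cases "i = n")
    case True
    then have i: "idc E x = cl (Unit y)" "y \<in> cells C n" using y by (simp_all add: cells_iff idc_Old_top)
    from v show ?thesis
    proof (cases rule: E_carE)
      case (Old z)
      then show ?thesis using dm_le[of z] assms(3) True i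
        by (simp add: composable_def joinable_def)
    next
      case (New t)
      then show ?thesis using assms(3) i
        by (auto simp: composable_cl_cl intro!: cl_taxI tax_unit_cat)
    qed
  next
    case False
    then have i: "idc E x = Old (idc C y)" "y \<in> car C" "dm C y = i" "i < n"
      using y assms(2) by (simp_all add: cells_iff idc_Old)
    from v show ?thesis
    proof (cases rule: E_carE)
      case (Old z)
      then show ?thesis using assms(3) i cmp_idc_left[of y i z] y by simp
    next
      case (New t)
      then have "wf (LWh (idc C y) t)" using assms(3) i composable_Old_cl[of t i "idc C y"] by (simp del: twf.simps)
      then show ?thesis using New i by (simp add: cl_taxI tax_idc_lwh del: twf.simps)
    qed
  qed
qed

lemma E_cmp_idc_right:
  assumes "x \<in> cells E i" "i < Suc n" "composable E i v (idc E x)"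
  shows "cmp E i v (idc E x) = v"
proof -
  obtain y where y: "x = Old y" "y \<in> cells C i" using assms E_cells_le[of i] by auto
  have v: "v \<in> car E" using assms(3) by (simp add: composable_def joinable_def)
  show ?thesis
  proof (cases "i = n")
    case True
    then have i: "idc E x = cl (Unit y)" "y \<in> cells C n" using y by (simp_all add: cells_iff idc_Old_top)
    from v show ?thesis
    proof (cases rule: E_carE)
      case (Old z)
      then show ?thesis using dm_le[of z] assms(3) True i
        by (simp add: composable_def joinable_def)
    next
      case (New t)
      then show ?thesis using assms(3) i
        by (auto simp: composable_cl_cl intro!: cl_taxI tax_cat_unit)
    qed
  next
    case False
    then have i: "idc E x = Old (idc C y)" "y \<in> car C" "dm C y = i" "i < n"
      using y assms(2) by (simp_all add: cells_iff idc_Old)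
    from v show ?thesis
    proof (cases rule: E_carE)
      case (Old z)
      then show ?thesis using assms(3) i cmp_idc_right[of y i z] y by simp
    next
      case (New t)
      then have "wf (RWh t (idc C y))" using assms(3) i composable_cl_Old[of t i "idc C y"] by (simp del: twf.simps)
      then show ?thesis using New i by (simp add: cl_taxI tax_rwh_idc del: twf.simps)
    qed
  qed
qed

lemma E_idc_cmp:
  assumes "composable E i u v" "dm E u < Suc n" "dm E v = Suc i"
  shows "cmp E i (idc E u) v = idc E (cmp E i u v)"
proof -
  have "u \<in> car E" "v \<in> car E" "Suc i \<le> dm E u" using assms(1) by (auto simp: composable_def joinable_def)
  then obtain x y where xy: "u = Old x" "v = Old y" "x \<in> car C" "y \<in> car C"
    using assms(2,3) by (auto elim!: E_carE)
  then have c: "composable C i x y" and d: "dm C y = Suc i" "dm C x \<le> n" using assms by simp_all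
  have dc: "dm C (cmp C i x y) = dm C x" using composableD[OF c] d by simp
  show ?thesis
  proof (cases "dm C x = n")
    case True
    then have "wf (RWh (Unit x) y)" "wf (Unit (cmp C i x y))"
      using c d xy cmp_cells[OF c] dc by (auto simp: cells_iff)
    then show ?thesis using xy True dc cl_taxI[OF tax_unit_rwh, of x y] d
      by (simp add: idc_Old_top del: twf.simps)
  next
    case False
    then have "dm C x < n" using d by simp
    then show ?thesis using xy dc idc_cmp[OF c _ d(1)] by (simp add: idc_Old)
  qed
qed

lemma E_cmp_idc:
  assumes "composable E i v u" "dm E u < Suc n" "dm E v = Suc i"
  shows "cmp E i v (idc E u) = idc E (cmp E i v u)"
proof -
  have "u \<in> car E" "v \<in> car E" "Suc i \<le> dm E u" using assms(1) by (auto simp: composable_def joinable_def)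
  then obtain x y where xy: "u = Old x" "v = Old y" "x \<in> car C" "y \<in> car C"
    using assms(2,3) by (auto elim!: E_carE)
  then have c: "composable C i y x" and d: "dm C y = Suc i" "dm C x \<le> n" using assms by simp_all
  have dc: "dm C (cmp C i y x) = dm C x" using composableD[OF c] d by simp
  show ?thesis
  proof (cases "dm C x = n")
    case True
    then have "wf (LWh y (Unit x))" "wf (Unit (cmp C i y x))"
      using c d xy cmp_cells[OF c] dc by (auto simp: cells_iff)
    then show ?thesis using xy True dc cl_taxI[OF tax_lwh_unit, of y x] d
      by (simp add: idc_Old_top del: twf.simps)
  next
    case False
    then have "dm C x < n" using d by simp
    then show ?thesis using xy dc cmp_idc[OF c _ d(1)] by (simp add: idc_Old)
  qed
qed

text \<open>With three old factors the law is that of \<open>C\<close>; with exactly one new factor,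
  or three, it is an axiom on terms. Exactly two new factors cannot occur: new cells compose with
  each other only along dimension \<open>n\<close>, whereas a composition involving an old cell
  takes place below \<open>n\<close>.\<close>

lemma E_assoc:
  assumes c: "composable E i u v" "composable E i (cmp E i u v) w"
    "composable E i v w" "composable E i u (cmp E i v w)"
  shows "cmp E i (cmp E i u v) w = cmp E i u (cmp E i v w)"
proof -
  note [simp] = E_composable
  note [simp del] = twf.simps
  have i: "i < n" if "Old x = u \<or> Old x = v \<or> Old x = w" for x
    using c that dm_le[of x] by (auto simp: composable_def joinable_def)
  have "u \<in> car E" "v \<in> car E" "w \<in> car E" using c by (auto simp: composable_def joinable_def)
  then show ?thesis
  proof (elim E_carE)
    fix x y z assume *: "u = Old x" "v = Old y" "w = Old z"
    show ?thesis using c assoc[of i x y z] unfolding * by simp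
  next
    fix x y z assume *: "u = Old x" "v = Old y" "w = cl z" "wf z"
    show ?thesis using c tax_lwh_lwh[of C x i y n z] *(4) unfolding *(1-3) by (auto simp: cl_taxI)
  next
    fix x y z assume *: "u = Old x" "v = cl y" "w = Old z" "wf y"
    show ?thesis using c tax_lwh_rwh[of C x z n y] *(4) unfolding *(1-3) by (auto simp: cl_taxI)
  next
    fix x y z assume *: "u = cl x" "v = Old y" "w = Old z" "wf x"
    show ?thesis using c tax_rwh_rwh[of C y i z n x] *(4) unfolding *(1-3) by (auto simp: cl_taxI)
  next
    fix x y z assume *: "u = cl x" "v = cl y" "w = cl z" "wf x" "wf y" "wf z"
    show ?thesis using c tax_cat_cat[of n C x y z] *(4-6) unfolding *(1-3) by (auto simp: cl_taxI)
  next
    fix x y z assume *: "u = Old x" "v = cl y" "w = cl z" "wf y" "wf z"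
    show ?thesis using c(3) i[of x] *(4-) unfolding *(1-3) by simp
  next
    fix x y z assume *: "u = cl x" "v = Old y" "w = cl z" "wf x" "wf z"
    show ?thesis using c(1,2) i[of y] *(4-) unfolding *(1-3) by simp
  next
    fix x y z assume *: "u = cl x" "v = cl y" "w = Old z" "wf x" "wf y"
    show ?thesis using c(1) i[of z] *(4-) unfolding *(1-3) by simp
  qed
qed

lemma E_distrib_left:
  assumes ij: "i < j" "dm E u = Suc i" and c: "composable E j v v'" "composable E i u (cmp E j v v')"
  shows "cmp E i u (cmp E j v v') = cmp E j (cmp E i u v) (cmp E i u v')"
proof -
  note [simp] = E_composable
  note [simp del] = twf.simps
  note D = ext.composable_distrib_left[OF ij c]
  have car: "u \<in> car E" "v \<in> car E" "v' \<in> car E" using c by (auto simp: composable_def joinable_def)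
  \<comment> \<open>The whisker has dimension \<open>Suc i < Suc j\<close>, hence at most
    \<open>n\<close>, so it is an old cell.\<close>
  have "Suc j \<le> Suc n" using c(1) ext.dm_le' by (fastforce simp: composable_def joinable_def)
  then obtain x where x: "u = Old x" "x \<in> car C" using car(1) ij by (auto elim!: E_carE)
  from car(2,3) show ?thesis
  proof (elim E_carE)
    fix y z assume *: "v = Old y" "v' = Old z"
    show ?thesis using c ij distrib_left[of i j x y z] unfolding * x by simp
  next
    fix y z assume *: "v = Old y" "v' = cl z" "wf z"
    show ?thesis using c ij D tax_lwh_over_lwh[of C x i y n z] *(3) unfolding *(1,2) x by (auto simp: cl_taxI)
  next
    fix y z assume *: "v = cl y" "v' = Old z" "wf y"
    show ?thesis using c ij D tax_lwh_over_rwh[of C x i z n y] *(3) unfolding *(1,2) x by (auto simp: cl_taxI)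
  next
    fix y z assume *: "v = cl y" "v' = cl z" "wf y" "wf z"
    show ?thesis using c ij D tax_lwh_cat[of n C x y z] *(3-) unfolding *(1,2) x by (auto simp: cl_taxI)
  qed
qed

lemma E_distrib_right:
  assumes ij: "i < j" "dm E u = Suc i" and c: "composable E j v v'" "composable E i (cmp E j v v') u"
  shows "cmp E i (cmp E j v v') u = cmp E j (cmp E i v u) (cmp E i v' u)"
proof -
  note [simp] = E_composable
  note [simp del] = twf.simps
  note D = ext.composable_distrib_right[OF ij c]
  have car: "u \<in> car E" "v \<in> car E" "v' \<in> car E" using c by (auto simp: composable_def joinable_def)
  have "Suc j \<le> Suc n" using c(1) ext.dm_le' by (fastforce simp: composable_def joinable_def)
  then obtain x where x: "u = Old x" "x \<in> car C" using car(1) ij by (auto elim!: E_carE)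
  from car(2,3) show ?thesis
  proof (elim E_carE)
    fix y z assume *: "v = Old y" "v' = Old z"
    show ?thesis using c ij distrib_right[of i j x y z] unfolding * x by simp
  next
    fix y z assume *: "v = Old y" "v' = cl z" "wf z"
    show ?thesis using c ij D tax_rwh_over_lwh[of C x i y n z] *(3) unfolding *(1,2) x by (auto simp: cl_taxI)
  next
    fix y z assume *: "v = cl y" "v' = Old z" "wf y"
    show ?thesis using c ij D tax_rwh_over_rwh[of C x i z n y] *(3) unfolding *(1,2) x by (auto simp: cl_taxI)
  next
    fix y z assume *: "v = cl y" "v' = cl z" "wf y" "wf z"
    show ?thesis using c ij D tax_cat_rwh[of n C y z x] *(3-) unfolding *(1,2) x by (auto simp: cl_taxI)
  qed
qed

lemma E_precategory: "precategory (Suc n) E"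
  by (rule precategory.intro)
    (fact ext.dm_le' ext.bd_cells' ext.globular' ext.cmp_cells' ext.bd_cmp_less' ext.bd_cmp_greater'
      ext.src_cmp_eq' ext.tgt_cmp_eq' E_idc[THEN conjunct1] E_idc[THEN conjunct2] E_cmp_idc_left
      E_cmp_idc_right E_idc_cmp E_cmp_idc E_assoc E_distrib_left E_distrib_right)+

end

section \<open>Quotients of precategories\<close>

context precategory
begin

text \<open>Filling the free side with this identity turns the two-sided stability required of a
  congruence into stability on one side.\<close>

lemma cmp_unit_right:
  assumes "u \<in> car C" "i < dm C u"
  shows "idc C (bdi C Tgt i u) \<in> cells C (Suc i)" "composable C i u (idc C (bdi C Tgt i u))"
    "cmp C i u (idc C (bdi C Tgt i u)) = u"
proof -
  have i: "i < n" using assms dm_le by fastforce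
  have z: "bdi C Tgt i u \<in> cells C i" using bdi_cells[OF assms(1)] assms(2) by simp
  show 1: "idc C (bdi C Tgt i u) \<in> cells C (Suc i)" by (rule idc_cells[OF z i])
  show 2: "composable C i u (idc C (bdi C Tgt i u))"
    using 1 assms bdi_pred[OF 1] bd_idc[OF z i] by (simp add: composable_def joinable_def cells_iff)
  show "cmp C i u (idc C (bdi C Tgt i u)) = u" by (rule cmp_idc_right[OF z i 2])
qed

lemma cmp_unit_left:
  assumes "u \<in> car C" "i < dm C u"
  shows "idc C (bdi C Src i u) \<in> cells C (Suc i)" "composable C i (idc C (bdi C Src i u)) u"
    "cmp C i (idc C (bdi C Src i u)) u = u"
proof -
  have i: "i < n" using assms dm_le by fastforce
  have z: "bdi C Src i u \<in> cells C i" using bdi_cells[OF assms(1)] assms(2) by simp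
  show 1: "idc C (bdi C Src i u) \<in> cells C (Suc i)" by (rule idc_cells[OF z i])
  show 2: "composable C i (idc C (bdi C Src i u)) u"
    using 1 assms bdi_pred[OF 1] bd_idc[OF z i] by (simp add: composable_def joinable_def cells_iff)
  show "cmp C i (idc C (bdi C Src i u)) u = u" by (rule cmp_idc_left[OF z i 2])
qed

end

section \<open>The quotient by a fixed congruence\<close>

locale quotient_by_congruence = precategory n C for n and C :: "'c precat" +
  fixes R :: "('c \<times> 'c) set"
  assumes cong: "congruence n C R"
begin

abbreviation Q where "Q \<equiv> quotient_precat n C R"
abbreviation q where "q \<equiv> qclass n C R"

lemma equiv_R: "equiv (cells C n) R"
  using cong by (simp add: congruence_def)

lemma R_cells: "(u, u') \<in> R \<Longrightarrow> u \<in> cells C n \<and> u' \<in> cells C n"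
  using equiv_R by (auto simp: equiv_def refl_on_def)

lemma R_bd: "(u, u') \<in> R \<Longrightarrow> bd C e u = bd C e u'"
  using cong by (simp add: congruence_def)

lemma R_bdi: assumes "(u, u') \<in> R" "i < n" shows "bdi C e i u = bdi C e i u'"
proof -
  obtain k where "n = Suc k" using assms(2) by (cases n) auto
  then show ?thesis using assms R_cells[OF assms(1)] R_bd[OF assms(1)]
      bdi_Suc[of u k i e] bdi_Suc[of u' k i e] by simp
qed

lemma R_composable_right: "(u, u') \<in> R \<Longrightarrow> i < n \<Longrightarrow> composable C i v u \<longleftrightarrow> composable C i v u'"
  using R_cells[of u u'] R_bdi[of u u' i Src] by (auto simp: composable_def joinable_def cells_iff)

lemma R_cmp:
  assumes "(u, u') \<in> R" "i < n" "v \<in> cells C (Suc i)" "w \<in> cells C (Suc i)"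
    "composable C i v u" "composable C i (cmp C i v u) w"
  shows "(cmp C i (cmp C i v u) w, cmp C i (cmp C i v u') w) \<in> R"
  using cong assms unfolding congruence_def by blast

text \<open>The second whisker in the stability condition is taken to be an identity. Related cells
  have the same \<open>i\<close>-boundary, so a single identity is a unit for both
  composites.\<close>

lemma R_cmp_left:
  assumes R: "(u, u') \<in> R" and v: "dm C v = Suc i" and c: "composable C i v u"
  shows "(cmp C i v u, cmp C i v u') \<in> R"
proof -
  note D = composableD[OF c]
  have i: "i < n" using D(4) R_cells[OF R] by (simp add: cells_iff)
  have c': "composable C i v u'" using c R_composable_right[OF R i] by simp
  note D' = composableD[OF c']
  have "bdi C Tgt i (cmp C i v u) = bdi C Tgt i (cmp C i v u')"
    using bdi_tgt_cmp[OF c] bdi_tgt_cmp[OF c'] R_bdi[OF R i] by simp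
  then show ?thesis
    using R_cmp[OF R i _ _ c, of "idc C (bdi C Tgt i (cmp C i v u))"]
      cmp_unit_right[of "cmp C i v u" i] cmp_unit_right[of "cmp C i v u'" i] D D' v
    by (simp add: cells_iff)
qed

lemma R_cmp_right:
  assumes R: "(u, u') \<in> R" and v: "dm C v = Suc i" and c: "composable C i u v"
  shows "(cmp C i u v, cmp C i u' v) \<in> R"
proof -
  note D = composableD[OF c]
  have i: "i < n" using D(3) R_cells[OF R] by (simp add: cells_iff)
  have u: "u \<in> car C" "i < dm C u" "u' \<in> car C" "i < dm C u'" using R_cells[OF R] i by (simp_all add: cells_iff)
  show ?thesis
    using R_cmp[OF R i _ _ cmp_unit_left(2)[OF u(1,2)], of v] c v D
      cmp_unit_left[OF u(1,2)] cmp_unit_left[OF u(3,4)] R_bdi[OF R i, of Src]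
    by (simp add: cells_iff)
qed

lemma q_top: "x \<in> cells C n \<Longrightarrow> q x = R `` {x}"
  and q_below: "dm C x < n \<Longrightarrow> q x = {x}"
  by (simp_all add: qclass_def cells_iff)

lemma q_eq_top: "x \<in> cells C n \<Longrightarrow> y \<in> cells C n \<Longrightarrow> q x = q y \<longleftrightarrow> (x, y) \<in> R"
  using equiv_R by (simp add: q_top eq_equiv_class_iff)

lemma rep_q_top: assumes "x \<in> cells C n" shows "(x, rep (q x)) \<in> R"
proof -
  have "x \<in> R `` {x}" using assms equiv_R by (rule_tac equiv_class_self)
  then have "rep (R `` {x}) \<in> R `` {x}" unfolding rep_def by (rule someI)
  then show ?thesis using q_top[OF assms] by simp
qed

lemma rep_q_below: "dm C x < n \<Longrightarrow> rep (q x) = x"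
  by (simp add: q_below rep_def)

lemma rep_q:
  assumes "x \<in> car C"
  shows "rep (q x) \<in> car C" "dm C (rep (q x)) = dm C x" "q (rep (q x)) = q x"
    "bd C e (rep (q x)) = bd C e x"
proof -
  consider "dm C x < n" | "x \<in> cells C n" using dm_le[OF assms] assms by (fastforce simp: cells_iff)
  then have "rep (q x) \<in> car C \<and> dm C (rep (q x)) = dm C x \<and> q (rep (q x)) = q x \<and>
    bd C e (rep (q x)) = bd C e x"
  proof cases
    case 1
    then show ?thesis using assms by (simp add: rep_q_below)
  next
    case 2
    have "(x, rep (q x)) \<in> R" by (rule rep_q_top[OF 2])
    then have "rep (q x) \<in> cells C n" "bd C e (rep (q x)) = bd C e x" "q (rep (q x)) = q x"
      using R_cells R_bd q_eq_top[OF 2] by metis+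
    then show ?thesis using 2 by (simp add: cells_iff)
  qed
  then show "rep (q x) \<in> car C" "dm C (rep (q x)) = dm C x" "q (rep (q x)) = q x"
    "bd C e (rep (q x)) = bd C e x" by blast+
qed

text \<open>Classes below the top dimension are singletons, and representatives keep the dimension,
  so a low class never coincides with one of top dimension.\<close>

lemma q_inj:
  assumes "x \<in> car C" "y \<in> car C" "dm C x < n"
  shows "q x = q y \<longleftrightarrow> x = y"
  using rep_q(2)[OF assms(1)] rep_q(2)[OF assms(2)] rep_q_below[OF assms(3)] rep_q_below[of y] assms(3)
  by metis

lemma Q_car: "car Q = q ` car C"
  by (simp add: quotient_precat_def)

lemma dm_q [simp]: "x \<in> car C \<Longrightarrow> dm Q (q x) = dm C x"
  using rep_q(2) by (simp add: quotient_precat_def)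

lemma bd_q [simp]: "x \<in> car C \<Longrightarrow> bd Q e (q x) = q (bd C e x)"
  using rep_q(4) by (simp add: quotient_precat_def)

lemma idc_q [simp]: "dm C x < n \<Longrightarrow> idc Q (q x) = q (idc C x)"
  using rep_q_below by (simp add: quotient_precat_def)

lemma q_car [simp]: "x \<in> car C \<Longrightarrow> q x \<in> car Q"
  by (simp add: Q_car)

lemma Q_carE: assumes "u \<in> car Q" obtains x where "u = q x" "x \<in> car C"
  using assms by (auto simp: Q_car)

lemma Q_cells: "cells Q k = q ` cells C k"
  by (auto simp: cells_iff elim!: Q_carE)

lemma bdi_q:
  assumes "x \<in> car C" "i \<le> dm C x" shows "bdi Q e i (q x) = q (bdi C e i x)"
proof -
  have "k \<le> dm C x \<Longrightarrow> (bd Q e ^^ k) (q x) = q ((bd C e ^^ k) x)" for k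
  proof (induction k)
    case (Suc k)
    have "(bd C e ^^ k) x \<in> car C"
      using bdi_cells[OF assms(1), of "dm C x - k" e] Suc(2) by (simp add: bdi_def cells_iff)
    then show ?case using Suc by simp
  qed simp
  then show ?thesis using assms by (simp add: bdi_def)
qed

text \<open>Matching is an equation between cells of dimension \<open>i < n\<close>, where
  \<open>q\<close> is injective; so it is reflected as well as preserved.\<close>

lemma joinable_q [simp]:
  assumes "x \<in> car C" "y \<in> car C" shows "joinable Q i (q x) (q y) \<longleftrightarrow> joinable C i x y"
proof (cases "i < dm C x \<and> i < dm C y")
  case True
  then have "bdi C Tgt i x \<in> cells C i" "bdi C Src i y \<in> cells C i" "i < n"
    using assms bdi_cells dm_le[OF assms(1)] by simp_all
  then show ?thesis using True assms by (simp add: joinable_def bdi_q q_inj cells_iff)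
next
  case False
  then show ?thesis using assms by (auto simp: joinable_def)
qed

lemma composable_q [simp]:
  assumes "x \<in> car C" "y \<in> car C" shows "composable Q i (q x) (q y) \<longleftrightarrow> composable C i x y"
  using assms by (simp add: composable_def)

lemma composable_QE:
  assumes "composable Q i u v"
  obtains x y where "u = q x" "v = q y" "composable C i x y" "x \<in> car C" "y \<in> car C"
proof -
  have "u \<in> car Q" "v \<in> car Q" using assms by (simp_all add: composable_def joinable_def)
  then obtain x y where "u = q x" "v = q y" "x \<in> car C" "y \<in> car C" by (elim Q_carE)
  then show ?thesis using that assms by simp
qed

text \<open>Composition in the quotient uses chosen representatives. When both factors have top
  dimension they are replaced one at a time, so that each replacement is an instance of one-sided
  stability.\<close>

lemma cmp_q [simp]:
  assumes c: "composable C i x y" shows "cmp Q i (q x) (q y) = q (cmp C i x y)"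
proof -
  note D = composableD[OF c]
  have *: "cmp Q i (q x) (q y) = q (cmp C i (rep (q x)) (rep (q y)))"
    by (simp add: quotient_precat_def)
  consider "dm C x < n" "dm C y < n" | "dm C x < n" "y \<in> cells C n" | "x \<in> cells C n" "dm C y < n"
    | "x \<in> cells C n" "y \<in> cells C n"
    using dm_le[OF D(1)] dm_le[OF D(2)] D(1,2) by (fastforce simp: cells_iff)
  then show ?thesis
  proof cases
    case 1
    then show ?thesis using * by (simp add: rep_q_below)
  next
    case 2
    then have "(cmp C i x y, cmp C i x (rep (q y))) \<in> R"
      using c D(6) by (intro R_cmp_left rep_q_top) (auto simp: cells_iff)
    then show ?thesis using * 2 q_eq_top R_cells rep_q_below by metis
  next
    case 3
    then have "(cmp C i x y, cmp C i (rep (q x)) y) \<in> R"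
      using c D(6) by (intro R_cmp_right rep_q_top) (auto simp: cells_iff)
    then show ?thesis using * 3 q_eq_top R_cells rep_q_below by metis
  next
    case 4
    have i: "i < n" "Suc i = n" using 4 D(3,6) by (simp_all add: cells_iff)
    have r: "(x, rep (q x)) \<in> R" "(y, rep (q y)) \<in> R" using rep_q_top 4 by blast+
    have d: "dm C x = Suc i" "dm C y = Suc i" "dm C (rep (q y)) = Suc i"
      using 4 i R_cells[OF r(2)] by (simp_all add: cells_iff)
    have 1: "(cmp C i x y, cmp C i x (rep (q y))) \<in> R" by (rule R_cmp_left[OF r(2) d(1) c])
    have c': "composable C i x (rep (q y))" using c R_composable_right[OF r(2) i(1)] by simp
    have "(cmp C i x (rep (q y)), cmp C i (rep (q x)) (rep (q y))) \<in> R"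
      by (rule R_cmp_right[OF r(1) d(3) c'])
    then have "q (cmp C i x y) = q (cmp C i (rep (q x)) (rep (q y)))"
      using 1 q_eq_top R_cells by metis
    then show ?thesis using * by simp
  qed
qed

lemma q_cmp_dm [simp]:
  "composable C i x y \<Longrightarrow> cmp C i x y \<in> car C"
  "composable C i x y \<Longrightarrow> dm C (cmp C i x y) = max (dm C x) (dm C y)"
  by (rule composableD(7,8), assumption)+

text \<open>Every cell and every composable pair of the quotient lifts, and \<open>q\<close>
  commutes with the operations, so each axiom is the image of the same axiom of
  \<open>C\<close>.\<close>

lemma Q_precategory: "precategory n Q"
proof (intro precategory.intro, goal_cases)
  case (1 u)
  then show ?case by (auto elim!: Q_carE dest: dm_le)
next
  case (2 u k e)
  then show ?case using bd_cells by (auto simp: Q_cells cells_iff)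
next
  case (3 u k e)
  then obtain x where x: "u = q x" "x \<in> cells C (Suc (Suc k))" by (auto simp: Q_cells)
  then have "bd C e' x \<in> car C" "x \<in> car C" for e' using bd_cells by (auto simp: cells_iff)
  then show ?case using x globular[of x k e] by simp
next
  case (4 u k)
  then show ?case using idc_cells by (auto simp: Q_cells cells_iff)
next
  case (5 i u v)
  then show ?case using cmp_cells by (auto simp: Q_cells elim!: composable_QE)
next
  case (6 u k e)
  then obtain x where x: "u = q x" "x \<in> cells C k" by (auto simp: Q_cells)
  then show ?case using 6(2) idc_cells[of x k] bd_idc[of x k e] by (simp add: cells_iff)
next
  case (7 i u v e)
  then obtain x y where "u = q x" "v = q y" "composable C i x y" "x \<in> car C" "y \<in> car C"
    by (elim composable_QE)
  then show ?case using 7(2) bd_cmp_less composable_bd_right[of i x y e] by simp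
next
  case (8 i u v e)
  then obtain x y where "u = q x" "v = q y" "composable C i x y" "x \<in> car C" "y \<in> car C"
    by (elim composable_QE)
  then show ?case using 8(2) bd_cmp_greater composable_bd_left[of i x y e] by simp
next
  case (9 i u v)
  then show ?case using src_cmp_eq by (auto elim!: composable_QE)
next
  case (10 i u v)
  then show ?case using tgt_cmp_eq by (auto elim!: composable_QE)
next
  case (11 z i v)
  obtain x where x: "z = q x" "x \<in> cells C i" using 11 by (auto simp: Q_cells)
  have i: "idc Q z = q (idc C x)" "idc C x \<in> car C"
    using x 11(2) idc_cells[of x i] by (simp_all add: cells_iff)
  have "v \<in> car Q" using 11(3) by (simp add: composable_def joinable_def)
  then obtain y where "v = q y" "y \<in> car C" by (elim Q_carE)
  then show ?case using 11(3) i cmp_idc_left[OF x(2) 11(2), of y] by simp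
next
  case (12 z i v)
  obtain x where x: "z = q x" "x \<in> cells C i" using 12 by (auto simp: Q_cells)
  have i: "idc Q z = q (idc C x)" "idc C x \<in> car C"
    using x 12(2) idc_cells[of x i] by (simp_all add: cells_iff)
  have "v \<in> car Q" using 12(3) by (simp add: composable_def joinable_def)
  then obtain y where "v = q y" "y \<in> car C" by (elim Q_carE)
  then show ?case using 12(3) i cmp_idc_right[OF x(2) 12(2), of y] by simp
next
  case (13 i u v)
  then obtain x y where x: "u = q x" "v = q y" "composable C i x y" "x \<in> car C" "y \<in> car C"
    by (elim composable_QE)
  have i: "idc C x \<in> cells C (Suc (dm C x))" using 13 x idc_cells[of x "dm C x"] by (simp add: cells_iff)
  have d: "Suc i \<le> dm C x" using composableD[OF x(3)] by simp
  \<comment> \<open>The axiom of \<open>C\<close> gives the equation itself; this composability is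
    what allows \<open>q\<close> to move across the composite with the identity.\<close>
  then have "composable C i (idc C x) y"
    using x 13 i bdi_Suc[OF i, of i Tgt] bd_idc[of x "dm C x" Tgt]
    by (simp add: composable_def joinable_def cells_iff)
  then show ?case using idc_cmp[OF x(3)] x 13 d by simp
next
  case (14 i v u)
  then obtain x y where x: "v = q y" "u = q x" "composable C i y x" "x \<in> car C" "y \<in> car C"
    by (elim composable_QE)
  have i: "idc C x \<in> cells C (Suc (dm C x))" using 14 x idc_cells[of x "dm C x"] by (simp add: cells_iff)
  have d: "Suc i \<le> dm C x" using composableD[OF x(3)] by simp
  then have "composable C i y (idc C x)"
    using x 14 i bdi_Suc[OF i, of i Src] bd_idc[of x "dm C x" Src]
    by (simp add: composable_def joinable_def cells_iff)
  then show ?case using cmp_idc[OF x(3)] x 14 d by simp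
next
  case (15 i u v w)
  obtain x y where "u = q x" "v = q y" "composable C i x y" "x \<in> car C" "y \<in> car C"
    using 15(1) by (elim composable_QE)
  moreover have "w \<in> car Q" using 15 by (simp add: composable_def joinable_def)
  then obtain z where "w = q z" "z \<in> car C" by (elim Q_carE)
  ultimately show ?case using 15 assoc[of i x y z] by simp
next
  case (16 i j u v v')
  obtain x y where "v = q x" "v' = q y" "composable C j x y" "x \<in> car C" "y \<in> car C"
    using 16(3) by (elim composable_QE)
  moreover have "u \<in> car Q" using 16 by (simp add: composable_def joinable_def)
  then obtain z where "u = q z" "z \<in> car C" by (elim Q_carE)
  ultimately show ?case
    using 16 distrib_left[of i j z x y] composable_distrib_left[of i j z x y] by simp
next
  case (17 i j u v v')
  obtain x y where "v = q x" "v' = q y" "composable C j x y" "x \<in> car C" "y \<in> car C"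
    using 17(3) by (elim composable_QE)
  moreover have "u \<in> car Q" using 17 by (simp add: composable_def joinable_def)
  then obtain z where "u = q z" "z \<in> car C" by (elim Q_carE)
  ultimately show ?case
    using 17 distrib_right[of i j z x y] composable_distrib_right[of i j z x y] by simp
qed

end

text \<open>An intersection of congruences inherits stability, but over an empty family it would be
  the full relation: a member is needed to confine it to \<open>n\<close>-cells with equal
  boundaries. The relation \<open>T\<close> of being parallel serves, since the two boundaries of
  each generator are parallel.\<close>

lemma (in precat_boundary) presented_congruence:
  assumes "generators n C G d" "0 < n"
  shows "congruence n C (presented_congruence n C G d)"
    "A \<in> G \<Longrightarrow> (d Src A, d Tgt A) \<in> presented_congruence n C G d"
proof -
  define S where "S = {R. congruence n C R \<and> (\<forall>A\<in>G. (d Src A, d Tgt A) \<in> R)}"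
  have S: "presented_congruence n C G d = \<Inter>S" by (simp add: presented_congruence_def S_def)
  then show "A \<in> G \<Longrightarrow> (d Src A, d Tgt A) \<in> presented_congruence n C G d" by (auto simp: S_def)
  define T where "T = {(u, u'). u \<in> cells C n \<and> u' \<in> cells C n \<and> (\<forall>e. bd C e u = bd C e u')}"
  have T_bdi: "bdi C e i u = bdi C e i u'" if "(u, u') \<in> T" "i < n" for u u' e i
    using that assms(2) bdi_Suc[of u "n - 1" i e] bdi_Suc[of u' "n - 1" i e] by (simp add: T_def)
  have T_bd_cmp: "composable C i v u' \<and> (cmp C i v u, cmp C i v u') \<in> T"
    if "(u, u') \<in> T" "composable C i v u" for u u' v i
  proof -
    note D = composableD[OF that(2)]
    have d: "dm C u = n" "dm C u' = n" "u' \<in> car C" using that by (simp_all add: T_def cells_iff)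
    have c: "composable C i v u'" using D d T_bdi[OF that(1), of i Src]
      by (auto simp: composable_def joinable_def)
    have b: "bd C e u = bd C e u'" for e using that by (simp add: T_def)
    have "bd C e (cmp C i v u) = bd C e (cmp C i v u')" for e
    proof (cases "dm C v < n")
      case True
      then show ?thesis using bd_cmp_less'[OF that(2)] bd_cmp_less'[OF c] d b by simp
    next
      case False
      then show ?thesis using src_cmp_eq'[OF that(2)] src_cmp_eq'[OF c] tgt_cmp_eq'[OF that(2)]
        tgt_cmp_eq'[OF c] d b dm_le'[OF D(1)] by (cases e) auto
    qed
    then show ?thesis using c D(8) composableD[OF c] D(7) d dm_le'[OF D(1)]
      by (simp add: T_def cells_iff max_def)
  qed
  have T_bd_cmp': "composable C i u' v \<and> (cmp C i u v, cmp C i u' v) \<in> T"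
    if "(u, u') \<in> T" "composable C i u v" for u u' v i
  proof -
    note D = composableD[OF that(2)]
    have d: "dm C u = n" "dm C u' = n" "u' \<in> car C" using that by (simp_all add: T_def cells_iff)
    have c: "composable C i u' v" using D d T_bdi[OF that(1), of i Tgt]
      by (auto simp: composable_def joinable_def)
    have b: "bd C e u = bd C e u'" for e using that by (simp add: T_def)
    have "bd C e (cmp C i u v) = bd C e (cmp C i u' v)" for e
    proof (cases "dm C v < n")
      case True
      then show ?thesis using bd_cmp_greater'[OF that(2)] bd_cmp_greater'[OF c] d b by simp
    next
      case False
      then show ?thesis using src_cmp_eq'[OF that(2)] src_cmp_eq'[OF c] tgt_cmp_eq'[OF that(2)]
        tgt_cmp_eq'[OF c] d b dm_le'[OF D(2)] by (cases e) auto
    qed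
    then show ?thesis using c D(8) composableD[OF c] D(7) d dm_le'[OF D(2)]
      by (simp add: T_def cells_iff max_def)
  qed
  have T: "T \<in> S"
    using assms T_bd_cmp T_bd_cmp' unfolding S_def congruence_def generators_def
    by (auto simp: equiv_def refl_on_def sym_def trans_def) (auto simp: T_def)
  have C: "congruence n C R" if "R \<in> S" for R using that by (simp add: S_def)
  have "equiv (cells C n) (\<Inter>S)"
  proof (rule equivI)
    show "\<Inter>S \<subseteq> cells C n \<times> cells C n" using T by (auto simp: T_def)
    show "refl_on (cells C n) (\<Inter>S)" using C T
      by (auto simp: T_def refl_on_def congruence_def equiv_def)
    show "sym (\<Inter>S)" using C unfolding congruence_def equiv_def sym_def by blast
    show "trans (\<Inter>S)" using C unfolding congruence_def equiv_def trans_def by blast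
  qed
  moreover have "(u, u') \<in> \<Inter>S \<Longrightarrow> bd C e u = bd C e u'" for u u' e using T by (auto simp: T_def)
  moreover have "(cmp C i (cmp C i v u) w, cmp C i (cmp C i v u') w) \<in> \<Inter>S"
    if "(u, u') \<in> \<Inter>S" "i < n" "v \<in> cells C (Suc i)" "w \<in> cells C (Suc i)" "composable C i v u"
      "composable C i (cmp C i v u) w" for u u' i v w
    using that C unfolding congruence_def by blast
  ultimately show "congruence n C (presented_congruence n C G d)"
    unfolding S congruence_def by blast
qed

text \<open>The calculation rules below mention the dimension \<open>1\<close>, which must not become \<open>Suc 0\<close>.\<close>

declare One_nat_def [simp del]

section \<open>Calculating in 3-precategories\<close>

locale precat3 = precategory 3 C for C :: "'c precat"
begin

lemma bd_low:
  "u \<in> cells C 1 \<Longrightarrow> bd C e u \<in> cells C 0"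
  "u \<in> cells C 2 \<Longrightarrow> bd C e u \<in> cells C 1"
  "u \<in> cells C 3 \<Longrightarrow> bd C e u \<in> cells C 2"
  using bd_cells[of u 0 e] bd_cells[of u 1 e] bd_cells[of u 2 e] by (simp_all add: One_nat_def[symmetric])

text \<open>Oriented so that rewriting expresses every lower boundary through iterated sources; the
  composability criteria below are stated in the same normal form.\<close>

lemma globular_low:
  "u \<in> cells C 2 \<Longrightarrow> bd C e (tgt u) = bd C e (src u)"
  "u \<in> cells C 3 \<Longrightarrow> bd C e (tgt u) = bd C e (src u)"
  using globular[of u 0 e] globular[of u 1 e] by (simp_all add: eval_nat_numeral One_nat_def)

lemma bdi_low:
  "u \<in> cells C 1 \<Longrightarrow> bdi C e 0 u = bd C e u"
  "u \<in> cells C 2 \<Longrightarrow> bdi C e 0 u = bd C e (src u)"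
  "u \<in> cells C 3 \<Longrightarrow> bdi C e 0 u = bd C e (src (src u))"
  "u \<in> cells C 2 \<Longrightarrow> bdi C e 1 u = bd C e u"
  "u \<in> cells C 3 \<Longrightarrow> bdi C e 1 u = bd C e (src u)"
  "u \<in> cells C 3 \<Longrightarrow> bdi C e 2 u = bd C e u"
  using bdi_pred[of u 0 e] bdi_pred[of u 1 e] bdi_pred[of u 2 e]
    bdi_bd[of u 1 0 e Src] bdi_bd[of u 2 1 e Src] bdi_bd[of u 2 0 e Src]
    bdi_pred[of "src u" 0 e] bdi_pred[of "src u" 1 e]
    bdi_bd[of "src u" 1 0 e Src] bdi_pred[of "src (src u)" 0 e]
    bd_low[of u Src] bd_low[of "src u" Src]
  by (simp_all add: One_nat_def[symmetric])

lemma composable_iff_bd: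
  "u \<in> cells C 1 \<Longrightarrow> v \<in> cells C 1 \<Longrightarrow> composable C 0 u v \<longleftrightarrow> tgt u = src v"
  "u \<in> cells C 1 \<Longrightarrow> v \<in> cells C 2 \<Longrightarrow> composable C 0 u v \<longleftrightarrow> tgt u = src (src v)"
  "u \<in> cells C 2 \<Longrightarrow> v \<in> cells C 1 \<Longrightarrow> composable C 0 u v \<longleftrightarrow> tgt (src u) = src v"
  "u \<in> cells C 1 \<Longrightarrow> v \<in> cells C 3 \<Longrightarrow> composable C 0 u v \<longleftrightarrow> tgt u = src (src (src v))"
  "u \<in> cells C 3 \<Longrightarrow> v \<in> cells C 1 \<Longrightarrow> composable C 0 u v \<longleftrightarrow> tgt (src (src u)) = src v"
  "u \<in> cells C 2 \<Longrightarrow> v \<in> cells C 2 \<Longrightarrow> composable C 1 u v \<longleftrightarrow> tgt u = src v"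
  "u \<in> cells C 2 \<Longrightarrow> v \<in> cells C 3 \<Longrightarrow> composable C 1 u v \<longleftrightarrow> tgt u = src (src v)"
  "u \<in> cells C 3 \<Longrightarrow> v \<in> cells C 2 \<Longrightarrow> composable C 1 u v \<longleftrightarrow> tgt (src u) = src v"
  "u \<in> cells C 3 \<Longrightarrow> v \<in> cells C 3 \<Longrightarrow> composable C 2 u v \<longleftrightarrow> tgt u = src v"
  by (auto simp: composable_def joinable_def bdi_low cells_iff One_nat_def[symmetric])

lemma joinable_iff_bd:
  "u \<in> cells C 1 \<Longrightarrow> v \<in> cells C 1 \<Longrightarrow> joinable C 0 u v \<longleftrightarrow> tgt u = src v"
  "u \<in> cells C 1 \<Longrightarrow> v \<in> cells C 2 \<Longrightarrow> joinable C 0 u v \<longleftrightarrow> tgt u = src (src v)"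
  "u \<in> cells C 2 \<Longrightarrow> v \<in> cells C 1 \<Longrightarrow> joinable C 0 u v \<longleftrightarrow> tgt (src u) = src v"
  "u \<in> cells C 1 \<Longrightarrow> v \<in> cells C 3 \<Longrightarrow> joinable C 0 u v \<longleftrightarrow> tgt u = src (src (src v))"
  "u \<in> cells C 3 \<Longrightarrow> v \<in> cells C 1 \<Longrightarrow> joinable C 0 u v \<longleftrightarrow> tgt (src (src u)) = src v"
  "u \<in> cells C 2 \<Longrightarrow> v \<in> cells C 2 \<Longrightarrow> joinable C 1 u v \<longleftrightarrow> tgt u = src v"
  "u \<in> cells C 2 \<Longrightarrow> v \<in> cells C 3 \<Longrightarrow> joinable C 1 u v \<longleftrightarrow> tgt u = src (src v)"
  "u \<in> cells C 3 \<Longrightarrow> v \<in> cells C 2 \<Longrightarrow> joinable C 1 u v \<longleftrightarrow> tgt (src u) = src v"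
  "u \<in> cells C 3 \<Longrightarrow> v \<in> cells C 3 \<Longrightarrow> joinable C 2 u v \<longleftrightarrow> tgt u = src v"
  "u \<in> cells C 2 \<Longrightarrow> v \<in> cells C 2 \<Longrightarrow> joinable C 0 u v \<longleftrightarrow> tgt (src u) = src (src v)"
  "u \<in> cells C 2 \<Longrightarrow> v \<in> cells C 3 \<Longrightarrow> joinable C 0 u v \<longleftrightarrow> tgt (src u) = src (src (src v))"
  "u \<in> cells C 3 \<Longrightarrow> v \<in> cells C 2 \<Longrightarrow> joinable C 0 u v \<longleftrightarrow> tgt (src (src u)) = src (src v)"
  "u \<in> cells C 3 \<Longrightarrow> v \<in> cells C 3 \<Longrightarrow> joinable C 0 u v \<longleftrightarrow> tgt (src (src u)) = src (src (src v))"
  "u \<in> cells C 3 \<Longrightarrow> v \<in> cells C 3 \<Longrightarrow> joinable C 1 u v \<longleftrightarrow> tgt (src u) = src (src v)"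
  by (auto simp: joinable_def bdi_low cells_iff)

lemma cmp011:
  assumes "u \<in> cells C 1" "v \<in> cells C 1" "tgt u = src v"
  shows "cmp C 0 u v \<in> cells C 1" "src (cmp C 0 u v) = src u" "tgt (cmp C 0 u v) = tgt v"
proof -
  have c: "composable C 0 u v" using assms by (simp add: composable_iff_bd)
  have d: "dm C u = 1" "dm C v = 1" using assms by (simp_all add: cells_iff)
  show "cmp C 0 u v \<in> cells C 1" "src (cmp C 0 u v) = src u" "tgt (cmp C 0 u v) = tgt v"
    using cmp_cells[OF c] src_cmp_eq[OF c] tgt_cmp_eq[OF c] d by simp_all
qed

lemma cmp012:
  assumes "u \<in> cells C 1" "v \<in> cells C 2" "tgt u = src (src v)"
  shows "cmp C 0 u v \<in> cells C 2" "bd C e (cmp C 0 u v) = cmp C 0 u (bd C e v)"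
proof -
  have c: "composable C 0 u v" using assms by (simp add: composable_iff_bd)
  have d: "dm C u = 1" "dm C v = 2" using assms by (simp_all add: cells_iff)
  show "cmp C 0 u v \<in> cells C 2" "bd C e (cmp C 0 u v) = cmp C 0 u (bd C e v)"
    using cmp_cells[OF c] bd_cmp_less[OF c] d by simp_all
qed

lemma cmp021:
  assumes "u \<in> cells C 2" "v \<in> cells C 1" "tgt (src u) = src v"
  shows "cmp C 0 u v \<in> cells C 2" "bd C e (cmp C 0 u v) = cmp C 0 (bd C e u) v"
proof -
  have c: "composable C 0 u v" using assms by (simp add: composable_iff_bd)
  have d: "dm C u = 2" "dm C v = 1" using assms by (simp_all add: cells_iff)
  show "cmp C 0 u v \<in> cells C 2" "bd C e (cmp C 0 u v) = cmp C 0 (bd C e u) v"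
    using cmp_cells[OF c] bd_cmp_greater[OF c] d by simp_all
qed

lemma cmp013:
  assumes "u \<in> cells C 1" "v \<in> cells C 3" "tgt u = src (src (src v))"
  shows "cmp C 0 u v \<in> cells C 3" "bd C e (cmp C 0 u v) = cmp C 0 u (bd C e v)"
proof -
  have c: "composable C 0 u v" using assms by (simp add: composable_iff_bd)
  have d: "dm C u = 1" "dm C v = 3" using assms by (simp_all add: cells_iff)
  show "cmp C 0 u v \<in> cells C 3" "bd C e (cmp C 0 u v) = cmp C 0 u (bd C e v)"
    using cmp_cells[OF c] bd_cmp_less[OF c] d by simp_all
qed

lemma cmp031:
  assumes "u \<in> cells C 3" "v \<in> cells C 1" "tgt (src (src u)) = src v"
  shows "cmp C 0 u v \<in> cells C 3" "bd C e (cmp C 0 u v) = cmp C 0 (bd C e u) v"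
proof -
  have c: "composable C 0 u v" using assms by (simp add: composable_iff_bd)
  have d: "dm C u = 3" "dm C v = 1" using assms by (simp_all add: cells_iff)
  show "cmp C 0 u v \<in> cells C 3" "bd C e (cmp C 0 u v) = cmp C 0 (bd C e u) v"
    using cmp_cells[OF c] bd_cmp_greater[OF c] d by simp_all
qed

lemma cmp122:
  assumes "u \<in> cells C 2" "v \<in> cells C 2" "tgt u = src v"
  shows "cmp C 1 u v \<in> cells C 2" "src (cmp C 1 u v) = src u" "tgt (cmp C 1 u v) = tgt v"
proof -
  have c: "composable C 1 u v" using assms by (simp add: composable_iff_bd)
  have d: "dm C u = 2" "dm C v = 2" using assms by (simp_all add: cells_iff)
  show "cmp C 1 u v \<in> cells C 2" "src (cmp C 1 u v) = src u" "tgt (cmp C 1 u v) = tgt v"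
    using cmp_cells[OF c] src_cmp_eq[OF c] tgt_cmp_eq[OF c] d by simp_all
qed

lemma cmp123:
  assumes "u \<in> cells C 2" "v \<in> cells C 3" "tgt u = src (src v)"
  shows "cmp C 1 u v \<in> cells C 3" "bd C e (cmp C 1 u v) = cmp C 1 u (bd C e v)"
proof -
  have c: "composable C 1 u v" using assms by (simp add: composable_iff_bd)
  have d: "dm C u = 2" "dm C v = 3" using assms by (simp_all add: cells_iff)
  show "cmp C 1 u v \<in> cells C 3" "bd C e (cmp C 1 u v) = cmp C 1 u (bd C e v)"
    using cmp_cells[OF c] bd_cmp_less[OF c] d by simp_all
qed

lemma cmp132:
  assumes "u \<in> cells C 3" "v \<in> cells C 2" "tgt (src u) = src v"
  shows "cmp C 1 u v \<in> cells C 3" "bd C e (cmp C 1 u v) = cmp C 1 (bd C e u) v"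
proof -
  have c: "composable C 1 u v" using assms by (simp add: composable_iff_bd)
  have d: "dm C u = 3" "dm C v = 2" using assms by (simp_all add: cells_iff)
  show "cmp C 1 u v \<in> cells C 3" "bd C e (cmp C 1 u v) = cmp C 1 (bd C e u) v"
    using cmp_cells[OF c] bd_cmp_greater[OF c] d by simp_all
qed

lemma cmp233:
  assumes "u \<in> cells C 3" "v \<in> cells C 3" "tgt u = src v"
  shows "cmp C 2 u v \<in> cells C 3" "src (cmp C 2 u v) = src u" "tgt (cmp C 2 u v) = tgt v"
proof -
  have c: "composable C 2 u v" using assms by (simp add: composable_iff_bd)
  have d: "dm C u = 3" "dm C v = 3" using assms by (simp_all add: cells_iff)
  show "cmp C 2 u v \<in> cells C 3" "src (cmp C 2 u v) = src u" "tgt (cmp C 2 u v) = tgt v"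
    using cmp_cells[OF c] src_cmp_eq[OF c] tgt_cmp_eq[OF c] d by simp_all
qed

lemmas cmp_bd = cmp011 cmp012 cmp021 cmp013 cmp031 cmp122 cmp123 cmp132 cmp233

lemma cmp_assoc:
  "u \<in> cells C 1 \<Longrightarrow> v \<in> cells C 1 \<Longrightarrow> w \<in> cells C 1 \<Longrightarrow> tgt u = src v \<Longrightarrow> tgt v = src w \<Longrightarrow>
    cmp C 0 (cmp C 0 u v) w = cmp C 0 u (cmp C 0 v w)"
  "u \<in> cells C 1 \<Longrightarrow> v \<in> cells C 1 \<Longrightarrow> w \<in> cells C 2 \<Longrightarrow> tgt u = src v \<Longrightarrow> tgt v = src (src w) \<Longrightarrow>
    cmp C 0 (cmp C 0 u v) w = cmp C 0 u (cmp C 0 v w)"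
  "u \<in> cells C 1 \<Longrightarrow> v \<in> cells C 2 \<Longrightarrow> w \<in> cells C 1 \<Longrightarrow> tgt u = src (src v) \<Longrightarrow> tgt (src v) = src w \<Longrightarrow>
    cmp C 0 (cmp C 0 u v) w = cmp C 0 u (cmp C 0 v w)"
  "u \<in> cells C 2 \<Longrightarrow> v \<in> cells C 1 \<Longrightarrow> w \<in> cells C 1 \<Longrightarrow> tgt (src u) = src v \<Longrightarrow> tgt v = src w \<Longrightarrow>
    cmp C 0 (cmp C 0 u v) w = cmp C 0 u (cmp C 0 v w)"
  "u \<in> cells C 1 \<Longrightarrow> v \<in> cells C 1 \<Longrightarrow> w \<in> cells C 3 \<Longrightarrow> tgt u = src v \<Longrightarrow> tgt v = src (src (src w)) \<Longrightarrow>
    cmp C 0 (cmp C 0 u v) w = cmp C 0 u (cmp C 0 v w)"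
  "u \<in> cells C 1 \<Longrightarrow> v \<in> cells C 3 \<Longrightarrow> w \<in> cells C 1 \<Longrightarrow> tgt u = src (src (src v)) \<Longrightarrow> tgt (src (src v)) = src w \<Longrightarrow>
    cmp C 0 (cmp C 0 u v) w = cmp C 0 u (cmp C 0 v w)"
  "u \<in> cells C 3 \<Longrightarrow> v \<in> cells C 1 \<Longrightarrow> w \<in> cells C 1 \<Longrightarrow> tgt (src (src u)) = src v \<Longrightarrow> tgt v = src w \<Longrightarrow>
    cmp C 0 (cmp C 0 u v) w = cmp C 0 u (cmp C 0 v w)"
  "u \<in> cells C 2 \<Longrightarrow> v \<in> cells C 2 \<Longrightarrow> w \<in> cells C 2 \<Longrightarrow> tgt u = src v \<Longrightarrow> tgt v = src w \<Longrightarrow>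
    cmp C 1 (cmp C 1 u v) w = cmp C 1 u (cmp C 1 v w)"
  "u \<in> cells C 2 \<Longrightarrow> v \<in> cells C 2 \<Longrightarrow> w \<in> cells C 3 \<Longrightarrow> tgt u = src v \<Longrightarrow> tgt v = src (src w) \<Longrightarrow>
    cmp C 1 (cmp C 1 u v) w = cmp C 1 u (cmp C 1 v w)"
  "u \<in> cells C 2 \<Longrightarrow> v \<in> cells C 3 \<Longrightarrow> w \<in> cells C 2 \<Longrightarrow> tgt u = src (src v) \<Longrightarrow> tgt (src v) = src w \<Longrightarrow>
    cmp C 1 (cmp C 1 u v) w = cmp C 1 u (cmp C 1 v w)"
  "u \<in> cells C 3 \<Longrightarrow> v \<in> cells C 2 \<Longrightarrow> w \<in> cells C 2 \<Longrightarrow> tgt (src u) = src v \<Longrightarrow> tgt v = src w \<Longrightarrow>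
    cmp C 1 (cmp C 1 u v) w = cmp C 1 u (cmp C 1 v w)"
  "u \<in> cells C 3 \<Longrightarrow> v \<in> cells C 3 \<Longrightarrow> w \<in> cells C 3 \<Longrightarrow> tgt u = src v \<Longrightarrow> tgt v = src w \<Longrightarrow>
    cmp C 2 (cmp C 2 u v) w = cmp C 2 u (cmp C 2 v w)"
  by (rule assoc; simp add: composable_iff_bd cmp_bd bd_low globular_low)+

lemma cmp_distrib:
  "u \<in> cells C 1 \<Longrightarrow> v \<in> cells C 2 \<Longrightarrow> v' \<in> cells C 2 \<Longrightarrow> tgt v = src v' \<Longrightarrow> tgt u = src (src v) \<Longrightarrow>
    cmp C 0 u (cmp C 1 v v') = cmp C 1 (cmp C 0 u v) (cmp C 0 u v')"
  "u \<in> cells C 1 \<Longrightarrow> v \<in> cells C 2 \<Longrightarrow> v' \<in> cells C 3 \<Longrightarrow> tgt v = src (src v') \<Longrightarrow> tgt u = src (src v) \<Longrightarrow>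
    cmp C 0 u (cmp C 1 v v') = cmp C 1 (cmp C 0 u v) (cmp C 0 u v')"
  "u \<in> cells C 1 \<Longrightarrow> v \<in> cells C 3 \<Longrightarrow> v' \<in> cells C 2 \<Longrightarrow> tgt (src v) = src v' \<Longrightarrow> tgt u = src (src (src v)) \<Longrightarrow>
    cmp C 0 u (cmp C 1 v v') = cmp C 1 (cmp C 0 u v) (cmp C 0 u v')"
  "u \<in> cells C 1 \<Longrightarrow> v \<in> cells C 3 \<Longrightarrow> v' \<in> cells C 3 \<Longrightarrow> tgt v = src v' \<Longrightarrow> tgt u = src (src (src v)) \<Longrightarrow>
    cmp C 0 u (cmp C 2 v v') = cmp C 2 (cmp C 0 u v) (cmp C 0 u v')"
  "u \<in> cells C 2 \<Longrightarrow> v \<in> cells C 3 \<Longrightarrow> v' \<in> cells C 3 \<Longrightarrow> tgt v = src v' \<Longrightarrow> tgt u = src (src v) \<Longrightarrow>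
    cmp C 1 u (cmp C 2 v v') = cmp C 2 (cmp C 1 u v) (cmp C 1 u v')"
  "u \<in> cells C 1 \<Longrightarrow> v \<in> cells C 2 \<Longrightarrow> v' \<in> cells C 2 \<Longrightarrow> tgt v = src v' \<Longrightarrow> tgt (src v) = src u \<Longrightarrow>
    cmp C 0 (cmp C 1 v v') u = cmp C 1 (cmp C 0 v u) (cmp C 0 v' u)"
  "u \<in> cells C 1 \<Longrightarrow> v \<in> cells C 2 \<Longrightarrow> v' \<in> cells C 3 \<Longrightarrow> tgt v = src (src v') \<Longrightarrow> tgt (src v) = src u \<Longrightarrow>
    cmp C 0 (cmp C 1 v v') u = cmp C 1 (cmp C 0 v u) (cmp C 0 v' u)"
  "u \<in> cells C 1 \<Longrightarrow> v \<in> cells C 3 \<Longrightarrow> v' \<in> cells C 2 \<Longrightarrow> tgt (src v) = src v' \<Longrightarrow> tgt (src (src v)) = src u \<Longrightarrow>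
    cmp C 0 (cmp C 1 v v') u = cmp C 1 (cmp C 0 v u) (cmp C 0 v' u)"
  "u \<in> cells C 1 \<Longrightarrow> v \<in> cells C 3 \<Longrightarrow> v' \<in> cells C 3 \<Longrightarrow> tgt v = src v' \<Longrightarrow> tgt (src (src v)) = src u \<Longrightarrow>
    cmp C 0 (cmp C 2 v v') u = cmp C 2 (cmp C 0 v u) (cmp C 0 v' u)"
  "u \<in> cells C 2 \<Longrightarrow> v \<in> cells C 3 \<Longrightarrow> v' \<in> cells C 3 \<Longrightarrow> tgt v = src v' \<Longrightarrow> tgt (src v) = src u \<Longrightarrow>
    cmp C 1 (cmp C 2 v v') u = cmp C 2 (cmp C 1 v u) (cmp C 1 v' u)"
  by (rule distrib_left distrib_right;
    (simp add: composable_iff_bd cmp_bd bd_low globular_low; fail | simp add: cells_iff One_nat_def))+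

lemma idc_low:
  "u \<in> cells C 0 \<Longrightarrow> idc C u \<in> cells C 1"
  "u \<in> cells C 0 \<Longrightarrow> bd C e (idc C u) = u"
  "u \<in> cells C 1 \<Longrightarrow> idc C u \<in> cells C 2"
  "u \<in> cells C 1 \<Longrightarrow> bd C e (idc C u) = u"
  "u \<in> cells C 2 \<Longrightarrow> idc C u \<in> cells C 3"
  "u \<in> cells C 2 \<Longrightarrow> bd C e (idc C u) = u"
  using idc_cells[of u 0] bd_idc[of u 0 e] idc_cells[of u 1] bd_idc[of u 1 e] idc_cells[of u 2] bd_idc[of u 2 e]
  by (simp_all add: One_nat_def[symmetric])

lemma cmp_idc_bdi:
  "v \<in> cells C l \<Longrightarrow> i < l \<Longrightarrow> bdi C Src i v = x \<Longrightarrow> cmp C i (idc C x) v = v"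
  "v \<in> cells C l \<Longrightarrow> i < l \<Longrightarrow> bdi C Tgt i v = x \<Longrightarrow> cmp C i v (idc C x) = v"
  by (metis cells_iff cmp_unit_left(3), metis cells_iff cmp_unit_right(3))

lemma cmp_idc_low:
  "v \<in> cells C 1 \<Longrightarrow> src v = x \<Longrightarrow> cmp C 0 (idc C x) v = v"
  "v \<in> cells C 1 \<Longrightarrow> tgt v = x \<Longrightarrow> cmp C 0 v (idc C x) = v"
  "v \<in> cells C 2 \<Longrightarrow> src (src v) = x \<Longrightarrow> cmp C 0 (idc C x) v = v"
  "v \<in> cells C 2 \<Longrightarrow> tgt (src v) = x \<Longrightarrow> cmp C 0 v (idc C x) = v"
  "v \<in> cells C 3 \<Longrightarrow> src (src (src v)) = x \<Longrightarrow> cmp C 0 (idc C x) v = v"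
  "v \<in> cells C 3 \<Longrightarrow> tgt (src (src v)) = x \<Longrightarrow> cmp C 0 v (idc C x) = v"
  "v \<in> cells C 2 \<Longrightarrow> src v = x \<Longrightarrow> cmp C 1 (idc C x) v = v"
  "v \<in> cells C 2 \<Longrightarrow> tgt v = x \<Longrightarrow> cmp C 1 v (idc C x) = v"
  "v \<in> cells C 3 \<Longrightarrow> src (src v) = x \<Longrightarrow> cmp C 1 (idc C x) v = v"
  "v \<in> cells C 3 \<Longrightarrow> tgt (src v) = x \<Longrightarrow> cmp C 1 v (idc C x) = v"
  "v \<in> cells C 3 \<Longrightarrow> src v = x \<Longrightarrow> cmp C 2 (idc C x) v = v"
  "v \<in> cells C 3 \<Longrightarrow> tgt v = x \<Longrightarrow> cmp C 2 v (idc C x) = v"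
  by (rule cmp_idc_bdi, assumption, simp, simp add: bdi_low)+

lemma idc_cmp_low:
  "u \<in> cells C 1 \<Longrightarrow> v \<in> cells C 1 \<Longrightarrow> tgt u = src v \<Longrightarrow> cmp C 0 (idc C u) v = idc C (cmp C 0 u v)"
  "u \<in> cells C 1 \<Longrightarrow> v \<in> cells C 1 \<Longrightarrow> tgt v = src u \<Longrightarrow> cmp C 0 v (idc C u) = idc C (cmp C 0 v u)"
  "u \<in> cells C 2 \<Longrightarrow> v \<in> cells C 1 \<Longrightarrow> tgt (src u) = src v \<Longrightarrow> cmp C 0 (idc C u) v = idc C (cmp C 0 u v)"
  "u \<in> cells C 2 \<Longrightarrow> v \<in> cells C 1 \<Longrightarrow> tgt v = src (src u) \<Longrightarrow> cmp C 0 v (idc C u) = idc C (cmp C 0 v u)"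
  "u \<in> cells C 2 \<Longrightarrow> v \<in> cells C 2 \<Longrightarrow> tgt u = src v \<Longrightarrow> cmp C 1 (idc C u) v = idc C (cmp C 1 u v)"
  "u \<in> cells C 2 \<Longrightarrow> v \<in> cells C 2 \<Longrightarrow> tgt v = src u \<Longrightarrow> cmp C 1 v (idc C u) = idc C (cmp C 1 v u)"
  by (rule idc_cmp cmp_idc; (simp add: composable_iff_bd; fail | simp add: cells_iff One_nat_def))+


text \<open>Rewriting with these rules brings composites into a normal form: whiskers are
  distributed over compositions of higher dimension, composites nest to the right, identities are
  absorbed, and boundaries become iterated sources. Consequences of the laws of 3-precategories are
  then checked by comparing normal forms.\<close>

lemmas ps = bd_low globular_low cmp_bd cmp_assoc cmp_distrib idc_low cmp_idc_low idc_cmp_low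

end

section \<open>Interchangers given on generators\<close>

text \<open>The nesting to the right agrees with the normal form of the rewriting rules. The
  generating cells are a parameter, so that the notion applies to the free 3-precategory and to its
  quotient alike.\<close>

inductive_set whiskers :: "'c precat \<Rightarrow> 'c set \<Rightarrow> 'c set" for C :: "'c precat" and B :: "'c set" where
  whisker: "b \<in> B \<Longrightarrow> f \<in> cells C 1 \<Longrightarrow> g \<in> cells C 1 \<Longrightarrow> bd C Tgt f = bd C Src (bd C Src b) \<Longrightarrow>
    bd C Tgt (bd C Src b) = bd C Src g \<Longrightarrow> cmp C 0 f (cmp C 0 b g) \<in> whiskers C B"

text \<open>Whiskers are added at the front, which matches the recursion of the interchangers in
  their first argument.\<close>

inductive_set span2 :: "'c precat \<Rightarrow> 'c set \<Rightarrow> 'c set" for C :: "'c precat" and B :: "'c set" where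
  span2_idc: "f \<in> cells C 1 \<Longrightarrow> idc C f \<in> span2 C B"
| span2_cmp: "w \<in> whiskers C B \<Longrightarrow> \<phi> \<in> cells C 2 \<Longrightarrow> \<phi> \<in> span2 C B \<Longrightarrow> bd C Tgt w = bd C Src \<phi> \<Longrightarrow>
    cmp C 1 w \<phi> \<in> span2 C B"

inductive_set span3 :: "'c precat \<Rightarrow> 'c set \<Rightarrow> 'c set" for C :: "'c precat" and G :: "'c set" where
  span3_gen: "A \<in> G \<Longrightarrow> A \<in> span3 C G"
| span3_idc: "\<phi> \<in> cells C 2 \<Longrightarrow> idc C \<phi> \<in> span3 C G"
| span3_cmp2: "A \<in> span3 C G \<Longrightarrow> A' \<in> span3 C G \<Longrightarrow> A \<in> cells C 3 \<Longrightarrow> A' \<in> cells C 3 \<Longrightarrow>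
    bd C Tgt A = bd C Src A' \<Longrightarrow> cmp C 2 A A' \<in> span3 C G"
| span3_left1: "A \<in> span3 C G \<Longrightarrow> A \<in> cells C 3 \<Longrightarrow> e \<in> cells C 1 \<Longrightarrow>
    bd C Tgt e = bd C Src (bd C Src (bd C Src A)) \<Longrightarrow> cmp C 0 e A \<in> span3 C G"
| span3_right1: "A \<in> span3 C G \<Longrightarrow> A \<in> cells C 3 \<Longrightarrow> h \<in> cells C 1 \<Longrightarrow>
    bd C Tgt (bd C Src (bd C Src A)) = bd C Src h \<Longrightarrow> cmp C 0 A h \<in> span3 C G"
| span3_left2: "A \<in> span3 C G \<Longrightarrow> A \<in> cells C 3 \<Longrightarrow> \<phi> \<in> cells C 2 \<Longrightarrow>
    bd C Tgt \<phi> = bd C Src (bd C Src A) \<Longrightarrow> cmp C 1 \<phi> A \<in> span3 C G"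
| span3_right2: "A \<in> span3 C G \<Longrightarrow> A \<in> cells C 3 \<Longrightarrow> \<phi> \<in> cells C 2 \<Longrightarrow>
    bd C Tgt (bd C Src A) = bd C Src \<phi> \<Longrightarrow> cmp C 1 A \<phi> \<in> span3 C G"

text \<open>
  In \<open>wspan3\<close> whiskering by 1-cells occurs only next to the generators, which is the shape
  covered by the independence generators.
\<close>

inductive_set wspan3 :: "'c precat \<Rightarrow> 'c set \<Rightarrow> 'c set" for C :: "'c precat" and G :: "'c set" where
  wspan3_gen: "A \<in> G \<Longrightarrow> e \<in> cells C 1 \<Longrightarrow> h \<in> cells C 1 \<Longrightarrow>
    bd C Tgt e = bd C Src (bd C Src (bd C Src A)) \<Longrightarrow> bd C Tgt (bd C Src (bd C Src A)) = bd C Src h \<Longrightarrow>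
    cmp C 0 e (cmp C 0 A h) \<in> wspan3 C G"
| wspan3_idc: "\<phi> \<in> cells C 2 \<Longrightarrow> idc C \<phi> \<in> wspan3 C G"
| wspan3_cmp2: "A \<in> wspan3 C G \<Longrightarrow> A' \<in> wspan3 C G \<Longrightarrow> A \<in> cells C 3 \<Longrightarrow> A' \<in> cells C 3 \<Longrightarrow>
    bd C Tgt A = bd C Src A' \<Longrightarrow> cmp C 2 A A' \<in> wspan3 C G"
| wspan3_left2: "A \<in> wspan3 C G \<Longrightarrow> A \<in> cells C 3 \<Longrightarrow> \<phi> \<in> cells C 2 \<Longrightarrow>
    bd C Tgt \<phi> = bd C Src (bd C Src A) \<Longrightarrow> cmp C 1 \<phi> A \<in> wspan3 C G"
| wspan3_right2: "A \<in> wspan3 C G \<Longrightarrow> A \<in> cells C 3 \<Longrightarrow> \<phi> \<in> cells C 2 \<Longrightarrow>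
    bd C Tgt (bd C Src A) = bd C Src \<phi> \<Longrightarrow> cmp C 1 A \<phi> \<in> wspan3 C G"

section \<open>Spanning by whiskered generators and pasting of squares\<close>

context precat3
begin

text \<open>Cells that meet share their lower boundaries. The cell \<open>u\<close> to which one
  rewrites does not occur on the left of the equation, so these facts are instantiated by hand where
  they are used.\<close>

lemma parallel_low:
  "u \<in> cells C 2 \<Longrightarrow> tgt u = src v \<Longrightarrow> bd C e (src v) = bd C e (src u)"
  "u \<in> cells C 3 \<Longrightarrow> tgt u = src v \<Longrightarrow> bd C e (src v) = bd C e (src u)"
  by (metis globular_low)+

lemma parallel_low':
  "u \<in> cells C 2 \<Longrightarrow> v \<in> cells C 3 \<Longrightarrow> tgt u = src (src v) \<Longrightarrow>
    bd C e (src (src v)) = bd C e (src u)"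
  "u \<in> cells C 3 \<Longrightarrow> v \<in> cells C 2 \<Longrightarrow> tgt (src u) = src v \<Longrightarrow>
    bd C e (src v) = bd C e (src (src u))"
  "u \<in> cells C 3 \<Longrightarrow> v \<in> cells C 3 \<Longrightarrow> tgt (src u) = src (src v) \<Longrightarrow>
    bd C e (src (src v)) = bd C e (src (src u))"
  by (metis globular_low bd_low(3))+

text \<open>Two commuting squares are glued along the common side \<open>r\<close>: the first
  replaces \<open>p\<close> followed by \<open>q\<close>, the second \<open>r\<close> followed by
  \<open>t\<close>.\<close>

lemma square_paste:
  assumes "p \<in> cells C 3" "q \<in> cells C 3" "q' \<in> cells C 3" "r \<in> cells C 3" "t \<in> cells C 3" "t' \<in> cells C 3"
    "s \<in> cells C 3"
    and "tgt p = src q" "tgt q = src t" "tgt q' = src r" "tgt r = src t"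
    and "tgt t' = src s"
    and 1: "cmp C 2 p q = cmp C 2 q' r" and 2: "cmp C 2 r t = cmp C 2 t' s"
  shows "cmp C 2 p (cmp C 2 q t) = cmp C 2 q' (cmp C 2 t' s)"
proof -
  have "cmp C 2 p (cmp C 2 q t) = cmp C 2 (cmp C 2 p q) t" using assms(1-12) by (simp add: ps)
  also have "\<dots> = cmp C 2 (cmp C 2 q' r) t" by (simp only: 1)
  also have "\<dots> = cmp C 2 q' (cmp C 2 r t)" using assms(1-12) by (simp add: ps)
  finally show ?thesis by (simp only: 2)
qed

text \<open>Whiskering by a 1-cell distributes over both higher compositions, so it can be pushed
  down to the generators and merged with the 1-cells there.\<close>

lemma wspan3_whisker:
  assumes "A \<in> wspan3 C G" "G \<subseteq> cells C 3"
  shows "e \<in> cells C 1 \<Longrightarrow> tgt e = src (src (src A)) \<Longrightarrow> cmp C 0 e A \<in> wspan3 C G"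
    and "e \<in> cells C 1 \<Longrightarrow> tgt (src (src A)) = src e \<Longrightarrow> cmp C 0 A e \<in> wspan3 C G"
proof -
  have "(e \<in> cells C 1 \<longrightarrow> tgt e = src (src (src A)) \<longrightarrow> cmp C 0 e A \<in> wspan3 C G) \<and>
    (e \<in> cells C 1 \<longrightarrow> tgt (src (src A)) = src e \<longrightarrow> cmp C 0 A e \<in> wspan3 C G)"
    using assms
  proof (induction A)
    case (wspan3_gen A e' h)
    then have A: "A \<in> cells C 3" by auto
    have 1: "cmp C 0 (cmp C 0 e e') (cmp C 0 A h) \<in> wspan3 C G" if "e \<in> cells C 1" "tgt e = src e'"
      using wspan3_gen A that by (intro wspan3.wspan3_gen) (simp_all add: ps)
    have 2: "cmp C 0 e' (cmp C 0 A (cmp C 0 h e)) \<in> wspan3 C G" if "e \<in> cells C 1" "tgt h = src e"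
      using wspan3_gen A that by (intro wspan3.wspan3_gen) (simp_all add: ps)
    show ?case using 1 2 wspan3_gen(2-5) A by (simp add: ps)
  next
    case (wspan3_idc \<phi>)
    then show ?case by (auto simp: ps intro!: wspan3.wspan3_idc)
  next
    case (wspan3_cmp2 A A')
    note p = parallel_low(2)[OF wspan3_cmp2(3,5)]
    show ?case using wspan3_cmp2 p by (auto simp: ps intro!: wspan3.wspan3_cmp2)
  next
    case (wspan3_left2 A \<phi>)
    note p = parallel_low'(1)[OF wspan3_left2(3,2,4)]
    show ?case using wspan3_left2 p by (auto simp: ps intro!: wspan3.wspan3_left2)
  next
    case (wspan3_right2 A \<phi>)
    note p = parallel_low'(2)[OF wspan3_right2(2,3,4)]
    show ?case using wspan3_right2 p by (auto simp: ps intro!: wspan3.wspan3_right2)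
  qed
  then show "e \<in> cells C 1 \<Longrightarrow> tgt e = src (src (src A)) \<Longrightarrow> cmp C 0 e A \<in> wspan3 C G"
    "e \<in> cells C 1 \<Longrightarrow> tgt (src (src A)) = src e \<Longrightarrow> cmp C 0 A e \<in> wspan3 C G"
    by blast+
qed

text \<open>A bare generator is whiskered by identities; the other constructors are either shared or
  dealt with by pushing 1-cells inwards.\<close>

lemma span3_wspan3:
  assumes "A \<in> span3 C G" "G \<subseteq> cells C 3"
  shows "A \<in> wspan3 C G"
  using assms
proof (induction A)
  case (span3_gen A)
  then have A: "A \<in> cells C 3" by auto
  have "cmp C 0 (idc C (src (src (src A)))) (cmp C 0 A (idc C (tgt (src (src A)))))
    \<in> wspan3 C G"
    using span3_gen A by (intro wspan3_gen) (simp_all add: ps)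
  then show ?case using A by (simp add: ps)
qed (simp_all add: wspan3.intros wspan3_whisker)

end

text \<open>This isolates what has to be known on generators: boundaries and unit laws of
  \<open>X\<close>, one step of recursion in each argument, compatibility with 1-cells for single
  whiskers, and the equations imposed by the 4-generators. Only \<open>indep\<close>,
  \<open>natl\<close> and \<open>natr\<close> call for the passage to the quotient.\<close>

locale gray_core = precat3 C for C :: "'c precat" +
  fixes B G :: "'c set" and X :: "'c \<Rightarrow> 'c \<Rightarrow> 'c"
  assumes B_cells: "b \<in> B \<Longrightarrow> b \<in> cells C 2"
    and G_cells: "A \<in> G \<Longrightarrow> A \<in> cells C 3"
    and cells2: "\<phi> \<in> cells C 2 \<Longrightarrow> \<phi> \<in> span2 C B"
    and cells3: "A \<in> cells C 3 \<Longrightarrow> A \<in> span3 C G"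
    and X_in: "\<phi> \<in> cells C 2 \<Longrightarrow> \<psi> \<in> cells C 2 \<Longrightarrow> tgt (src \<phi>) = src (src \<psi>) \<Longrightarrow> X \<phi> \<psi> \<in> cells C 3"
    and X_src: "\<phi> \<in> cells C 2 \<Longrightarrow> \<psi> \<in> cells C 2 \<Longrightarrow> tgt (src \<phi>) = src (src \<psi>) \<Longrightarrow>
      src (X \<phi> \<psi>) = (\<phi> \<star>\<^sub>0 src \<psi>) \<star>\<^sub>1 (tgt \<phi> \<star>\<^sub>0 \<psi>)"
    and X_tgt: "\<phi> \<in> cells C 2 \<Longrightarrow> \<psi> \<in> cells C 2 \<Longrightarrow> tgt (src \<phi>) = src (src \<psi>) \<Longrightarrow>
      tgt (X \<phi> \<psi>) = (src \<phi> \<star>\<^sub>0 \<psi>) \<star>\<^sub>1 (\<phi> \<star>\<^sub>0 tgt \<psi>)"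
    and X_idl: "f \<in> cells C 1 \<Longrightarrow> \<psi> \<in> cells C 2 \<Longrightarrow> tgt f = src (src \<psi>) \<Longrightarrow> X (idc C f) \<psi> = idc C (f \<star>\<^sub>0 \<psi>)"
    and X_idr: "\<phi> \<in> cells C 2 \<Longrightarrow> g \<in> cells C 1 \<Longrightarrow> tgt (src \<phi>) = src g \<Longrightarrow> X \<phi> (idc C g) = idc C (\<phi> \<star>\<^sub>0 g)"
    and X_consl: "w \<in> whiskers C B \<Longrightarrow> \<phi> \<in> cells C 2 \<Longrightarrow> \<psi> \<in> cells C 2 \<Longrightarrow> tgt w = src \<phi> \<Longrightarrow>
      tgt (src w) = src (src \<psi>) \<Longrightarrow>
      X (w \<star>\<^sub>1 \<phi>) \<psi> = ((w \<star>\<^sub>0 src \<psi>) \<star>\<^sub>1 X \<phi> \<psi>) \<star>\<^sub>2 (X w \<psi> \<star>\<^sub>1 (\<phi> \<star>\<^sub>0 tgt \<psi>))"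
    and X_consr: "w \<in> whiskers C B \<Longrightarrow> v \<in> whiskers C B \<Longrightarrow> \<psi> \<in> cells C 2 \<Longrightarrow> tgt v = src \<psi> \<Longrightarrow>
      tgt (src w) = src (src v) \<Longrightarrow>
      X w (v \<star>\<^sub>1 \<psi>) = (X w v \<star>\<^sub>1 (tgt w \<star>\<^sub>0 \<psi>)) \<star>\<^sub>2 ((src w \<star>\<^sub>0 v) \<star>\<^sub>1 X w \<psi>)"
    and X_wl: "e \<in> cells C 1 \<Longrightarrow> w \<in> whiskers C B \<Longrightarrow> v \<in> whiskers C B \<Longrightarrow> tgt e = src (src w) \<Longrightarrow>
      tgt (src w) = src (src v) \<Longrightarrow> X (e \<star>\<^sub>0 w) v = e \<star>\<^sub>0 X w v"
    and X_wr: "h \<in> cells C 1 \<Longrightarrow> w \<in> whiskers C B \<Longrightarrow> v \<in> whiskers C B \<Longrightarrow> tgt (src v) = src h \<Longrightarrow>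
      tgt (src w) = src (src v) \<Longrightarrow> X w (v \<star>\<^sub>0 h) = X w v \<star>\<^sub>0 h"
    and X_wm: "m \<in> cells C 1 \<Longrightarrow> w \<in> whiskers C B \<Longrightarrow> v \<in> whiskers C B \<Longrightarrow> tgt (src w) = src m \<Longrightarrow>
      tgt m = src (src v) \<Longrightarrow> X (w \<star>\<^sub>0 m) v = X w (m \<star>\<^sub>0 v)"
    and indep: "A \<in> G \<Longrightarrow> A' \<in> G \<Longrightarrow> e \<in> cells C 1 \<Longrightarrow> h \<in> cells C 1 \<Longrightarrow> e' \<in> cells C 1 \<Longrightarrow> h' \<in> cells C 1 \<Longrightarrow>
      \<chi> \<in> cells C 2 \<Longrightarrow> tgt e = src (src (src A)) \<Longrightarrow> tgt (src (src A)) = src h \<Longrightarrow>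
      tgt e' = src (src (src A')) \<Longrightarrow> tgt (src (src A')) = src h' \<Longrightarrow>
      e \<star>\<^sub>0 (tgt (src A) \<star>\<^sub>0 h) = src \<chi> \<Longrightarrow> tgt \<chi> = e' \<star>\<^sub>0 (src (src A') \<star>\<^sub>0 h') \<Longrightarrow>
      ((e \<star>\<^sub>0 (A \<star>\<^sub>0 h)) \<star>\<^sub>1 (\<chi> \<star>\<^sub>1 (e' \<star>\<^sub>0 (src A' \<star>\<^sub>0 h')))) \<star>\<^sub>2
      ((e \<star>\<^sub>0 (tgt A \<star>\<^sub>0 h)) \<star>\<^sub>1 (\<chi> \<star>\<^sub>1 (e' \<star>\<^sub>0 (A' \<star>\<^sub>0 h')))) =
      ((e \<star>\<^sub>0 (src A \<star>\<^sub>0 h)) \<star>\<^sub>1 (\<chi> \<star>\<^sub>1 (e' \<star>\<^sub>0 (A' \<star>\<^sub>0 h')))) \<star>\<^sub>2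
      ((e \<star>\<^sub>0 (A \<star>\<^sub>0 h)) \<star>\<^sub>1 (\<chi> \<star>\<^sub>1 (e' \<star>\<^sub>0 (tgt A' \<star>\<^sub>0 h'))))"
    and natl: "A \<in> G \<Longrightarrow> g \<in> cells C 1 \<Longrightarrow> b \<in> B \<Longrightarrow> tgt (src (src A)) = src g \<Longrightarrow> tgt g = src (src b) \<Longrightarrow>
      ((A \<star>\<^sub>0 (g \<star>\<^sub>0 src b)) \<star>\<^sub>1 (tgt (src A) \<star>\<^sub>0 (g \<star>\<^sub>0 b))) \<star>\<^sub>2 X (tgt A) (g \<star>\<^sub>0 b) =
      X (src A) (g \<star>\<^sub>0 b) \<star>\<^sub>2 ((src (src A) \<star>\<^sub>0 (g \<star>\<^sub>0 b)) \<star>\<^sub>1 (A \<star>\<^sub>0 (g \<star>\<^sub>0 tgt b)))"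
    and natr: "b \<in> B \<Longrightarrow> g \<in> cells C 1 \<Longrightarrow> A \<in> G \<Longrightarrow> tgt (src b) = src g \<Longrightarrow> tgt g = src (src (src A)) \<Longrightarrow>
      ((b \<star>\<^sub>0 (g \<star>\<^sub>0 src (src A))) \<star>\<^sub>1 (tgt b \<star>\<^sub>0 (g \<star>\<^sub>0 A))) \<star>\<^sub>2 X (b \<star>\<^sub>0 g) (tgt A) =
      X (b \<star>\<^sub>0 g) (src A) \<star>\<^sub>2 ((src b \<star>\<^sub>0 (g \<star>\<^sub>0 A)) \<star>\<^sub>1 (b \<star>\<^sub>0 (g \<star>\<^sub>0 tgt (src A))))"
begin

lemmas pX = ps X_in X_src X_tgt

lemma whiskers_cells: "w \<in> whiskers C B \<Longrightarrow> w \<in> cells C 2"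
  by (induction rule: whiskers.induct) (simp add: ps B_cells)

lemma whiskers_left:
  "w \<in> whiskers C B \<Longrightarrow> e \<in> cells C 1 \<Longrightarrow> tgt e = src (src w) \<Longrightarrow> e \<star>\<^sub>0 w \<in> whiskers C B"
proof (induction rule: whiskers.induct)
  case (whisker b f g)
  then have "(e \<star>\<^sub>0 f) \<star>\<^sub>0 (b \<star>\<^sub>0 g) \<in> whiskers C B"
    using B_cells by (intro whiskers.whisker) (simp_all add: ps)
  then show ?case using whisker B_cells by (simp add: ps)
qed

lemma whiskers_right:
  "w \<in> whiskers C B \<Longrightarrow> h \<in> cells C 1 \<Longrightarrow> tgt (src w) = src h \<Longrightarrow> w \<star>\<^sub>0 h \<in> whiskers C B"
proof (induction rule: whiskers.induct)
  case (whisker b f g)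
  then have "f \<star>\<^sub>0 (b \<star>\<^sub>0 (g \<star>\<^sub>0 h)) \<in> whiskers C B"
    using B_cells by (intro whiskers.whisker) (simp_all add: ps)
  then show ?case using whisker B_cells by (simp add: ps)
qed

text \<open>The equation between the boundaries of \<open>src \<phi>\<close> and
  \<open>src w\<close> is handed to the inductive step because the simplifier has no way to find it:
  it turns the lower boundaries of the remainder into those of the first whisker.\<close>

lemma cell2_induct [consumes 1, case_names idc cmp]:
  assumes "\<phi> \<in> cells C 2"
    and "\<And>f. f \<in> cells C 1 \<Longrightarrow> P (idc C f)"
    and "\<And>w \<phi>. w \<in> whiskers C B \<Longrightarrow> w \<in> cells C 2 \<Longrightarrow> \<phi> \<in> cells C 2 \<Longrightarrow> tgt w = src \<phi> \<Longrightarrow>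
      (\<And>e. bd C e (src \<phi>) = bd C e (src w)) \<Longrightarrow> P \<phi> \<Longrightarrow> P (w \<star>\<^sub>1 \<phi>)"
  shows "P \<phi>"
  using cells2[OF assms(1)]
proof (induction rule: span2.induct)
  case (span2_idc f)
  then show ?case by (rule assms(2))
next
  case (span2_cmp w \<phi>)
  then show ?case using whiskers_cells parallel_low(1)[OF whiskers_cells] by (intro assms(3)) auto
qed

section \<open>The exchange law for 3-cells\<close>

definition exch :: "'c \<Rightarrow> 'c \<Rightarrow> bool" where
  "exch A B' \<longleftrightarrow> (A \<star>\<^sub>1 src B') \<star>\<^sub>2 (tgt A \<star>\<^sub>1 B') = (src A \<star>\<^sub>1 B') \<star>\<^sub>2 (A \<star>\<^sub>1 tgt B')"

lemma exch_idc:
  "A \<in> cells C 3 \<Longrightarrow> \<psi> \<in> cells C 2 \<Longrightarrow> tgt (src A) = src \<psi> \<Longrightarrow> exch A (idc C \<psi>)"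
  "A \<in> cells C 3 \<Longrightarrow> \<psi> \<in> cells C 2 \<Longrightarrow> tgt \<psi> = src (src A) \<Longrightarrow> exch (idc C \<psi>) A"
  by (simp_all add: exch_def ps)

lemma exch_cmp2_right:
  assumes A: "A \<in> cells C 3" and B: "B1 \<in> cells C 3" "B2 \<in> cells C 3" "tgt B1 = src B2"
    and t: "tgt (src A) = src (src B1)" and e: "exch A B1" "exch A B2"
  shows "exch A (B1 \<star>\<^sub>2 B2)"
proof -
  note p = parallel_low(2)[OF B(1,3)] parallel_low'(3)[OF A B(1) t]
  have "(A \<star>\<^sub>1 src B1) \<star>\<^sub>2 ((tgt A \<star>\<^sub>1 B1) \<star>\<^sub>2 (tgt A \<star>\<^sub>1 B2)) =
    (src A \<star>\<^sub>1 B1) \<star>\<^sub>2 ((src A \<star>\<^sub>1 B2) \<star>\<^sub>2 (A \<star>\<^sub>1 tgt B2))"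
    by (rule square_paste[where r = "A \<star>\<^sub>1 tgt B1"]) (use A B t p e in \<open>simp_all add: ps exch_def\<close>)
  then show ?thesis using A B t p by (simp add: ps exch_def)
qed

lemma exch_cmp2_left:
  assumes A: "A1 \<in> cells C 3" "A2 \<in> cells C 3" "tgt A1 = src A2" and B: "B' \<in> cells C 3"
    and t: "tgt (src A1) = src (src B')" and e: "exch A1 B'" "exch A2 B'"
  shows "exch (A1 \<star>\<^sub>2 A2) B'"
proof -
  note p = parallel_low(2)[OF A(1,3)] parallel_low'(3)[OF A(1) B t]
  have "(src A1 \<star>\<^sub>1 B') \<star>\<^sub>2 ((A1 \<star>\<^sub>1 tgt B') \<star>\<^sub>2 (A2 \<star>\<^sub>1 tgt B')) =
    (A1 \<star>\<^sub>1 src B') \<star>\<^sub>2 ((A2 \<star>\<^sub>1 src B') \<star>\<^sub>2 (tgt A2 \<star>\<^sub>1 B'))"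
    by (rule square_paste[where r = "tgt A1 \<star>\<^sub>1 B'"]) (use A B t p e in \<open>simp_all add: ps exch_def\<close>)
  then show ?thesis using A B t p by (simp add: ps exch_def)
qed

text \<open>A whisker on an outer side multiplies the whole equation. A whisker between the two
  cells can be counted with either of them, by associativity.\<close>

lemma exch_whisker:
  assumes A: "A \<in> cells C 3" and B: "B' \<in> cells C 3" and \<phi>: "\<phi> \<in> cells C 2"
  shows "exch A B' \<Longrightarrow> tgt (src A) = src (src B') \<Longrightarrow> tgt (src B') = src \<phi> \<Longrightarrow> exch A (B' \<star>\<^sub>1 \<phi>)"
    and "exch A B' \<Longrightarrow> tgt (src A) = src (src B') \<Longrightarrow> tgt \<phi> = src (src A) \<Longrightarrow> exch (\<phi> \<star>\<^sub>1 A) B'"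
    and "exch A (\<phi> \<star>\<^sub>1 B') \<Longrightarrow> tgt (src A) = src \<phi> \<Longrightarrow> tgt \<phi> = src (src B') \<Longrightarrow> exch (A \<star>\<^sub>1 \<phi>) B'"
proof -
  assume e: "exch A B'" and t: "tgt (src A) = src (src B')"
  note p = parallel_low'(3)[OF A B t]
  {
    assume f: "tgt (src B') = src \<phi>"
    from arg_cong[OF e[unfolded exch_def], of "\<lambda>u. u \<star>\<^sub>1 \<phi>"]
    show "exch A (B' \<star>\<^sub>1 \<phi>)" using A B \<phi> t f p parallel_low'(2)[OF B \<phi> f] by (simp add: ps exch_def)
  next
    assume f: "tgt \<phi> = src (src A)"
    from arg_cong[OF e[unfolded exch_def], of "\<lambda>u. \<phi> \<star>\<^sub>1 u"]
    show "exch (\<phi> \<star>\<^sub>1 A) B'" using A B \<phi> t f p parallel_low'(1)[OF \<phi> A f] by (simp add: ps exch_def)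
  }
next
  assume "exch A (\<phi> \<star>\<^sub>1 B')" "tgt (src A) = src \<phi>" "tgt \<phi> = src (src B')"
  then show "exch (A \<star>\<^sub>1 \<phi>) B'"
    using A B \<phi> parallel_low'(2)[of A \<phi>] parallel_low'(1)[of \<phi> B'] by (simp add: ps exch_def)
qed

text \<open>The 2-cell \<open>\<chi>\<close> between the two 3-cells is kept arbitrary: a left
  whisker of \<open>B'\<close> stands between them and is absorbed into \<open>\<chi>\<close>. This
  is why the independence generators carry a middle 2-cell.\<close>

lemma exchange_whisker:
  assumes B: "B' \<in> wspan3 C G" and A: "A \<in> G" "e \<in> cells C 1" "h \<in> cells C 1"
      "tgt e = src (src (src A))" "tgt (src (src A)) = src h"
    and a: "a = e \<star>\<^sub>0 (A \<star>\<^sub>0 h)"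
  shows "\<chi> \<in> cells C 2 \<Longrightarrow> tgt (src a) = src \<chi> \<Longrightarrow> tgt \<chi> = src (src B') \<Longrightarrow> exch a (\<chi> \<star>\<^sub>1 B')"
  using B
proof (induction arbitrary: \<chi> rule: wspan3.induct)
  case (wspan3_gen A' e' h')
  then show ?case using A G_cells[OF A(1)] G_cells[OF wspan3_gen(1)] indep[OF A(1) wspan3_gen(1)]
    unfolding a exch_def by (simp add: ps)
next
  case (wspan3_idc \<psi>)
  have "a \<in> cells C 3" unfolding a using A G_cells[OF A(1)] by (simp add: ps)
  then show ?case using wspan3_idc exch_idc(1)[of a "\<chi> \<star>\<^sub>1 \<psi>"] by (simp add: ps)
next
  case (wspan3_cmp2 A1 A2)
  have ac: "a \<in> cells C 3" unfolding a using A G_cells[OF A(1)] by (simp add: ps)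
  have t: "tgt \<chi> = src (src A1)" "tgt \<chi> = src (src A2)"
    using wspan3_cmp2(3-5,10) parallel_low(2)[OF wspan3_cmp2(3,5), of Src] by (simp_all add: ps)
  then show ?case
    using exch_cmp2_right[OF ac, of "\<chi> \<star>\<^sub>1 A1" "\<chi> \<star>\<^sub>1 A2"] wspan3_cmp2 by (simp add: ps)
next
  case (wspan3_left2 A1 \<phi>)
  have t: "tgt \<chi> = src \<phi>" using wspan3_left2 by (simp add: ps)
  then show ?case
    using wspan3_left2(5)[of "\<chi> \<star>\<^sub>1 \<phi>"] wspan3_left2(2-4,6,7) parallel_low(1)[OF wspan3_left2(6) t]
    by (simp add: ps)
next
  case (wspan3_right2 A1 \<phi>)
  have ac: "a \<in> cells C 3" unfolding a using A G_cells[OF A(1)] by (simp add: ps)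
  have t: "tgt \<chi> = src (src A1)" using wspan3_right2 by (simp add: ps)
  then show ?case
    using exch_whisker(1)[OF ac _ wspan3_right2(3), of "\<chi> \<star>\<^sub>1 A1"] wspan3_right2 by (simp add: ps)
qed

text \<open>Induction on \<open>A\<close> for all \<open>B'\<close> at once, because a right whisker
  of \<open>A\<close> is transferred to \<open>B'\<close>. The case of a whiskered generator is the
  preceding induction, on \<open>B'\<close>.\<close>

lemma exchange_cells:
  assumes "A \<in> cells C 3" "B' \<in> cells C 3" "tgt (src A) = src (src B')"
  shows "(A \<star>\<^sub>1 src B') \<star>\<^sub>2 (tgt A \<star>\<^sub>1 B') = (src A \<star>\<^sub>1 B') \<star>\<^sub>2 (A \<star>\<^sub>1 tgt B')"
proof -
  have w: "A \<in> wspan3 C G" if "A \<in> cells C 3" for A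
    using that cells3 span3_wspan3 G_cells by blast
  have "exch A B'" using w[OF assms(1)] assms(2,3)
  proof (induction arbitrary: B' rule: wspan3.induct)
    case (wspan3_gen A e h)
    then have "e \<star>\<^sub>0 (A \<star>\<^sub>0 h) \<in> cells C 3" using G_cells[of A] by (simp add: ps)
    \<comment> \<open>With nothing between the two cells, the middle 2-cell is an identity.\<close>
    then show ?case
      using exchange_whisker[OF w[OF wspan3_gen(6)] wspan3_gen(1-5) refl, of "idc C (src (src B'))"] wspan3_gen(6,7)
      by (simp add: ps)
  next
    case (wspan3_idc \<phi>)
    then show ?case by (intro exch_idc) (simp_all add: ps)
  next
    case (wspan3_cmp2 A A')
    then show ?case using parallel_low(2)[OF wspan3_cmp2(3,5)] by (intro exch_cmp2_left) (simp_all add: ps)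
  next
    case (wspan3_left2 A \<phi>)
    then show ?case by (intro exch_whisker) (simp_all add: ps)
  next
    case (wspan3_right2 A \<phi>)
    then show ?case by (intro exch_whisker(3)) (simp_all add: ps)
  qed
  then show ?thesis by (simp add: exch_def)
qed

section \<open>Interchangers of composite 2-cells\<close>

lemma X_cmp_left:
  assumes "\<phi> \<in> cells C 2" "\<psi> \<in> cells C 2"
  shows "\<phi>' \<in> cells C 2 \<Longrightarrow> tgt \<phi> = src \<phi>' \<Longrightarrow> tgt (src \<phi>) = src (src \<psi>) \<Longrightarrow>
    X (\<phi> \<star>\<^sub>1 \<phi>') \<psi> = ((\<phi> \<star>\<^sub>0 src \<psi>) \<star>\<^sub>1 X \<phi>' \<psi>) \<star>\<^sub>2 (X \<phi> \<psi> \<star>\<^sub>1 (\<phi>' \<star>\<^sub>0 tgt \<psi>))"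
  using assms(1)
proof (induction rule: cell2_induct)
  case (idc f)
  then show ?case using assms(2) by (simp add: pX X_idl)
next
  case (cmp w \<phi>)
  then have t: "tgt \<phi> = src \<phi>'" by (simp add: ps)
  show ?case using cmp assms(2) parallel_low(1)[OF cmp(3) t] t by (simp add: pX X_consl)
qed

lemma X_cmp_right_whisker:
  assumes "w \<in> whiskers C B" "\<psi> \<in> cells C 2"
  shows "\<psi>' \<in> cells C 2 \<Longrightarrow> tgt \<psi> = src \<psi>' \<Longrightarrow> tgt (src w) = src (src \<psi>) \<Longrightarrow>
    X w (\<psi> \<star>\<^sub>1 \<psi>') = (X w \<psi> \<star>\<^sub>1 (tgt w \<star>\<^sub>0 \<psi>')) \<star>\<^sub>2 ((src w \<star>\<^sub>0 \<psi>) \<star>\<^sub>1 X w \<psi>')"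
  using assms(2)
proof (induction rule: cell2_induct)
  case (idc g)
  then show ?case using whiskers_cells[OF assms(1)] by (simp add: pX X_idr)
next
  case (cmp v \<psi>)
  then have t: "tgt \<psi> = src \<psi>'" by (simp add: ps)
  show ?case using cmp assms(1) whiskers_cells[OF assms(1)] parallel_low(1)[OF cmp(3) t] t
    by (simp add: pX X_consr)
qed

text \<open>Splitting the first argument needs only the recursion and the laws of precategories.
  Here the swaps come in two different orders: on the left \<open>\<phi>\<close> passes both
  \<open>\<psi>\<close> and \<open>\<psi>'\<close> before \<open>w\<close> moves, on the right
  \<open>w\<close> passes \<open>\<psi>\<close> before \<open>\<phi>\<close> passes
  \<open>\<psi>'\<close>. The two middle swaps \<open>X w \<psi>\<close> and
  \<open>X \<phi> \<psi>'\<close> occupy disjoint parts of the 2-cell, so the exchange law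
  interchanges them.\<close>

lemma X_cmp_right:
  assumes "\<phi> \<in> cells C 2" "\<psi> \<in> cells C 2" "\<psi>' \<in> cells C 2" "tgt \<psi> = src \<psi>'"
  shows "tgt (src \<phi>) = src (src \<psi>) \<Longrightarrow>
    X \<phi> (\<psi> \<star>\<^sub>1 \<psi>') = (X \<phi> \<psi> \<star>\<^sub>1 (tgt \<phi> \<star>\<^sub>0 \<psi>')) \<star>\<^sub>2 ((src \<phi> \<star>\<^sub>0 \<psi>) \<star>\<^sub>1 X \<phi> \<psi>')"
  using assms(1)
proof (induction rule: cell2_induct)
  case (idc f)
  then show ?case using assms(2-) parallel_low(1)[OF assms(2,4)] by (simp add: pX X_idl)
next
  case (cmp w \<phi>)
  note p = parallel_low(1)[OF assms(2,4)]
  have t: "tgt (src w) = src (src \<psi>)" using cmp by (simp add: ps)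
  have e: "(X w \<psi> \<star>\<^sub>1 src (X \<phi> \<psi>')) \<star>\<^sub>2 (tgt (X w \<psi>) \<star>\<^sub>1 X \<phi> \<psi>') =
    (src (X w \<psi>) \<star>\<^sub>1 X \<phi> \<psi>') \<star>\<^sub>2 (X w \<psi> \<star>\<^sub>1 tgt (X \<phi> \<psi>'))"
    using cmp assms(2-) p t by (intro exchange_cells) (simp_all add: pX)
  \<comment> \<open>The first and the last block of swaps are common to both sides, which differ
    only by the exchange in the middle.\<close>
  let ?t = "(w \<star>\<^sub>0 src \<psi>) \<star>\<^sub>1 (X \<phi> \<psi> \<star>\<^sub>1 (tgt \<phi> \<star>\<^sub>0 \<psi>'))"
  let ?t' = "(src w \<star>\<^sub>0 \<psi>) \<star>\<^sub>1 (X w \<psi>' \<star>\<^sub>1 (\<phi> \<star>\<^sub>0 tgt \<psi>'))"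
  from arg_cong[OF e, of "\<lambda>u. ?t \<star>\<^sub>2 (u \<star>\<^sub>2 ?t')"]
  show ?case using cmp assms(2-) p t
    by (simp add: pX X_consl X_cmp_right_whisker)
qed

section \<open>Interchangers and whiskering by 1-cells\<close>

lemma X_whisker_right_w:
  assumes "\<psi> \<in> cells C 2" "w \<in> whiskers C B" "h \<in> cells C 1"
  shows "tgt (src w) = src (src \<psi>) \<Longrightarrow> tgt (src \<psi>) = src h \<Longrightarrow> X w (\<psi> \<star>\<^sub>0 h) = X w \<psi> \<star>\<^sub>0 h"
  using assms(1)
proof (induction rule: cell2_induct)
  case (idc g)
  then show ?case using assms whiskers_cells[OF assms(2)] by (simp add: pX X_idr)
next
  case (cmp v \<psi>)
  then have t: "tgt (src v) = src h" by (simp add: ps)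
  show ?case using cmp assms whiskers_cells[OF assms(2)] whiskers_right[OF cmp(1) assms(3) t] t
    by (simp add: pX X_consr X_wr)
qed

text \<open>Each compatibility with 1-cells is obtained by peeling whiskers off the second argument
  while the first is a single whisker, and then off the first argument; the 1-cell distributes over
  every composite that appears.\<close>

lemma X_whisker_right:
  assumes "\<phi> \<in> cells C 2" "\<psi> \<in> cells C 2" "h \<in> cells C 1" "tgt (src \<psi>) = src h"
  shows "tgt (src \<phi>) = src (src \<psi>) \<Longrightarrow> X \<phi> (\<psi> \<star>\<^sub>0 h) = X \<phi> \<psi> \<star>\<^sub>0 h"
  using assms(1)
proof (induction rule: cell2_induct)
  case (idc f)
  then show ?case using assms by (simp add: pX X_idl)
next
  case (cmp w \<phi>)
  then show ?case using assms by (simp add: pX X_consl X_whisker_right_w)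
qed

lemma X_whisker_left_w:
  assumes "\<psi> \<in> cells C 2" "w \<in> whiskers C B" "e \<in> cells C 1" "tgt e = src (src w)"
  shows "tgt (src w) = src (src \<psi>) \<Longrightarrow> X (e \<star>\<^sub>0 w) \<psi> = e \<star>\<^sub>0 X w \<psi>"
  using assms(1)
proof (induction rule: cell2_induct)
  case (idc g)
  then show ?case using assms whiskers_cells[OF assms(2)] by (simp add: pX X_idr)
next
  case (cmp v \<psi>)
  then show ?case using assms whiskers_cells[OF assms(2)] whiskers_left[OF assms(2-4)]
    by (simp add: pX X_consr X_wl)
qed

lemma X_whisker_left:
  assumes "\<phi> \<in> cells C 2" "\<psi> \<in> cells C 2" "e \<in> cells C 1"
  shows "tgt e = src (src \<phi>) \<Longrightarrow> tgt (src \<phi>) = src (src \<psi>) \<Longrightarrow> X (e \<star>\<^sub>0 \<phi>) \<psi> = e \<star>\<^sub>0 X \<phi> \<psi>"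
  using assms(1)
proof (induction rule: cell2_induct)
  case (idc f)
  then show ?case using assms by (simp add: pX X_idl)
next
  case (cmp w \<phi>)
  then have t: "tgt e = src (src w)" by (simp add: ps)
  show ?case using cmp assms t whiskers_left[OF cmp(1) assms(3) t]
    by (simp add: pX X_consl X_whisker_left_w)
qed

lemma X_whisker_middle_w:
  assumes "\<psi> \<in> cells C 2" "w \<in> whiskers C B" "m \<in> cells C 1" "tgt (src w) = src m"
  shows "tgt m = src (src \<psi>) \<Longrightarrow> X (w \<star>\<^sub>0 m) \<psi> = X w (m \<star>\<^sub>0 \<psi>)"
  using assms(1)
proof (induction rule: cell2_induct)
  case (idc g)
  then show ?case using assms whiskers_cells[OF assms(2)] by (simp add: pX X_idr)
next
  case (cmp v \<psi>)
  then have t: "tgt m = src (src v)" by (simp add: ps)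
  show ?case using cmp assms t whiskers_cells[OF assms(2)] whiskers_right[OF assms(2-4)]
      whiskers_left[OF cmp(1) assms(3) t]
    by (simp add: pX X_consr X_wm)
qed

lemma X_whisker_middle:
  assumes "\<phi> \<in> cells C 2" "\<psi> \<in> cells C 2" "m \<in> cells C 1"
  shows "tgt (src \<phi>) = src m \<Longrightarrow> tgt m = src (src \<psi>) \<Longrightarrow> X (\<phi> \<star>\<^sub>0 m) \<psi> = X \<phi> (m \<star>\<^sub>0 \<psi>)"
  using assms(1)
proof (induction rule: cell2_induct)
  case (idc f)
  then show ?case using assms by (simp add: pX X_idl)
next
  case (cmp w \<phi>)
  then have t: "tgt (src w) = src m" by (simp add: ps)
  show ?case using cmp assms t whiskers_right[OF cmp(1) assms(3) t]
    by (simp add: pX X_consl X_whisker_middle_w)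
qed

section \<open>Naturality of the interchangers\<close>

lemma natural_left_gen:
  assumes A: "A \<in> G" and "\<psi> \<in> cells C 2"
  shows "tgt (src (src A)) = src (src \<psi>) \<Longrightarrow>
    ((A \<star>\<^sub>0 src \<psi>) \<star>\<^sub>1 (tgt (src A) \<star>\<^sub>0 \<psi>)) \<star>\<^sub>2 X (tgt A) \<psi> =
    X (src A) \<psi> \<star>\<^sub>2 ((src (src A) \<star>\<^sub>0 \<psi>) \<star>\<^sub>1 (A \<star>\<^sub>0 tgt \<psi>))"
  using assms(2)
proof (induction rule: cell2_induct)
  case (idc g)
  then show ?case using G_cells[OF A] by (simp add: pX X_idr)
next
  case (cmp v \<psi>)
  have Ac: "A \<in> cells C 3" by (rule G_cells[OF A])
  have t: "tgt (src (src A)) = src (src v)" using cmp by (simp add: ps)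
  have v: "((A \<star>\<^sub>0 src v) \<star>\<^sub>1 (tgt (src A) \<star>\<^sub>0 v)) \<star>\<^sub>2 X (tgt A) v =
    X (src A) v \<star>\<^sub>2 ((src (src A) \<star>\<^sub>0 v) \<star>\<^sub>1 (A \<star>\<^sub>0 tgt v))"
    using cmp(1) t
  proof (cases rule: whiskers.cases)
    case (whisker b f g)
    have b: "b \<in> cells C 2" by (rule B_cells[OF whisker(2)])
    have f: "tgt (src (src A)) = src f" using whisker b t by (simp add: ps)
    \<comment> \<open>The 4-generator provides the square for \<open>f \<star>\<^sub>0 b\<close>,
      with \<open>f\<close> in the part of the middle 1-cell; the outer 1-cell \<open>g\<close> is
      pulled out of the interchanger.\<close>
    have *: "X \<phi> (f \<star>\<^sub>0 (b \<star>\<^sub>0 g)) = X \<phi> (f \<star>\<^sub>0 b) \<star>\<^sub>0 g"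
      if "\<phi> \<in> cells C 2" "tgt (src \<phi>) = src f" for \<phi>
      using X_whisker_right[of \<phi> "f \<star>\<^sub>0 b" g] that whisker(2-) b by (simp add: ps)
    from arg_cong[OF natl[OF A whisker(3,2) f whisker(5)], of "\<lambda>u. u \<star>\<^sub>0 g"]
    show ?thesis using whisker b f Ac by (simp add: pX *)
  qed
  let ?p = "(A \<star>\<^sub>0 src v) \<star>\<^sub>1 ((tgt (src A) \<star>\<^sub>0 v) \<star>\<^sub>1 (tgt (src A) \<star>\<^sub>0 \<psi>))" and ?q = "X (tgt A) v \<star>\<^sub>1 (tgt (src A) \<star>\<^sub>0 \<psi>)"
    and ?q' = "X (src A) v \<star>\<^sub>1 (tgt (src A) \<star>\<^sub>0 \<psi>)" and ?r = "(src (src A) \<star>\<^sub>0 v) \<star>\<^sub>1 ((A \<star>\<^sub>0 tgt v) \<star>\<^sub>1 (tgt (src A) \<star>\<^sub>0 \<psi>))"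
    and ?t = "(src (src A) \<star>\<^sub>0 v) \<star>\<^sub>1 X (tgt A) \<psi>" and ?t' = "(src (src A) \<star>\<^sub>0 v) \<star>\<^sub>1 X (src A) \<psi>"
    and ?s = "(src (src A) \<star>\<^sub>0 v) \<star>\<^sub>1 ((src (src A) \<star>\<^sub>0 \<psi>) \<star>\<^sub>1 (A \<star>\<^sub>0 tgt \<psi>))"
  \<comment> \<open>The square for the first whisker, extended on the right, is glued to the square
    for the remainder, extended on the left.\<close>
  have "?p \<star>\<^sub>2 (?q \<star>\<^sub>2 ?t) = ?q' \<star>\<^sub>2 (?t' \<star>\<^sub>2 ?s)"
  proof (rule square_paste[where r = ?r])
    show "?p \<star>\<^sub>2 ?q = ?q' \<star>\<^sub>2 ?r"
      using arg_cong[OF v, of "\<lambda>u. u \<star>\<^sub>1 (tgt (src A) \<star>\<^sub>0 \<psi>)"] cmp(1-5) Ac t by (simp add: pX)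
    show "?r \<star>\<^sub>2 ?t = ?t' \<star>\<^sub>2 ?s"
      using arg_cong[OF cmp(6), of "\<lambda>u. (src (src A) \<star>\<^sub>0 v) \<star>\<^sub>1 u"] cmp(1-5) Ac t by (simp add: pX)
  qed (use cmp(1-5) Ac t in \<open>simp_all add: pX\<close>)
  then show ?case using cmp(1-5) Ac t by (simp add: pX X_cmp_right)
qed

lemma natural_right_gen:
  assumes A: "A \<in> G" and "\<phi> \<in> cells C 2"
  shows "tgt (src \<phi>) = src (src (src A)) \<Longrightarrow>
    ((\<phi> \<star>\<^sub>0 src (src A)) \<star>\<^sub>1 (tgt \<phi> \<star>\<^sub>0 A)) \<star>\<^sub>2 X \<phi> (tgt A) =
    X \<phi> (src A) \<star>\<^sub>2 ((src \<phi> \<star>\<^sub>0 A) \<star>\<^sub>1 (\<phi> \<star>\<^sub>0 tgt (src A)))"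
  using assms(2)
proof (induction rule: cell2_induct)
  case (idc g)
  then show ?case using G_cells[OF A] by (simp add: pX X_idl)
next
  case (cmp w \<phi>)
  have Ac: "A \<in> cells C 3" by (rule G_cells[OF A])
  have t: "tgt (src w) = src (src (src A))" using cmp by (simp add: ps)
  have w: "((w \<star>\<^sub>0 src (src A)) \<star>\<^sub>1 (tgt w \<star>\<^sub>0 A)) \<star>\<^sub>2 X w (tgt A) =
    X w (src A) \<star>\<^sub>2 ((src w \<star>\<^sub>0 A) \<star>\<^sub>1 (w \<star>\<^sub>0 tgt (src A)))"
    using cmp(1) t
  proof (cases rule: whiskers.cases)
    case (whisker b f g)
    have b: "b \<in> cells C 2" by (rule B_cells[OF whisker(2)])
    have g: "tgt g = src (src (src A))" using whisker b t by (simp add: ps)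
    \<comment> \<open>On this side \<open>f\<close> is the 1-cell pulled out, and \<open>g\<close>
      becomes the middle one.\<close>
    have *: "X (f \<star>\<^sub>0 (b \<star>\<^sub>0 g)) \<psi> = f \<star>\<^sub>0 X (b \<star>\<^sub>0 g) \<psi>"
      if "\<psi> \<in> cells C 2" "src (src \<psi>) = src (src (src A))" for \<psi>
      using X_whisker_left[of "b \<star>\<^sub>0 g" \<psi> f] that whisker(2-) b g by (simp add: ps)
    from arg_cong[OF natr[OF whisker(2,4) A whisker(6) g], of "\<lambda>u. f \<star>\<^sub>0 u"]
    show ?thesis using whisker b g Ac by (simp add: pX *)
  qed
  let ?v = "src (src A)" and ?v' = "tgt (src A)"
  let ?p = "(w \<star>\<^sub>0 ?v) \<star>\<^sub>1 ((\<phi> \<star>\<^sub>0 ?v) \<star>\<^sub>1 (tgt \<phi> \<star>\<^sub>0 A))" and ?q = "(w \<star>\<^sub>0 ?v) \<star>\<^sub>1 X \<phi> (tgt A)"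
    and ?q' = "(w \<star>\<^sub>0 ?v) \<star>\<^sub>1 X \<phi> (src A)" and ?r = "(w \<star>\<^sub>0 ?v) \<star>\<^sub>1 ((src \<phi> \<star>\<^sub>0 A) \<star>\<^sub>1 (\<phi> \<star>\<^sub>0 ?v'))"
    and ?t = "X w (tgt A) \<star>\<^sub>1 (\<phi> \<star>\<^sub>0 ?v')" and ?t' = "X w (src A) \<star>\<^sub>1 (\<phi> \<star>\<^sub>0 ?v')"
    and ?s = "(src w \<star>\<^sub>0 A) \<star>\<^sub>1 ((w \<star>\<^sub>0 ?v') \<star>\<^sub>1 (\<phi> \<star>\<^sub>0 ?v'))"
  \<comment> \<open>The remainder \<open>\<phi>\<close> passes before the first whisker
    \<open>w\<close>, so its square comes first.\<close>
  have "?p \<star>\<^sub>2 (?q \<star>\<^sub>2 ?t) = ?q' \<star>\<^sub>2 (?t' \<star>\<^sub>2 ?s)"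
  proof (rule square_paste[where r = ?r])
    show "?p \<star>\<^sub>2 ?q = ?q' \<star>\<^sub>2 ?r"
      using arg_cong[OF cmp(6), of "\<lambda>u. (w \<star>\<^sub>0 ?v) \<star>\<^sub>1 u"] cmp(1-5) Ac t by (simp add: pX)
    show "?r \<star>\<^sub>2 ?t = ?t' \<star>\<^sub>2 ?s"
      using arg_cong[OF w, of "\<lambda>u. u \<star>\<^sub>1 (\<phi> \<star>\<^sub>0 ?v')"] cmp(1-5) Ac t by (simp add: pX)
  qed (use cmp(1-5) Ac t in \<open>simp_all add: pX\<close>)
  then show ?case using cmp(1-5) Ac t by (simp add: pX X_cmp_left)
qed

end

context gray_core
begin

text \<open>The cell \<open>\<psi>\<close> stays arbitrary, because a 1-cell on the right of
  \<open>A\<close> is moved into \<open>\<psi>\<close> by the middle compatibility. Whiskering along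
  dimension 1 glues the naturality square of \<open>A\<close> to an instance of the exchange
  law.\<close>

lemma natural_left:
  assumes "A \<in> cells C 3"
  shows "\<psi> \<in> cells C 2 \<Longrightarrow> tgt (src (src A)) = src (src \<psi>) \<Longrightarrow>
    ((A \<star>\<^sub>0 src \<psi>) \<star>\<^sub>1 (tgt (src A) \<star>\<^sub>0 \<psi>)) \<star>\<^sub>2 X (tgt A) \<psi> =
    X (src A) \<psi> \<star>\<^sub>2 ((src (src A) \<star>\<^sub>0 \<psi>) \<star>\<^sub>1 (A \<star>\<^sub>0 tgt \<psi>))"
  using cells3[OF assms]
proof (induction arbitrary: \<psi> rule: span3.induct)
  case (span3_gen A)
  then show ?case by (rule natural_left_gen)
next
  case (span3_idc \<phi>)
  then show ?case by (simp add: pX)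
next
  case (span3_cmp2 A A')
  note p = parallel_low(2)[OF span3_cmp2(3,5)]
  have t: "tgt (src (src A)) = src (src \<psi>)" using span3_cmp2 by (simp add: ps)
  let ?v = "src \<psi>" and ?v' = "tgt \<psi>" and ?u = "src (src A)" and ?u' = "tgt (src A)"
  have "X (src A) \<psi> \<star>\<^sub>2 (((?u \<star>\<^sub>0 \<psi>) \<star>\<^sub>1 (A \<star>\<^sub>0 ?v')) \<star>\<^sub>2 ((?u \<star>\<^sub>0 \<psi>) \<star>\<^sub>1 (A' \<star>\<^sub>0 ?v'))) =
    ((A \<star>\<^sub>0 ?v) \<star>\<^sub>1 (?u' \<star>\<^sub>0 \<psi>)) \<star>\<^sub>2 (((A' \<star>\<^sub>0 ?v) \<star>\<^sub>1 (?u' \<star>\<^sub>0 \<psi>)) \<star>\<^sub>2 X (tgt A') \<psi>)"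
    by (rule square_paste[where r = "X (tgt A) \<psi>"])
      (use span3_cmp2 p t in \<open>simp_all add: pX\<close>)
  then show ?case using span3_cmp2(3-5,8) p t by (simp add: pX)
next
  case (span3_left1 A e)
  have t: "tgt (src (src A)) = src (src \<psi>)" using span3_left1 by (simp add: ps)
  from arg_cong[OF span3_left1(5)[OF span3_left1(6) t], of "\<lambda>u. e \<star>\<^sub>0 u"]
  show ?case using span3_left1(2-4,6) t by (simp add: pX X_whisker_left)
next
  case (span3_right1 A h)
  have t: "tgt h = src (src \<psi>)" using span3_right1 by (simp add: ps)
  have m: "h \<star>\<^sub>0 \<psi> \<in> cells C 2" "tgt (src (src A)) = src (src (h \<star>\<^sub>0 \<psi>))"
    using span3_right1(2-4,6) t by (simp_all add: ps)
  from span3_right1(5)[OF m]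
  show ?case using span3_right1(2-4,6) t by (simp add: pX X_whisker_middle)
next
  case (span3_left2 A \<phi>)
  note p = parallel_low'(1)[OF span3_left2(3,2,4)]
  have t: "tgt (src \<phi>) = src (src \<psi>)" using span3_left2 by (simp add: ps)
  let ?v = "src \<psi>" and ?v' = "tgt \<psi>" and ?u = "src \<phi>" and ?u' = "tgt (src A)"
  \<comment> \<open>The interchanger of \<open>\<phi>\<close> with \<open>\<psi>\<close> and the
    whiskered cell \<open>A\<close> act on different factors, so the exchange law gives the second
    square.\<close>
  have e: "(X \<phi> \<psi> \<star>\<^sub>1 src (A \<star>\<^sub>0 ?v')) \<star>\<^sub>2 (tgt (X \<phi> \<psi>) \<star>\<^sub>1 (A \<star>\<^sub>0 ?v')) =
    (src (X \<phi> \<psi>) \<star>\<^sub>1 (A \<star>\<^sub>0 ?v')) \<star>\<^sub>2 (X \<phi> \<psi> \<star>\<^sub>1 tgt (A \<star>\<^sub>0 ?v'))"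
    by (rule exchange_cells) (use span3_left2(2-4,6) p t in \<open>simp_all add: pX\<close>)
  have n: "((A \<star>\<^sub>0 ?v) \<star>\<^sub>1 (?u' \<star>\<^sub>0 \<psi>)) \<star>\<^sub>2 X (tgt A) \<psi> =
    X (src A) \<psi> \<star>\<^sub>2 ((src (src A) \<star>\<^sub>0 \<psi>) \<star>\<^sub>1 (A \<star>\<^sub>0 ?v'))"
    using span3_left2(2-6) p t by simp
  let ?p = "(\<phi> \<star>\<^sub>0 ?v) \<star>\<^sub>1 ((A \<star>\<^sub>0 ?v) \<star>\<^sub>1 (?u' \<star>\<^sub>0 \<psi>))" and ?q = "(\<phi> \<star>\<^sub>0 ?v) \<star>\<^sub>1 X (tgt A) \<psi>"
    and ?q' = "(\<phi> \<star>\<^sub>0 ?v) \<star>\<^sub>1 X (src A) \<psi>" and ?r = "(\<phi> \<star>\<^sub>0 ?v) \<star>\<^sub>1 ((tgt \<phi> \<star>\<^sub>0 \<psi>) \<star>\<^sub>1 (A \<star>\<^sub>0 ?v'))"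
    and ?t = "X \<phi> \<psi> \<star>\<^sub>1 (tgt A \<star>\<^sub>0 ?v')" and ?t' = "X \<phi> \<psi> \<star>\<^sub>1 (src A \<star>\<^sub>0 ?v')"
    and ?s = "(?u \<star>\<^sub>0 \<psi>) \<star>\<^sub>1 ((\<phi> \<star>\<^sub>0 ?v') \<star>\<^sub>1 (A \<star>\<^sub>0 ?v'))"
  have "?p \<star>\<^sub>2 (?q \<star>\<^sub>2 ?t) = ?q' \<star>\<^sub>2 (?t' \<star>\<^sub>2 ?s)"
  proof (rule square_paste[where r = ?r])
    show "?p \<star>\<^sub>2 ?q = ?q' \<star>\<^sub>2 ?r"
      using arg_cong[OF n, of "\<lambda>u. (\<phi> \<star>\<^sub>0 ?v) \<star>\<^sub>1 u"] span3_left2(2-4,6) p t by (simp add: pX)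
    show "?r \<star>\<^sub>2 ?t = ?t' \<star>\<^sub>2 ?s"
      using e[symmetric] span3_left2(2-4,6) p t by (simp add: pX)
  qed (use span3_left2(2-4,6) p t in \<open>simp_all add: pX\<close>)
  then show ?case using span3_left2(2-4,6) p t by (simp add: pX X_cmp_left)
next
  case (span3_right2 A \<phi>)
  note p = parallel_low'(2)[OF span3_right2(2,3,4)]
  have t: "tgt (src (src A)) = src (src \<psi>)" using span3_right2 by (simp add: ps)
  let ?v = "src \<psi>" and ?v' = "tgt \<psi>" and ?u = "src (src A)" and ?u' = "tgt \<phi>"
  \<comment> \<open>For a whisker on the right of \<open>A\<close> the exchange square comes before
    the naturality square.\<close>
  have e: "((A \<star>\<^sub>0 ?v) \<star>\<^sub>1 src (X \<phi> \<psi>)) \<star>\<^sub>2 (tgt (A \<star>\<^sub>0 ?v) \<star>\<^sub>1 X \<phi> \<psi>) =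
    (src (A \<star>\<^sub>0 ?v) \<star>\<^sub>1 X \<phi> \<psi>) \<star>\<^sub>2 ((A \<star>\<^sub>0 ?v) \<star>\<^sub>1 tgt (X \<phi> \<psi>))"
    by (rule exchange_cells) (use span3_right2(2-4,6) p t in \<open>simp_all add: pX\<close>)
  have n: "((A \<star>\<^sub>0 ?v) \<star>\<^sub>1 (tgt (src A) \<star>\<^sub>0 \<psi>)) \<star>\<^sub>2 X (tgt A) \<psi> =
    X (src A) \<psi> \<star>\<^sub>2 ((src (src A) \<star>\<^sub>0 \<psi>) \<star>\<^sub>1 (A \<star>\<^sub>0 ?v'))"
    using span3_right2(2-6) p t by simp
  let ?p = "(A \<star>\<^sub>0 ?v) \<star>\<^sub>1 ((\<phi> \<star>\<^sub>0 ?v) \<star>\<^sub>1 (?u' \<star>\<^sub>0 \<psi>))" and ?q = "(tgt A \<star>\<^sub>0 ?v) \<star>\<^sub>1 X \<phi> \<psi>"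
    and ?q' = "(src A \<star>\<^sub>0 ?v) \<star>\<^sub>1 X \<phi> \<psi>" and ?r = "(A \<star>\<^sub>0 ?v) \<star>\<^sub>1 ((tgt (src A) \<star>\<^sub>0 \<psi>) \<star>\<^sub>1 (\<phi> \<star>\<^sub>0 ?v'))"
    and ?t = "X (tgt A) \<psi> \<star>\<^sub>1 (\<phi> \<star>\<^sub>0 ?v')" and ?t' = "X (src A) \<psi> \<star>\<^sub>1 (\<phi> \<star>\<^sub>0 ?v')"
    and ?s = "(?u \<star>\<^sub>0 \<psi>) \<star>\<^sub>1 ((A \<star>\<^sub>0 ?v') \<star>\<^sub>1 (\<phi> \<star>\<^sub>0 ?v'))"
  have "?p \<star>\<^sub>2 (?q \<star>\<^sub>2 ?t) = ?q' \<star>\<^sub>2 (?t' \<star>\<^sub>2 ?s)"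
  proof (rule square_paste[where r = ?r])
    show "?p \<star>\<^sub>2 ?q = ?q' \<star>\<^sub>2 ?r"
      using e span3_right2(2-4,6) p t by (simp add: pX)
    show "?r \<star>\<^sub>2 ?t = ?t' \<star>\<^sub>2 ?s"
      using arg_cong[OF n, of "\<lambda>u. u \<star>\<^sub>1 (\<phi> \<star>\<^sub>0 ?v')"] span3_right2(2-4,6) p t by (simp add: pX)
  qed (use span3_right2(2-4,6) p t in \<open>simp_all add: pX\<close>)
  then show ?case using span3_right2(2-4,6) p t by (simp add: pX X_cmp_left)
qed

text \<open>In the mirrored argument a 1-cell on the left of \<open>A\<close> is moved into
  \<open>\<phi>\<close>, which therefore stays arbitrary, and whiskers along dimension 1 split the
  second argument of \<open>X\<close> instead of the first.\<close>

lemma natural_right: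
  assumes "A \<in> cells C 3"
  shows "\<phi> \<in> cells C 2 \<Longrightarrow> tgt (src \<phi>) = src (src (src A)) \<Longrightarrow>
    ((\<phi> \<star>\<^sub>0 src (src A)) \<star>\<^sub>1 (tgt \<phi> \<star>\<^sub>0 A)) \<star>\<^sub>2 X \<phi> (tgt A) =
    X \<phi> (src A) \<star>\<^sub>2 ((src \<phi> \<star>\<^sub>0 A) \<star>\<^sub>1 (\<phi> \<star>\<^sub>0 tgt (src A)))"
  using cells3[OF assms]
proof (induction arbitrary: \<phi> rule: span3.induct)
  case (span3_gen A)
  then show ?case by (rule natural_right_gen)
next
  case (span3_idc \<psi>)
  then show ?case by (simp add: pX)
next
  case (span3_cmp2 A A')
  note p = parallel_low(2)[OF span3_cmp2(3,5)]
  have t: "tgt (src \<phi>) = src (src (src A))" using span3_cmp2 by (simp add: ps)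
  let ?v = "src (src A)" and ?v' = "tgt (src A)" and ?u = "src \<phi>" and ?u' = "tgt \<phi>"
  have "X \<phi> (src A) \<star>\<^sub>2 (((?u \<star>\<^sub>0 A) \<star>\<^sub>1 (\<phi> \<star>\<^sub>0 ?v')) \<star>\<^sub>2 ((?u \<star>\<^sub>0 A') \<star>\<^sub>1 (\<phi> \<star>\<^sub>0 ?v'))) =
    ((\<phi> \<star>\<^sub>0 ?v) \<star>\<^sub>1 (?u' \<star>\<^sub>0 A)) \<star>\<^sub>2 (((\<phi> \<star>\<^sub>0 ?v) \<star>\<^sub>1 (?u' \<star>\<^sub>0 A')) \<star>\<^sub>2 X \<phi> (tgt A'))"
    by (rule square_paste[where r = "X \<phi> (tgt A)"])
      (use span3_cmp2 p t in \<open>simp_all add: pX\<close>)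
  then show ?case using span3_cmp2(3-5,8) p t by (simp add: pX)
next
  case (span3_left1 A e)
  have t: "tgt (src \<phi>) = src e" using span3_left1 by (simp add: ps)
  have m: "\<phi> \<star>\<^sub>0 e \<in> cells C 2" "tgt (src (\<phi> \<star>\<^sub>0 e)) = src (src (src A))"
    using span3_left1(2-4,6) t by (simp_all add: ps)
  from span3_left1(5)[OF m]
  show ?case using span3_left1(2-4,6) t by (simp add: pX X_whisker_middle)
next
  case (span3_right1 A h)
  have t: "tgt (src \<phi>) = src (src (src A))" using span3_right1 by (simp add: ps)
  from arg_cong[OF span3_right1(5)[OF span3_right1(6) t], of "\<lambda>u. u \<star>\<^sub>0 h"]
  show ?case using span3_right1(2-4,6) t by (simp add: pX X_whisker_right)
next
  case (span3_left2 A \<psi>)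
  note p = parallel_low'(1)[OF span3_left2(3,2,4)]
  have t: "tgt (src \<phi>) = src (src \<psi>)" using span3_left2 by (simp add: ps)
  let ?v = "src \<psi>" and ?v' = "tgt (src A)" and ?u = "src \<phi>" and ?u' = "tgt \<phi>"
  have e: "(X \<phi> \<psi> \<star>\<^sub>1 src (?u' \<star>\<^sub>0 A)) \<star>\<^sub>2 (tgt (X \<phi> \<psi>) \<star>\<^sub>1 (?u' \<star>\<^sub>0 A)) =
    (src (X \<phi> \<psi>) \<star>\<^sub>1 (?u' \<star>\<^sub>0 A)) \<star>\<^sub>2 (X \<phi> \<psi> \<star>\<^sub>1 tgt (?u' \<star>\<^sub>0 A))"
    by (rule exchange_cells) (use span3_left2(2-4,6) p t in \<open>simp_all add: pX\<close>)
  have n: "((\<phi> \<star>\<^sub>0 src (src A)) \<star>\<^sub>1 (?u' \<star>\<^sub>0 A)) \<star>\<^sub>2 X \<phi> (tgt A) =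
    X \<phi> (src A) \<star>\<^sub>2 ((?u \<star>\<^sub>0 A) \<star>\<^sub>1 (\<phi> \<star>\<^sub>0 ?v'))"
    using span3_left2(2-6) p t by simp
  let ?p = "(\<phi> \<star>\<^sub>0 ?v) \<star>\<^sub>1 ((?u' \<star>\<^sub>0 \<psi>) \<star>\<^sub>1 (?u' \<star>\<^sub>0 A))" and ?q = "X \<phi> \<psi> \<star>\<^sub>1 (?u' \<star>\<^sub>0 tgt A)"
    and ?q' = "X \<phi> \<psi> \<star>\<^sub>1 (?u' \<star>\<^sub>0 src A)" and ?r = "(?u \<star>\<^sub>0 \<psi>) \<star>\<^sub>1 ((\<phi> \<star>\<^sub>0 tgt \<psi>) \<star>\<^sub>1 (?u' \<star>\<^sub>0 A))"
    and ?t = "(?u \<star>\<^sub>0 \<psi>) \<star>\<^sub>1 X \<phi> (tgt A)" and ?t' = "(?u \<star>\<^sub>0 \<psi>) \<star>\<^sub>1 X \<phi> (src A)"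
    and ?s = "(?u \<star>\<^sub>0 \<psi>) \<star>\<^sub>1 ((?u \<star>\<^sub>0 A) \<star>\<^sub>1 (\<phi> \<star>\<^sub>0 ?v'))"
  have "?p \<star>\<^sub>2 (?q \<star>\<^sub>2 ?t) = ?q' \<star>\<^sub>2 (?t' \<star>\<^sub>2 ?s)"
  proof (rule square_paste[where r = ?r])
    show "?p \<star>\<^sub>2 ?q = ?q' \<star>\<^sub>2 ?r"
      using e[symmetric] span3_left2(2-4,6) p t by (simp add: pX)
    show "?r \<star>\<^sub>2 ?t = ?t' \<star>\<^sub>2 ?s"
      using arg_cong[OF n, of "\<lambda>u. (?u \<star>\<^sub>0 \<psi>) \<star>\<^sub>1 u"] span3_left2(2-4,6) p t by (simp add: pX)
  qed (use span3_left2(2-4,6) p t in \<open>simp_all add: pX\<close>)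
  then show ?case using span3_left2(2-4,6) p t by (simp add: pX X_cmp_right)
next
  case (span3_right2 A \<psi>)
  note p = parallel_low'(2)[OF span3_right2(2,3,4)]
  have t: "tgt (src \<phi>) = src (src (src A))" using span3_right2 by (simp add: ps)
  let ?v = "src (src A)" and ?v' = "tgt \<psi>" and ?u = "src \<phi>" and ?u' = "tgt \<phi>"
  have e: "((?u \<star>\<^sub>0 A) \<star>\<^sub>1 src (X \<phi> \<psi>)) \<star>\<^sub>2 (tgt (?u \<star>\<^sub>0 A) \<star>\<^sub>1 X \<phi> \<psi>) =
    (src (?u \<star>\<^sub>0 A) \<star>\<^sub>1 X \<phi> \<psi>) \<star>\<^sub>2 ((?u \<star>\<^sub>0 A) \<star>\<^sub>1 tgt (X \<phi> \<psi>))"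
    by (rule exchange_cells) (use span3_right2(2-4,6) p t in \<open>simp_all add: pX\<close>)
  have n: "((\<phi> \<star>\<^sub>0 ?v) \<star>\<^sub>1 (?u' \<star>\<^sub>0 A)) \<star>\<^sub>2 X \<phi> (tgt A) =
    X \<phi> (src A) \<star>\<^sub>2 ((?u \<star>\<^sub>0 A) \<star>\<^sub>1 (\<phi> \<star>\<^sub>0 tgt (src A)))"
    using span3_right2(2-6) p t by simp
  let ?p = "(\<phi> \<star>\<^sub>0 ?v) \<star>\<^sub>1 ((?u' \<star>\<^sub>0 A) \<star>\<^sub>1 (?u' \<star>\<^sub>0 \<psi>))" and ?q = "X \<phi> (tgt A) \<star>\<^sub>1 (?u' \<star>\<^sub>0 \<psi>)"
    and ?q' = "X \<phi> (src A) \<star>\<^sub>1 (?u' \<star>\<^sub>0 \<psi>)" and ?r = "(?u \<star>\<^sub>0 A) \<star>\<^sub>1 ((\<phi> \<star>\<^sub>0 src \<psi>) \<star>\<^sub>1 (?u' \<star>\<^sub>0 \<psi>))"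
    and ?t = "(?u \<star>\<^sub>0 tgt A) \<star>\<^sub>1 X \<phi> \<psi>" and ?t' = "(?u \<star>\<^sub>0 src A) \<star>\<^sub>1 X \<phi> \<psi>"
    and ?s = "(?u \<star>\<^sub>0 A) \<star>\<^sub>1 ((?u \<star>\<^sub>0 \<psi>) \<star>\<^sub>1 (\<phi> \<star>\<^sub>0 ?v'))"
  have "?p \<star>\<^sub>2 (?q \<star>\<^sub>2 ?t) = ?q' \<star>\<^sub>2 (?t' \<star>\<^sub>2 ?s)"
  proof (rule square_paste[where r = ?r])
    show "?p \<star>\<^sub>2 ?q = ?q' \<star>\<^sub>2 ?r"
      using arg_cong[OF n, of "\<lambda>u. u \<star>\<^sub>1 (?u' \<star>\<^sub>0 \<psi>)"] span3_right2(2-4,6) p t by (simp add: pX)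
    show "?r \<star>\<^sub>2 ?t = ?t' \<star>\<^sub>2 ?s"
      using e span3_right2(2-4,6) p t by (simp add: pX)
  qed (use span3_right2(2-4,6) p t in \<open>simp_all add: pX\<close>)
  then show ?case using span3_right2(2-4,6) p t by (simp add: pX X_cmp_right)
qed

lemma lax_gray: "lax_gray_category C X"
  by (intro lax_gray_category.intro lax_gray_category_axioms.intro precategory_axioms)
    (simp_all add: joinable_iff_bd composable_iff_bd bd_low X_in X_src X_tgt X_idl X_idr X_cmp_left X_cmp_right
      X_whisker_left X_whisker_right X_whisker_middle exchange_cells natural_left natural_right)

end

section \<open>Decompositions of cells of free precategories\<close>

context free_extension
begin

lemma gen_cl: "gen n C G d g = cl (Gen g)"
  by (simp add: gen_def cl_def)

text \<open>Induction on a representing term, rephrased in terms of cells so that later arguments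
  about 3-cells need not mention terms.\<close>

lemma E_top_induct [consumes 1, case_names gen idc cat left right]:
  assumes "c \<in> cells E (Suc n)"
    and gen: "\<And>g. g \<in> G \<Longrightarrow> P (gen n C G d g)"
    and idc: "\<And>x. x \<in> cells C n \<Longrightarrow> P (idc E (Old x))"
    and cat: "\<And>a b. a \<in> cells E (Suc n) \<Longrightarrow> b \<in> cells E (Suc n) \<Longrightarrow> composable E n a b \<Longrightarrow>
      P a \<Longrightarrow> P b \<Longrightarrow> P (cmp E n a b)"
    and left: "\<And>i u a. u \<in> cells C (Suc i) \<Longrightarrow> a \<in> cells E (Suc n) \<Longrightarrow> composable E i (Old u) a \<Longrightarrow>
      P a \<Longrightarrow> P (cmp E i (Old u) a)"
    and right: "\<And>i u a. u \<in> cells C (Suc i) \<Longrightarrow> a \<in> cells E (Suc n) \<Longrightarrow> composable E i a (Old u) \<Longrightarrow>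
      P a \<Longrightarrow> P (cmp E i a (Old u))"
  shows "P c"
proof -
  have "wf t \<Longrightarrow> P (cl t)" for t
  proof (induction t)
    case (Gen g)
    then show ?case using gen gen_cl by simp
  next
    case (Unit x)
    then show ?case using idc[of x] by (simp add: cells_iff idc_Old_top)
  next
    case (Cat a b)
    then have "wf a" "wf b" by simp_all
    then show ?case using cat[of "cl a" "cl b"] Cat
      by (auto simp: E_cells_top composable_cl_cl simp del: twf.simps)
  next
    case (LWh u a)
    then obtain i where i: "wf a" "dm C u = Suc i" "composable C i u (tb Src a)"
      using wf_LWh by blast
    then show ?case using left[of u i "cl a"] LWh composableD(1)[OF i(3)]
      by (auto simp: E_cells_top composable_Old_cl cells_iff simp del: twf.simps)
  next
    case (RWh a u)
    then obtain i where i: "wf a" "dm C u = Suc i" "composable C i (tb Src a) u"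
      using wf_RWh by blast
    then show ?case using right[of u i "cl a"] RWh composableD(2)[OF i(3)]
      by (auto simp: E_cells_top composable_cl_Old cells_iff simp del: twf.simps)
  qed
  then show ?thesis using assms(1) E_cells_top by auto
qed

end

section \<open>Closure properties of the span of whiskers\<close>

context precat3
begin

lemma whiskers_in: "B \<subseteq> cells C 2 \<Longrightarrow> w \<in> whiskers C B \<Longrightarrow> w \<in> cells C 2"
  by (auto elim!: whiskers.cases simp: ps subset_iff)

lemma span2_in: "B \<subseteq> cells C 2 \<Longrightarrow> \<phi> \<in> span2 C B \<Longrightarrow> \<phi> \<in> cells C 2"
  by (erule span2.cases) (auto simp: ps whiskers_in)

lemma span2_append:
  assumes "\<phi> \<in> span2 C B" "B \<subseteq> cells C 2" "\<psi> \<in> span2 C B"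
  shows "tgt \<phi> = src \<psi> \<Longrightarrow> \<phi> \<star>\<^sub>1 \<psi> \<in> span2 C B"
  using assms(1)
proof (induction rule: span2.induct)
  case (span2_idc f)
  then show ?case using assms(3) span2_in[OF assms(2,3)] by (simp add: ps)
next
  case (span2_cmp w \<phi>)
  then show ?case using span2_in[OF assms(2,3)] whiskers_in[OF assms(2)]
    by (auto simp: ps intro!: span2.span2_cmp)
qed

text \<open>A 1-cell distributes over the composite and merges with the outer 1-cells of each
  whisker.\<close>

lemma span2_whisker:
  assumes B: "B \<subseteq> cells C 2" and "\<phi> \<in> span2 C B" "e \<in> cells C 1"
  shows "(tgt e = src (src \<phi>) \<longrightarrow> e \<star>\<^sub>0 \<phi> \<in> span2 C B) \<and> (tgt (src \<phi>) = src e \<longrightarrow> \<phi> \<star>\<^sub>0 e \<in> span2 C B)"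
  using assms(2)
proof (induction rule: span2.induct)
  case (span2_idc f)
  then show ?case using assms(3) by (auto simp: ps intro!: span2.span2_idc)
next
  case (span2_cmp w \<phi>)
  have w: "w \<in> cells C 2" by (rule whiskers_in[OF B span2_cmp(1)])
  have l: "e \<star>\<^sub>0 w \<in> whiskers C B" if "tgt e = src (src w)"
    using span2_cmp(1)
  proof (cases rule: whiskers.cases)
    case (whisker b f g)
    then have "(e \<star>\<^sub>0 f) \<star>\<^sub>0 (b \<star>\<^sub>0 g) \<in> whiskers C B"
      using B assms(3) that by (intro whiskers.whisker) (auto simp: ps subset_iff)
    then show ?thesis using whisker B assms(3) that by (auto simp: ps subset_iff)
  qed
  have r: "w \<star>\<^sub>0 e \<in> whiskers C B" if "tgt (src w) = src e"
    using span2_cmp(1)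
  proof (cases rule: whiskers.cases)
    case (whisker b f g)
    then have "f \<star>\<^sub>0 (b \<star>\<^sub>0 (g \<star>\<^sub>0 e)) \<in> whiskers C B"
      using B assms(3) that by (intro whiskers.whisker) (auto simp: ps subset_iff)
    then show ?thesis using whisker B assms(3) that by (auto simp: ps subset_iff)
  qed
  show ?case using l r span2_cmp w assms(3) parallel_low(1)[OF w span2_cmp(4)]
    by (auto simp: ps intro!: span2.span2_cmp)
qed

text \<open>Identities on both sides make \<open>b\<close> a whisker, and one more identity after it
  ends the composite.\<close>

lemma span2_basic:
  assumes "b \<in> B" "b \<in> cells C 2" shows "b \<in> span2 C B"
proof -
  have "idc C (src (src b)) \<star>\<^sub>0 (b \<star>\<^sub>0 idc C (tgt (src b))) \<in> whiskers C B"
    using assms by (intro whisker) (simp_all add: ps)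
  then have "b \<in> whiskers C B" using assms by (simp add: ps)
  then have "b \<star>\<^sub>1 idc C (tgt b) \<in> span2 C B" using assms by (intro span2_cmp span2_idc) (simp_all add: ps)
  then show ?thesis using assms by (simp add: ps)
qed

end

section \<open>The free 3-precategory of the presentation\<close>

context gray_presentation
begin

text \<open>A set is a 0-precategory: it has no composable pairs and no cells of positive dimension,
  so the undefined operations are never consulted.\<close>

lemma ext1: "free_extension 0 (discrete (P0 P)) (P1 P) (d1 P)"
proof -
  have "precategory 0 (discrete (P0 P))"
    by unfold_locales (auto simp: discrete_def cells_def composable_def joinable_def)
  then show ?thesis using prepolygraph
    by (simp add: free_extension_def free_extension_axioms_def prepolygraph4_def)
qed

lemma ext2: "free_extension 1 (F1 P) (P2 P) (d2 P)"
  using free_extension.E_precategory[OF ext1] prepolygraph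
  by (simp add: free_extension_def free_extension_axioms_def prepolygraph4_def F1_def One_nat_def)

lemma ext3: "free_extension 2 (F2 P) (P3 P) (d3 P)"
  using free_extension.E_precategory[OF ext2] prepolygraph
  by (simp add: free_extension_def free_extension_axioms_def prepolygraph4_def F2_def)

lemma F_precat3: "precat3 F"
  using free_extension.E_precategory[OF ext3] by (simp add: precat3_def F3_def)

lemma generators4: "generators 3 F (P4 P) (d4 P)"
  using prepolygraph by (simp add: prepolygraph4_def)

lemmas Fps = precat3.ps[OF F_precat3]
lemmas F_comp = precat3.composable_iff_bd[OF F_precat3]
lemmas F_join = precat3.joinable_iff_bd[OF F_precat3]
lemmas F_par = precat3.parallel_low[OF F_precat3]

abbreviation J :: "('a, 'b) ext \<Rightarrow> ('a, 'b, 'c, 'd) cell3" where "J u \<equiv> Old (Old u)"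
abbreviation wf2 where "wf2 \<equiv> twf 1 (F1 P) (P2 P) (d2 P)"
abbreviation tb2 where "tb2 \<equiv> tbd (F1 P) (d2 P)"
text \<open>Adjoining 3-cells does not alter the 2-cells, so a 2-cell is still a class of terms over
  \<open>F1 P\<close>, seen through one more inclusion.\<close>

definition cl2 :: "(('a, 'b) ext, 'c) fterm \<Rightarrow> ('a, 'b, 'c, 'd) cell3" where
  "cl2 t = Old (free_extension.cl 1 (F1 P) (P2 P) (d2 P) t)"

lemmas Old2 = free_extension.cmp_Old_Old[OF ext2, folded F2_def]
  free_extension.bd_Old[OF ext2, folded F2_def] free_extension.dm_Old[OF ext2, folded F2_def]
  free_extension.Old_car[OF ext2, folded F2_def] free_extension.composable_Old_Old[OF ext2, folded F2_def]
lemmas Old3 = free_extension.cmp_Old_Old[OF ext3, folded F3_def]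
  free_extension.bd_Old[OF ext3, folded F3_def] free_extension.dm_Old[OF ext3, folded F3_def]
  free_extension.Old_car[OF ext3, folded F3_def] free_extension.composable_Old_Old[OF ext3, folded F3_def]

lemma J_simps:
  "cmp F i (J u) (J v) = J (cmp (F1 P) i u v)"
  "bd F e (J u) = J (bd (F1 P) e u)"
  "J u \<in> cells F k \<longleftrightarrow> u \<in> cells (F1 P) k"
  "composable F i (J u) (J v) \<longleftrightarrow> composable (F1 P) i u v"
  by (simp_all add: Old2 Old3 cells_iff)

lemma F_cells: "cells F 1 = J ` cells (F1 P) 1" "cells F 2 = cl2 ` {t. wf2 t}"
proof -
  have "cells F k = Old ` cells (F2 P) k" if "k \<le> 2" for k
    using free_extension.E_cells_le[OF ext3, of k] that by (simp add: F3_def)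
  moreover have "cells (F2 P) 1 = Old ` cells (F1 P) 1"
    using free_extension.E_cells_le[OF ext2, of 1] by (simp add: F2_def)
  moreover have "cells (F2 P) 2 = free_extension.cl 1 (F1 P) (P2 P) (d2 P) ` {t. wf2 t}"
    using free_extension.E_cells_top[OF ext2] by (simp add: F2_def)
  ultimately show "cells F 1 = J ` cells (F1 P) 1" "cells F 2 = cl2 ` {t. wf2 t}"
    by (simp_all add: image_image cl2_def)
qed

lemma cl2_cells: "wf2 t \<Longrightarrow> cl2 t \<in> cells F 2"
  by (simp add: F_cells)

lemma cl2_simps:
  "wf2 t \<Longrightarrow> bd F e (cl2 t) = J (tb2 e t)"
  "wf2 (Cat s t) \<Longrightarrow> cmp F 1 (cl2 s) (cl2 t) = cl2 (Cat s t)"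
  "wf2 (LWh u t) \<Longrightarrow> cmp F 0 (J u) (cl2 t) = cl2 (LWh u t)"
  "wf2 (RWh t u) \<Longrightarrow> cmp F 0 (cl2 t) (J u) = cl2 (RWh t u)"
  "x \<in> cells (F1 P) 1 \<Longrightarrow> idc F (J x) = cl2 (Unit x)"
  "gen2 \<alpha> = cl2 (Gen \<alpha>)"
proof -
  note c = free_extension.bd_cl[OF ext2, folded F2_def] free_extension.cmp_cl_cl[OF ext2, folded F2_def]
    free_extension.cmp_Old_cl[OF ext2, folded F2_def] free_extension.cmp_cl_Old[OF ext2, folded F2_def]
  show "wf2 t \<Longrightarrow> bd F e (cl2 t) = J (tb2 e t)"
    "wf2 (Cat s t) \<Longrightarrow> cmp F 1 (cl2 s) (cl2 t) = cl2 (Cat s t)"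
    "wf2 (LWh u t) \<Longrightarrow> cmp F 0 (J u) (cl2 t) = cl2 (LWh u t)"
    "wf2 (RWh t u) \<Longrightarrow> cmp F 0 (cl2 t) (J u) = cl2 (RWh t u)"
    by (simp_all add: cl2_def Old3 c del: twf.simps)
  have "idc F (J x) = Old (idc (F2 P) (Old x))" if "x \<in> cells (F1 P) 1"
    using that free_extension.idc_Old[OF ext3, folded F3_def, of "Old x"] by (simp add: Old2 cells_iff)
  then show "x \<in> cells (F1 P) 1 \<Longrightarrow> idc F (J x) = cl2 (Unit x)"
    using free_extension.idc_Old_top[OF ext2, folded F2_def, of x] by (simp add: cells_iff cl2_def)
  show "gen2 \<alpha> = cl2 (Gen \<alpha>)"
    using free_extension.gen_cl[OF ext2, of \<alpha>] by (simp add: gen2_def cl2_def)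
qed

lemma gen2_cells: "\<alpha> \<in> P2 P \<Longrightarrow> gen2 \<alpha> \<in> cells F 2"
  by (simp add: cl2_simps cl2_cells)

lemma gen3_cells: "A \<in> P3 P \<Longrightarrow> gen3 A \<in> cells F 3"
  using free_extension.E_cells_top[OF ext3] free_extension.gen_cl[OF ext3, of A]
  by (auto simp: gen3_def F3_def)

lemma F_span3: "A \<in> cells F 3 \<Longrightarrow> A \<in> span3 F (gen3 ` P3 P)"
proof -
  assume "A \<in> cells F 3"
  then have "A \<in> cells (free_ext 2 (F2 P) (P3 P) (d3 P)) (Suc 2)" by (simp add: F3_def)
  then show ?thesis
  proof (induction rule: free_extension.E_top_induct[OF ext3, consumes 1, case_names gen idc cat left right])
    case (gen A)
    then show ?case by (auto simp: gen3_def intro!: span3_gen)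
  next
    case (idc x)
    then show ?case by (auto simp: F3_def[symmetric] Old3 cells_iff intro!: span3_idc)
  next
    case (cat a b)
    then show ?case by (auto simp: F3_def[symmetric] F_comp intro!: span3_cmp2)
  next
    case (left i u a)
    have i: "i \<le> 1" and u: "Old u \<in> cells F (Suc i)"
      using left(1) precategory.dm_le[OF free_extension.axioms(1)[OF ext3], of u]
      by (auto simp: cells_iff Old3)
    then consider "i = 0" | "i = 1" by linarith
    then show ?case using left u
      by cases (auto simp: F3_def[symmetric] F_comp One_nat_def[symmetric] intro: span3_left1 span3_left2)
  next
    case (right i u a)
    have i: "i \<le> 1" and u: "Old u \<in> cells F (Suc i)"
      using right(1) precategory.dm_le[OF free_extension.axioms(1)[OF ext3], of u]
      by (auto simp: cells_iff Old3)
    then consider "i = 0" | "i = 1" by linarith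
    then show ?case using right u
      by cases (auto simp: F3_def[symmetric] F_comp One_nat_def[symmetric] intro: span3_right1 span3_right2)
  qed
qed

lemma gen2_subset: "gen2 ` P2 P \<subseteq> cells F 2"
  using gen2_cells by auto

lemma cl2_bd_cells: "wf2 t \<Longrightarrow> J (tb2 e t) \<in> cells F 1"
  using precat3.bd_low(2)[OF F_precat3 cl2_cells, of t e] by (simp add: cl2_simps)

lemma J_composable: "J u \<in> cells F 1 \<Longrightarrow> J v \<in> cells F 1 \<Longrightarrow>
  composable (F1 P) 0 u v \<longleftrightarrow> tgt (J u) = src (J v)"
  using F_comp(1)[of "J u" "J v"] by (simp add: J_simps)

text \<open>Cells of \<open>F1 P\<close> have dimension at most 1, so in a term for a 2-cell the
  only whiskering is by 1-cells along dimension 0.\<close>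

lemma wf2_LWh: "wf2 (LWh u t) \<longleftrightarrow> wf2 t \<and> J u \<in> cells F 1 \<and> dm (F1 P) u = 1 \<and> tgt (J u) = src (J (tb2 Src t))"
proof -
  have "u \<in> car (F1 P) \<Longrightarrow> dm (F1 P) u \<le> 1"
    by (rule precategory.dm_le[OF free_extension.axioms(1)[OF ext2]])
  then have "wf2 (LWh u t) \<longleftrightarrow> wf2 t \<and> dm (F1 P) u = 1 \<and> composable (F1 P) 0 u (tb2 Src t)"
    by (auto simp: composable_def joinable_def)
  also have "\<dots> \<longleftrightarrow> wf2 t \<and> J u \<in> cells F 1 \<and> dm (F1 P) u = 1 \<and> composable (F1 P) 0 u (tb2 Src t)"
    unfolding J_simps by (auto simp: composable_def joinable_def cells_iff)
  finally show ?thesis using J_composable cl2_bd_cells by auto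
qed

lemma wf2_RWh: "wf2 (RWh t u) \<longleftrightarrow> wf2 t \<and> J u \<in> cells F 1 \<and> dm (F1 P) u = 1 \<and> tgt (J (tb2 Src t)) = src (J u)"
proof -
  have g: "tgt (J (tb2 Tgt t)) = tgt (J (tb2 Src t))" if "wf2 t"
    using that precat3.globular_low(1)[OF F_precat3 cl2_cells[OF that]] by (simp add: cl2_simps)
  have "u \<in> car (F1 P) \<Longrightarrow> dm (F1 P) u \<le> 1"
    by (rule precategory.dm_le[OF free_extension.axioms(1)[OF ext2]])
  then have "wf2 (RWh t u) \<longleftrightarrow> wf2 t \<and> dm (F1 P) u = 1 \<and> composable (F1 P) 0 (tb2 Tgt t) u"
    by (auto simp: composable_def joinable_def)
  also have "\<dots> \<longleftrightarrow> wf2 t \<and> J u \<in> cells F 1 \<and> dm (F1 P) u = 1 \<and> composable (F1 P) 0 (tb2 Tgt t) u"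
    unfolding J_simps by (auto simp: composable_def joinable_def cells_iff)
  finally show ?thesis using J_composable[OF cl2_bd_cells] g by auto
qed

lemma F_span2: "\<phi> \<in> cells F 2 \<Longrightarrow> \<phi> \<in> span2 F (gen2 ` P2 P)"
proof -
  assume "\<phi> \<in> cells F 2"
  then obtain t where t: "\<phi> = cl2 t" "wf2 t" by (auto simp: F_cells)
  have "wf2 t \<Longrightarrow> cl2 t \<in> span2 F (gen2 ` P2 P)"
  proof (induction t)
    case (Gen \<alpha>)
    then show ?case using precat3.span2_basic[OF F_precat3, of "gen2 \<alpha>"] gen2_cells[of \<alpha>]
      by (simp add: cl2_simps)
  next
    case (Unit x)
    then show ?case using span2_idc[of "J x" F] by (simp add: J_simps cl2_simps)
  next
    case (Cat a b)
    then show ?case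
      using precat3.span2_append[OF F_precat3 _ gen2_subset, of "cl2 a" "cl2 b"] by (simp add: cl2_simps)
  next
    case (LWh u a)
    then show ?case
      using precat3.span2_whisker[OF F_precat3 gen2_subset, of "cl2 a" "J u"] wf2_LWh[of u a]
      by (simp add: cl2_simps del: twf.simps)
  next
    case (RWh a u)
    then show ?case
      using precat3.span2_whisker[OF F_precat3 gen2_subset, of "cl2 a" "J u"] wf2_RWh[of a u]
      by (simp add: cl2_simps del: twf.simps)
  qed
  then show ?thesis using t by simp
qed

text \<open>The list of whiskers read off a term is invariant under the axioms of precategories, whence
  the uniqueness of the decomposition of a 2-cell.\<close>

primrec term_whiskers :: "(('a, 'b) ext, 'c) fterm \<Rightarrow>
    (('a, 'b, 'c, 'd) cell3 \<times> 'c \<times> ('a, 'b, 'c, 'd) cell3) list" where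
  "term_whiskers (Gen \<alpha>) = [(idc F (src (src (gen2 \<alpha>))), \<alpha>, idc F (tgt (src (gen2 \<alpha>))))]"
| "term_whiskers (Unit x) = []"
| "term_whiskers (Cat a b) = term_whiskers a @ term_whiskers b"
| "term_whiskers (LWh u a) = map (\<lambda>(f, \<alpha>, g). (J u \<star>\<^sub>0 f, \<alpha>, g)) (term_whiskers a)"
| "term_whiskers (RWh a u) = map (\<lambda>(f, \<alpha>, g). (f, \<alpha>, g \<star>\<^sub>0 J u)) (term_whiskers a)"

text \<open>The unit and associativity laws for the outer 1-cells need these matching conditions;
  they persist along a term because parallel 1-cells have the same end points.\<close>

lemma term_whiskers_bd:
  "wf2 t \<Longrightarrow> (f, \<alpha>, g) \<in> set (term_whiskers t) \<Longrightarrow>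
    f \<in> cells F 1 \<and> g \<in> cells F 1 \<and> src f = src (J (tb2 Src t)) \<and> tgt g = tgt (J (tb2 Src t))"
proof (induction t arbitrary: f g)
  case (Gen \<alpha>')
  then have "\<alpha>' \<in> P2 P" by simp
  then show ?case using Gen cl2_bd_cells[OF Gen(1), of Src] cl2_simps(1)[OF Gen(1), of Src]
    by (auto simp: Fps cl2_simps(6))
next
  case (Unit x)
  then show ?case by simp
next
  case (Cat a b)
  have ab: "wf2 a" "wf2 b" "tb2 Tgt a = tb2 Src b" using Cat by simp_all
  have "bd F e (J (tb2 Tgt a)) = bd F e (J (tb2 Src a))" for e
    using precat3.globular_low(1)[OF F_precat3 cl2_cells[OF ab(1)], of e] ab(1) by (simp add: cl2_simps)
  then show ?case using Cat ab by auto
next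
  case (LWh u a)
  then have w: "wf2 a" "J u \<in> cells F 1" "dm (F1 P) u = 1" "tgt (J u) = src (J (tb2 Src a))"
    using wf2_LWh by blast+
  obtain f' where f: "f = J u \<star>\<^sub>0 f'" "(f', \<alpha>, g) \<in> set (term_whiskers a)" using LWh(3) by auto
  have "J (tb2 Src (LWh u a)) = J u \<star>\<^sub>0 J (tb2 Src a)" using w(3) by (simp add: J_simps)
  then show ?case using LWh(1)[OF w(1) f(2)] w(2,4) cl2_bd_cells[OF w(1), of Src] f(1)
    by (simp add: Fps del: tbd.simps)
next
  case (RWh a u)
  then have w: "wf2 a" "J u \<in> cells F 1" "dm (F1 P) u = 1" "tgt (J (tb2 Src a)) = src (J u)"
    using wf2_RWh by blast+
  obtain g' where f: "g = g' \<star>\<^sub>0 J u" "(f, \<alpha>, g') \<in> set (term_whiskers a)" using RWh(3) by auto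
  have "J (tb2 Src (RWh a u)) = J (tb2 Src a) \<star>\<^sub>0 J u" using w(3) by (simp add: J_simps)
  then show ?case using RWh(1)[OF w(1) f(2)] w(2,4) cl2_bd_cells[OF w(1), of Src] f(1)
    by (simp add: Fps del: tbd.simps)
qed

lemma J_idc: assumes "x \<in> cells (F1 P) 0" shows "idc F (J x) = J (idc (F1 P) x)"
  using assms free_extension.idc_Old[OF ext3, folded F3_def, of "Old x"]
    free_extension.idc_Old[OF ext2, folded F2_def, of x]
  by (simp add: Old2 cells_iff)

lemma J_idc_bd: assumes "x \<in> cells (F1 P) 0" shows "bd F e (J (idc (F1 P) x)) = J x"
  using precat3.idc_low(2)[OF F_precat3, of "J x" e] J_idc[OF assms] assms by (simp add: J_simps(3))

text \<open>Axioms on concatenation become laws of lists, and axioms on whiskers become unit and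
  associativity laws for the outer 1-cells.\<close>

lemma tax_term_whiskers:
  assumes "tax 1 (F1 P) a b" "wf2 a" "wf2 b"
  shows "term_whiskers a = term_whiskers b"
proof -
  have dm1: "dm (F1 P) u \<le> 1" if "J u \<in> cells F 1" for u using that unfolding J_simps(3) by (simp add: cells_iff)
  show ?thesis using assms(1)
  proof (cases rule: tax.cases)
    case (tax_idc_lwh x)
    have w: "J (idc (F1 P) x) \<in> cells F 1" "tgt (J (idc (F1 P) x)) = src (J (tb2 Src b))"
      using assms(2) tax_idc_lwh wf2_LWh by blast+
    have x: "x \<in> cells (F1 P) 0" using tax_idc_lwh by (simp add: cells_iff)
    have "tgt (J (idc (F1 P) x)) = J x" "J (idc (F1 P) x) = idc F (J x)"
      using J_idc[OF x] J_idc_bd[OF x] by simp_all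
    then have "J (idc (F1 P) x) \<star>\<^sub>0 f = f" if "(f, \<alpha>, g) \<in> set (term_whiskers b)" for f \<alpha> g
      using term_whiskers_bd[OF assms(3) that] w by (simp add: Fps)
    then show ?thesis using tax_idc_lwh by (auto intro!: map_idI)
  next
    case (tax_rwh_idc x)
    have w: "J (idc (F1 P) x) \<in> cells F 1" "tgt (J (tb2 Src b)) = src (J (idc (F1 P) x))"
      using assms(2) tax_rwh_idc wf2_RWh by blast+
    have x: "x \<in> cells (F1 P) 0" using tax_rwh_idc by (simp add: cells_iff)
    have "src (J (idc (F1 P) x)) = J x" "J (idc (F1 P) x) = idc F (J x)"
      using J_idc[OF x] J_idc_bd[OF x] by simp_all
    then have "g \<star>\<^sub>0 J (idc (F1 P) x) = g" if "(f, \<alpha>, g) \<in> set (term_whiskers b)" for f \<alpha> g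
      using term_whiskers_bd[OF assms(3) that] w by (simp add: Fps)
    then show ?thesis using tax_rwh_idc by (auto intro!: map_idI)
  next
    case (tax_lwh_lwh u i v a')
    have w: "wf2 a'" "J v \<in> cells F 1" "tgt (J v) = src (J (tb2 Src a'))"
      "J u \<in> cells F 1" "dm (F1 P) v = 1"
      using assms(3) tax_lwh_lwh wf2_LWh by blast+
    then have "i = 0" using tax_lwh_lwh by simp
    then have t: "tgt (J u) = src (J v)" "J (cmp (F1 P) i u v) = J u \<star>\<^sub>0 J v"
      using tax_lwh_lwh J_composable[OF w(4,2)] by (simp_all add: J_simps)
    have "(J u \<star>\<^sub>0 J v) \<star>\<^sub>0 f = J u \<star>\<^sub>0 (J v \<star>\<^sub>0 f)" if "(f, \<alpha>, g) \<in> set (term_whiskers a')" for f \<alpha> g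
      using term_whiskers_bd[OF w(1) that] w t by (simp add: Fps)
    then show ?thesis using tax_lwh_lwh t(2) by auto
  next
    case (tax_rwh_rwh u i v a')
    have w: "wf2 (RWh a' u)" "J v \<in> cells F 1" "tgt (J (tb2 Src (RWh a' u))) = src (J v)"
      using assms(2) tax_rwh_rwh wf2_RWh by blast+
    then have w': "wf2 a'" "J u \<in> cells F 1" "tgt (J (tb2 Src a')) = src (J u)" "dm (F1 P) u = 1"
      using wf2_RWh by blast+
    then have "i = 0" using tax_rwh_rwh by simp
    then have t: "tgt (J u) = src (J v)" "J (cmp (F1 P) i u v) = J u \<star>\<^sub>0 J v"
      using tax_rwh_rwh J_composable[OF w'(2) w(2)] by (simp_all add: J_simps)
    have "(g \<star>\<^sub>0 J u) \<star>\<^sub>0 J v = g \<star>\<^sub>0 (J u \<star>\<^sub>0 J v)" if "(f, \<alpha>, g) \<in> set (term_whiskers a')" for f \<alpha> g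
      using term_whiskers_bd[OF w'(1) that] w w' t by (simp add: Fps)
    then show ?thesis using tax_rwh_rwh t(2) by auto
  next
    \<comment> \<open>The four remaining axioms would whisker by a cell of dimension at least 2, and
      none occurs in a term for a 2-cell.\<close>
    case (tax_lwh_over_lwh u i v a')
    then show ?thesis using assms(2) dm1[of v] wf2_LWh by fastforce
  next
    case (tax_lwh_over_rwh u i v a')
    then show ?thesis using assms(2) dm1[of v] wf2_LWh wf2_RWh by fastforce
  next
    case (tax_rwh_over_lwh u i v a')
    then show ?thesis using assms(2) dm1[of v] wf2_LWh wf2_RWh by fastforce
  next
    case (tax_rwh_over_rwh u i v a')
    then show ?thesis using assms(2) dm1[of v] wf2_RWh by fastforce
  qed auto
qed

lemma teq_term_whiskers:
  "teq 1 (F1 P) (P2 P) (d2 P) a b \<Longrightarrow> term_whiskers a = term_whiskers b"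
  by (induction rule: teq.induct) (simp_all add: tax_term_whiskers)

section \<open>Uniqueness of the decomposition of a 2-cell\<close>

definition cell_whiskers :: "('a, 'b, 'c, 'd) cell3 \<Rightarrow>
    (('a, 'b, 'c, 'd) cell3 \<times> 'c \<times> ('a, 'b, 'c, 'd) cell3) list" where
  "cell_whiskers \<phi> = term_whiskers (SOME t. wf2 t \<and> \<phi> = cl2 t)"

lemma cell_whiskers_cl2: "wf2 t \<Longrightarrow> cell_whiskers (cl2 t) = term_whiskers t"
proof -
  assume w: "wf2 t"
  define s where "s = (SOME s. wf2 s \<and> cl2 t = cl2 s)"
  have "wf2 s \<and> cl2 t = cl2 s" unfolding s_def by (rule someI[of _ t]) (simp add: w)
  then have "teq 1 (F1 P) (P2 P) (d2 P) t s"
    using free_extension.cl_eq_iff[OF ext2 w, of s] by (simp add: cl2_def)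
  then show ?thesis using teq_term_whiskers by (simp add: cell_whiskers_def s_def)
qed

lemma cell_whiskers_idc: "f \<in> cells F 1 \<Longrightarrow> cell_whiskers (idc F f) = []"
  by (auto simp: F_cells cl2_simps cell_whiskers_cl2)

lemma cell_whiskers_cmp:
  assumes "\<phi> \<in> cells F 2" "\<psi> \<in> cells F 2" "tgt \<phi> = src \<psi>"
  shows "cell_whiskers (\<phi> \<star>\<^sub>1 \<psi>) = cell_whiskers \<phi> @ cell_whiskers \<psi>"
  using assms by (auto simp: F_cells cl2_simps cell_whiskers_cl2)

lemma cell_whiskers_left:
  assumes "e \<in> cells F 1" "\<phi> \<in> cells F 2" "tgt e = src (src \<phi>)"
  shows "cell_whiskers (e \<star>\<^sub>0 \<phi>) = map (\<lambda>(f, \<alpha>, g). (e \<star>\<^sub>0 f, \<alpha>, g)) (cell_whiskers \<phi>)"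
proof -
  obtain u t where u: "e = J u" "u \<in> cells (F1 P) 1" "\<phi> = cl2 t" "wf2 t" using assms by (auto simp: F_cells)
  then have "wf2 (LWh u t)" using assms wf2_LWh[of u t] by (simp add: cl2_simps cells_iff)
  then show ?thesis using u by (simp add: cl2_simps cell_whiskers_cl2 del: twf.simps)
qed

lemma cell_whiskers_right:
  assumes "e \<in> cells F 1" "\<phi> \<in> cells F 2" "tgt (src \<phi>) = src e"
  shows "cell_whiskers (\<phi> \<star>\<^sub>0 e) = map (\<lambda>(f, \<alpha>, g). (f, \<alpha>, g \<star>\<^sub>0 e)) (cell_whiskers \<phi>)"
proof -
  obtain u t where u: "e = J u" "u \<in> cells (F1 P) 1" "\<phi> = cl2 t" "wf2 t" using assms by (auto simp: F_cells)
  then have "wf2 (RWh t u)" using assms wf2_RWh[of t u] by (simp add: cl2_simps cells_iff)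
  then show ?thesis using u by (simp add: cl2_simps cell_whiskers_cl2 del: twf.simps)
qed

lemma is_whisker_iff: "is_whisker (f, \<alpha>, g) \<longleftrightarrow> \<alpha> \<in> P2 P \<and> f \<in> cells F 1 \<and> g \<in> cells F 1 \<and>
    tgt f = src (src (gen2 \<alpha>)) \<and> tgt (src (gen2 \<alpha>)) = src g"
  using gen2_cells by (auto simp: F_join)

lemma is_whiskerD:
  assumes "is_whisker w" "w = (f, \<alpha>, g)"
  shows "\<alpha> \<in> P2 P" "f \<in> cells F 1" "g \<in> cells F 1" "tgt f = src (src (gen2 \<alpha>))"
    "tgt (src (gen2 \<alpha>)) = src g" "gen2 \<alpha> \<in> cells F 2"
  using assms is_whisker_iff gen2_cells by blast+

lemma whisker_cells: "is_whisker w \<Longrightarrow> whisker w \<in> cells F 2"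
  using gen2_cells by (cases w) (simp add: is_whisker_iff Fps del: is_whisker.simps)

text \<open>The identities that \<open>term_whiskers\<close> puts around a generator are absorbed by
  the outer 1-cells, so the triple is recovered exactly from the cell.\<close>

lemma cell_whiskers_whisker: "is_whisker w \<Longrightarrow> cell_whiskers (whisker w) = [w]"
proof (cases w)
  case (fields f \<alpha> g)
  assume w0: "is_whisker w"
  note w = is_whiskerD[OF w0 fields]
  have "cell_whiskers (gen2 \<alpha>) = [(idc F (src (src (gen2 \<alpha>))), \<alpha>, idc F (tgt (src (gen2 \<alpha>))))]"
    using w(1) by (simp add: cl2_simps(6) cell_whiskers_cl2)
  then show ?thesis using w unfolding fields
    by (simp add: Fps cell_whiskers_left cell_whiskers_right)
qed

lemma paste_cells: "whisker_path f ws \<Longrightarrow> paste f ws \<in> cells F 2 \<and> src (paste f ws) = f"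
  by (induction ws arbitrary: f) (auto simp: Fps whisker_cells)

text \<open>This makes \<open>cell_whiskers\<close> a left inverse of \<open>paste\<close>, so two
  paths with the same composite are equal: the uniqueness half of the description by
  \<open>THE\<close> in \<open>decomp\<close>.\<close>

lemma cell_whiskers_paste: "whisker_path f ws \<Longrightarrow> cell_whiskers (paste f ws) = ws"
proof (induction ws arbitrary: f)
  case (Cons w ws)
  then show ?case
    using paste_cells[of "tgt (whisker w)" ws]
    by (simp add: cell_whiskers_cmp cell_whiskers_whisker whisker_cells)
qed (simp add: cell_whiskers_idc)

lemma F_whiskersE:
  assumes "w \<in> whiskers F (gen2 ` P2 P)"
  obtains w' where "w = whisker w'" "is_whisker w'"
  using assms
proof (cases rule: whiskers.cases)
  case (whisker b f g)
  then obtain \<alpha> where \<alpha>: "b = gen2 \<alpha>" "\<alpha> \<in> P2 P" by auto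
  have "w = gray_data.whisker P (f, \<alpha>, g)" "is_whisker (f, \<alpha>, g)"
    using whisker \<alpha> gen2_cells[OF \<alpha>(2)] by (simp_all add: is_whisker_iff Fps del: is_whisker.simps)
  then show ?thesis by (rule that)
qed

lemma paste_exists: "\<phi> \<in> cells F 2 \<Longrightarrow> \<exists>ws. whisker_path (src \<phi>) ws \<and> paste (src \<phi>) ws = \<phi>"
proof -
  assume "\<phi> \<in> cells F 2"
  then have "\<phi> \<in> span2 F (gen2 ` P2 P)" by (rule F_span2)
  then show ?thesis
  proof (induction rule: span2.induct)
    case (span2_idc f)
    then show ?case by (intro exI[of _ "[]"]) (simp add: Fps)
  next
    case (span2_cmp w \<phi>)
    then obtain w' ws where w: "w = whisker w'" "is_whisker w'" "whisker_path (src \<phi>) ws"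
      "paste (src \<phi>) ws = \<phi>" by (auto elim!: F_whiskersE)
    then show ?case using span2_cmp whisker_cells[OF w(2)]
      by (intro exI[of _ "w' # ws"]) (simp add: Fps)
  qed
qed

lemma decomp_cell_whiskers:
  assumes "\<phi> \<in> cells F 2"
  shows "decomp \<phi> = cell_whiskers \<phi>" "whisker_path (src \<phi>) (decomp \<phi>)" "paste (src \<phi>) (decomp \<phi>) = \<phi>"
proof -
  obtain ws where ws: "whisker_path (src \<phi>) ws" "paste (src \<phi>) ws = \<phi>" using paste_exists[OF assms] by blast
  have 1: "ws = cell_whiskers \<phi>" using cell_whiskers_paste[OF ws(1)] ws(2) by simp
  have u: "ws' = ws" if "whisker_path (src \<phi>) ws' \<and> paste (src \<phi>) ws' = \<phi>" for ws'
    using cell_whiskers_paste[OF conjunct1[OF that]] conjunct2[OF that] 1 by simp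
  have 2: "decomp \<phi> = ws" unfolding decomp_def
    by (rule the_equality, rule conjI[OF ws], rule u)
  show "decomp \<phi> = cell_whiskers \<phi>" "whisker_path (src \<phi>) (decomp \<phi>)" "paste (src \<phi>) (decomp \<phi>) = \<phi>"
    using 1 2 ws by simp_all
qed

lemma decomp_idc: "f \<in> cells F 1 \<Longrightarrow> decomp (idc F f) = []"
  by (simp add: decomp_cell_whiskers Fps cell_whiskers_idc)

lemma decomp_whisker: "is_whisker w \<Longrightarrow> decomp (whisker w) = [w]"
  by (simp add: decomp_cell_whiskers whisker_cells cell_whiskers_whisker)

lemma decomp_cmp: "is_whisker w \<Longrightarrow> \<phi> \<in> cells F 2 \<Longrightarrow> tgt (whisker w) = src \<phi> \<Longrightarrow>
    decomp (whisker w \<star>\<^sub>1 \<phi>) = w # decomp \<phi>"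
  by (simp add: decomp_cell_whiskers whisker_cells cell_whiskers_whisker cell_whiskers_cmp Fps)

end

section \<open>The interchangers of the free 3-precategory\<close>

context precat3
begin

text \<open>Both end points are recorded, as an empty list does not determine the 2-cell whose
  identity is its composite.\<close>

primrec chain :: "'c \<Rightarrow> 'c list \<Rightarrow> 'c \<Rightarrow> bool" where
  "chain c [] d \<longleftrightarrow> c \<in> cells C 2 \<and> c = d"
| "chain c (A # L) d \<longleftrightarrow> A \<in> cells C 3 \<and> src A = c \<and> chain (tgt A) L d"

primrec fold2 :: "'c \<Rightarrow> 'c list \<Rightarrow> 'c" where
  "fold2 c [] = idc C c"
| "fold2 c (A # L) = A \<star>\<^sub>2 fold2 (tgt A) L"

lemma fold2_bd:
  "chain c L d \<Longrightarrow> fold2 c L \<in> cells C 3 \<and> src (fold2 c L) = c \<and> tgt (fold2 c L) = d"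
  by (induction L arbitrary: c) (auto simp: ps)

lemma foldl_fold2:
  "chain c L d \<Longrightarrow> A \<in> cells C 3 \<Longrightarrow> tgt A = c \<Longrightarrow> foldl (\<star>\<^sub>2) A L = A \<star>\<^sub>2 fold2 c L"
proof (induction L arbitrary: c A)
  case Nil
  then show ?case by (simp add: ps)
next
  case (Cons B L)
  then have B: "B \<in> cells C 3" "src B = c" "chain (tgt B) L d" by simp_all
  then show ?case using Cons(1)[OF B(3), of "A \<star>\<^sub>2 B"] Cons(3,4) fold2_bd[OF B(3)] by (simp add: ps)
qed

text \<open>\<open>XX\<close> accumulates from the left, starting with an identity, whereas
  inductions on whiskers take lists apart from the front; this passes from one bracketing to the
  other.\<close>

lemma foldl_idc_fold2: "chain c L d \<Longrightarrow> foldl (\<star>\<^sub>2) (idc C c) L = fold2 c L"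
  using foldl_fold2[of c L d "idc C c"] fold2_bd[of c L d] by (cases L) (auto simp: ps)

lemma chain_append:
  "chain c L d \<Longrightarrow> chain d L' e \<Longrightarrow> chain c (L @ L') e \<and> fold2 c (L @ L') = fold2 c L \<star>\<^sub>2 fold2 d L'"
proof (induction L arbitrary: c)
  case Nil
  then show ?case using fold2_bd[of d L' e] by (simp add: ps)
next
  case (Cons A L)
  then show ?case using fold2_bd[of d L' e] fold2_bd[of "tgt A" L d] by (simp add: ps)
qed

text \<open>Whiskering by a 2-cell distributes over \<open>\<star>\<^sub>2\<close>, so it may be
  applied entry by entry.\<close>

lemma chain_left:
  "chain c L d \<Longrightarrow> \<kappa> \<in> cells C 2 \<Longrightarrow> tgt \<kappa> = src c \<Longrightarrow>
    chain (\<kappa> \<star>\<^sub>1 c) (map ((\<star>\<^sub>1) \<kappa>) L) (\<kappa> \<star>\<^sub>1 d) \<and> fold2 (\<kappa> \<star>\<^sub>1 c) (map ((\<star>\<^sub>1) \<kappa>) L) = \<kappa> \<star>\<^sub>1 fold2 c L"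
proof (induction L arbitrary: c)
  case Nil
  then show ?case by (auto simp: ps)
next
  case (Cons A L)
  then have "src (tgt A) = tgt \<kappa>" by (simp add: ps)
  with Cons show ?case using fold2_bd[of "tgt A" L d] by (simp add: ps)
qed

lemma chain_right:
  "chain c L d \<Longrightarrow> \<kappa> \<in> cells C 2 \<Longrightarrow> tgt c = src \<kappa> \<Longrightarrow>
    chain (c \<star>\<^sub>1 \<kappa>) (map (\<lambda>A. A \<star>\<^sub>1 \<kappa>) L) (d \<star>\<^sub>1 \<kappa>) \<and> fold2 (c \<star>\<^sub>1 \<kappa>) (map (\<lambda>A. A \<star>\<^sub>1 \<kappa>) L) = fold2 c L \<star>\<^sub>1 \<kappa>"
proof (induction L arbitrary: c)
  case Nil
  then show ?case by (auto simp: ps)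
next
  case (Cons A L)
  then have "tgt (tgt A) = src \<kappa>" by (simp add: ps)
  with Cons show ?case using fold2_bd[of "tgt A" L d] by (simp add: ps)
qed

end

section \<open>Elementary swaps\<close>

context gray_presentation
begin

text \<open>The elementary swap stripped of the parts of the interleaving before and after
  it.\<close>

fun swap :: "('a, 'b, 'c, 'd) cell3 \<times> 'c \<times> ('a, 'b, 'c, 'd) cell3 \<Rightarrow>
    ('a, 'b, 'c, 'd) cell3 \<times> 'c \<times> ('a, 'b, 'c, 'd) cell3 \<Rightarrow> ('a, 'b, 'c, 'd) cell3" where
  "swap (f, \<alpha>, g) (f', \<beta>, g') = f \<star>\<^sub>0 gen3 (X \<alpha> (g \<star>\<^sub>0 f') \<beta>) \<star>\<^sub>0 g'"

lemma interchange_bd: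
  assumes "\<alpha> \<in> P2 P" "\<beta> \<in> P2 P" "g \<in> cells F 1" "tgt (src (gen2 \<alpha>)) = src g" "tgt g = src (src (gen2 \<beta>))"
  shows "X \<alpha> g \<beta> \<in> P3 P"
    "src (gen3 (X \<alpha> g \<beta>)) = (gen2 \<alpha> \<star>\<^sub>0 g \<star>\<^sub>0 src (gen2 \<beta>)) \<star>\<^sub>1 (tgt (gen2 \<alpha>) \<star>\<^sub>0 g \<star>\<^sub>0 gen2 \<beta>)"
    "tgt (gen3 (X \<alpha> g \<beta>)) = (src (gen2 \<alpha>) \<star>\<^sub>0 g \<star>\<^sub>0 gen2 \<beta>) \<star>\<^sub>1 (gen2 \<alpha> \<star>\<^sub>0 g \<star>\<^sub>0 tgt (gen2 \<beta>))"
  using interchange_gen[of \<alpha> \<beta> g, OF assms(1-3) _ _ refl refl refl refl] assms gen2_cells F_join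
  by simp_all

lemma swap_bd:
  assumes "is_whisker w" "is_whisker v" "tgt (src (whisker w)) = src (src (whisker v))"
  shows "swap w v \<in> cells F 3 \<and>
    src (swap w v) = (whisker w \<star>\<^sub>0 src (whisker v)) \<star>\<^sub>1 (tgt (whisker w) \<star>\<^sub>0 whisker v) \<and>
    tgt (swap w v) = (src (whisker w) \<star>\<^sub>0 whisker v) \<star>\<^sub>1 (whisker w \<star>\<^sub>0 tgt (whisker v))"
proof (cases w; cases v)
  fix f \<alpha> g f' \<beta> g' assume wv: "w = (f, \<alpha>, g)" "v = (f', \<beta>, g')"
  note w = is_whiskerD[OF assms(1) wv(1)]
  note v = is_whiskerD[OF assms(2) wv(2)]
  have t: "tgt g = src f'" using assms(3) w v by (simp add: wv Fps)
  have i: "X \<alpha> (g \<star>\<^sub>0 f') \<beta> \<in> P3 P"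
    "src (gen3 (X \<alpha> (g \<star>\<^sub>0 f') \<beta>)) = (gen2 \<alpha> \<star>\<^sub>0 (g \<star>\<^sub>0 f') \<star>\<^sub>0 src (gen2 \<beta>)) \<star>\<^sub>1 (tgt (gen2 \<alpha>) \<star>\<^sub>0 (g \<star>\<^sub>0 f') \<star>\<^sub>0 gen2 \<beta>)"
    "tgt (gen3 (X \<alpha> (g \<star>\<^sub>0 f') \<beta>)) = (src (gen2 \<alpha>) \<star>\<^sub>0 (g \<star>\<^sub>0 f') \<star>\<^sub>0 gen2 \<beta>) \<star>\<^sub>1 (gen2 \<alpha> \<star>\<^sub>0 (g \<star>\<^sub>0 f') \<star>\<^sub>0 tgt (gen2 \<beta>))"
    using interchange_bd[OF w(1) v(1), of "g \<star>\<^sub>0 f'"] w v t by (simp_all add: Fps)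
  show ?thesis using w v t gen3_cells[OF i(1)] i(2,3) by (simp add: wv Fps)
qed

definition wh where "wh \<phi> i = whisker (decomp \<phi> ! i)"
definition pre where "pre \<phi> i = paste (src \<phi>) (take i (decomp \<phi>))"
definition post where "post \<phi> i = paste (tgt (wh \<phi> i)) (drop (Suc i) (decomp \<phi>))"

lemma elem_swap_alt:
  "elem_swap \<phi> \<psi> i j = ((pre \<phi> i \<star>\<^sub>0 src \<psi>) \<star>\<^sub>1 (src (wh \<phi> i) \<star>\<^sub>0 pre \<psi> j)) \<star>\<^sub>1
    swap (decomp \<phi> ! i) (decomp \<psi> ! j) \<star>\<^sub>1
    ((tgt (wh \<phi> i) \<star>\<^sub>0 post \<psi> j) \<star>\<^sub>1 (post \<phi> i \<star>\<^sub>0 tgt \<psi>))"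
  by (cases "decomp \<phi> ! i"; cases "decomp \<psi> ! j")
    (simp add: elem_swap_def Let_def wh_def pre_def post_def)

lemma whisker_path_split:
  "whisker_path f ws \<Longrightarrow> i < length ws \<Longrightarrow>
    is_whisker (ws ! i) \<and> whisker_path f (take i ws) \<and> tgt (paste f (take i ws)) = src (whisker (ws ! i)) \<and>
    whisker_path (tgt (whisker (ws ! i))) (drop (Suc i) ws) \<and>
    tgt (paste (tgt (whisker (ws ! i))) (drop (Suc i) ws)) = tgt (paste f ws)"
proof (induction ws arbitrary: f i)
  case (Cons w ws)
  have w: "is_whisker w" "whisker w \<in> cells F 2" "src (whisker w) = f" "whisker_path (tgt (whisker w)) ws"
    using Cons(2) whisker_cells by simp_all
  show ?case
  proof (cases i)
    case 0
    then show ?thesis using w paste_cells[OF w(4)] by (auto simp: Fps simp del: is_whisker.simps)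
  next
    case (Suc k)
    note IH = Cons(1)[OF w(4), of k]
    have k: "k < length ws" using Suc Cons(3) by simp
    have "whisker_path (tgt (whisker w)) (take k ws)" using IH k by simp
    then show ?thesis using w paste_cells[OF w(4)] paste_cells[of "tgt (whisker w)" "take k ws"] IH k
      by (simp add: Suc Fps)
  qed
qed simp

lemma split_bd:
  assumes \<phi>: "\<phi> \<in> cells F 2" "i < length (decomp \<phi>)"
  shows "is_whisker (decomp \<phi> ! i)" "wh \<phi> i \<in> cells F 2" "pre \<phi> i \<in> cells F 2" "post \<phi> i \<in> cells F 2"
    "src (pre \<phi> i) = src \<phi>" "tgt (pre \<phi> i) = src (wh \<phi> i)" "src (post \<phi> i) = tgt (wh \<phi> i)"
    "tgt (post \<phi> i) = tgt \<phi>" "bd F e (src (wh \<phi> i)) = bd F e (src \<phi>)"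
proof -
  note d = decomp_cell_whiskers(2,3)[OF \<phi>(1)]
  note s = whisker_path_split[OF d(1) \<phi>(2)]
  show w: "is_whisker (decomp \<phi> ! i)" using s by simp
  show 1: "wh \<phi> i \<in> cells F 2" unfolding wh_def by (rule whisker_cells[OF w])
  show p: "pre \<phi> i \<in> cells F 2" "post \<phi> i \<in> cells F 2"
    "src (pre \<phi> i) = src \<phi>" "src (post \<phi> i) = tgt (wh \<phi> i)"
    using s paste_cells unfolding pre_def post_def wh_def by blast+
  show t: "tgt (pre \<phi> i) = src (wh \<phi> i)" "tgt (post \<phi> i) = tgt \<phi>"
    using s d unfolding pre_def post_def wh_def by simp_all
  show "bd F e (src (wh \<phi> i)) = bd F e (src \<phi>)"
    using F_par(1)[OF p(1) t(1), of e] p(3) by simp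
qed

lemma split_cons:
  assumes w: "is_whisker w" and \<phi>: "\<phi> \<in> cells F 2" "tgt (whisker w) = src \<phi>"
  shows "wh (whisker w \<star>\<^sub>1 \<phi>) 0 = whisker w" "pre (whisker w \<star>\<^sub>1 \<phi>) 0 = idc F (src (whisker w))"
    "post (whisker w \<star>\<^sub>1 \<phi>) 0 = \<phi>"
    "wh (whisker w \<star>\<^sub>1 \<phi>) (Suc i) = wh \<phi> i"
    "pre (whisker w \<star>\<^sub>1 \<phi>) (Suc i) = whisker w \<star>\<^sub>1 pre \<phi> i"
    "post (whisker w \<star>\<^sub>1 \<phi>) (Suc i) = post \<phi> i"
  using decomp_cell_whiskers(3)[OF \<phi>(1)] whisker_cells[OF w] \<phi>
  by (simp_all add: wh_def pre_def post_def decomp_cmp[OF w \<phi>] Fps)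

lemma split_whisker:
  assumes w: "is_whisker w"
  shows "wh (whisker w) 0 = whisker w" "pre (whisker w) 0 = idc F (src (whisker w))"
    "post (whisker w) 0 = idc F (tgt (whisker w))"
  by (simp_all add: wh_def pre_def post_def decomp_whisker[OF w])

text \<open>When the front whisker \<open>w\<close> moves, all of \<open>\<phi>\<close> has already
  passed \<open>\<psi>\<close> and lies behind it as
  \<open>\<phi> \<star>\<^sub>0 tgt \<psi>\<close>. When a whisker of \<open>\<phi>\<close> moves,
  \<open>w\<close> still waits ahead of the whole of \<open>\<psi>\<close>, as
  \<open>whisker w \<star>\<^sub>0 src \<psi>\<close>.\<close>

lemma elem_swap_cons_left:
  assumes w: "is_whisker w" and \<phi>: "\<phi> \<in> cells F 2" "tgt (whisker w) = src \<phi>"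
    and \<psi>: "\<psi> \<in> cells F 2" "tgt (src \<phi>) = src (src \<psi>)"
    and j: "j < length (decomp \<psi>)"
  shows "elem_swap (whisker w \<star>\<^sub>1 \<phi>) \<psi> 0 j = elem_swap (whisker w) \<psi> 0 j \<star>\<^sub>1 (\<phi> \<star>\<^sub>0 tgt \<psi>)"
    "i < length (decomp \<phi>) \<Longrightarrow>
      elem_swap (whisker w \<star>\<^sub>1 \<phi>) \<psi> (Suc i) j = (whisker w \<star>\<^sub>0 src \<psi>) \<star>\<^sub>1 elem_swap \<phi> \<psi> i j"
proof -
  have W: "whisker w \<in> cells F 2" by (rule whisker_cells[OF w])
  note p = F_par(1)[OF W \<phi>(2)]
  note sj = split_bd[OF \<psi>(1) j]
  have "swap w (decomp \<psi> ! j) \<in> cells F 3"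
    "src (swap w (decomp \<psi> ! j)) = (whisker w \<star>\<^sub>0 src (wh \<psi> j)) \<star>\<^sub>1 (tgt (whisker w) \<star>\<^sub>0 wh \<psi> j)"
    "tgt (swap w (decomp \<psi> ! j)) = (src (whisker w) \<star>\<^sub>0 wh \<psi> j) \<star>\<^sub>1 (whisker w \<star>\<^sub>0 tgt (wh \<psi> j))"
    using swap_bd[OF w sj(1)] sj p \<psi>(2) unfolding wh_def by simp_all
  then show "elem_swap (whisker w \<star>\<^sub>1 \<phi>) \<psi> 0 j = elem_swap (whisker w) \<psi> 0 j \<star>\<^sub>1 (\<phi> \<star>\<^sub>0 tgt \<psi>)"
    using W \<phi> p \<psi> sj
    by (simp add: elem_swap_alt split_cons[OF w \<phi>] split_whisker[OF w] decomp_cmp[OF w \<phi>] decomp_whisker[OF w] Fps)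
  assume i: "i < length (decomp \<phi>)"
  note si = split_bd[OF \<phi>(1) i]
  have "swap (decomp \<phi> ! i) (decomp \<psi> ! j) \<in> cells F 3"
    "src (swap (decomp \<phi> ! i) (decomp \<psi> ! j)) = (wh \<phi> i \<star>\<^sub>0 src (wh \<psi> j)) \<star>\<^sub>1 (tgt (wh \<phi> i) \<star>\<^sub>0 wh \<psi> j)"
    "tgt (swap (decomp \<phi> ! i) (decomp \<psi> ! j)) = (src (wh \<phi> i) \<star>\<^sub>0 wh \<psi> j) \<star>\<^sub>1 (wh \<phi> i \<star>\<^sub>0 tgt (wh \<psi> j))"
    using swap_bd[OF si(1) sj(1)] si sj p \<psi>(2) unfolding wh_def by simp_all
  then show "elem_swap (whisker w \<star>\<^sub>1 \<phi>) \<psi> (Suc i) j = (whisker w \<star>\<^sub>0 src \<psi>) \<star>\<^sub>1 elem_swap \<phi> \<psi> i j"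
    using W \<phi> p \<psi> sj si
    by (simp add: elem_swap_alt split_cons[OF w \<phi>] decomp_cmp[OF w \<phi>] Fps)
qed

text \<open>During the first swap the whole of \<open>\<psi>\<close> is still behind; once
  \<open>w\<close> has passed \<open>v\<close>, that whisker stays ahead of all later swaps.\<close>

lemma elem_swap_cons_right:
  assumes w: "is_whisker w" and v: "is_whisker v" and \<psi>: "\<psi> \<in> cells F 2" "tgt (whisker v) = src \<psi>"
    and t: "tgt (src (whisker w)) = src (src (whisker v))"
  shows "elem_swap (whisker w) (whisker v \<star>\<^sub>1 \<psi>) 0 0 = swap w v \<star>\<^sub>1 (tgt (whisker w) \<star>\<^sub>0 \<psi>)"
    "j < length (decomp \<psi>) \<Longrightarrow> elem_swap (whisker w) (whisker v \<star>\<^sub>1 \<psi>) 0 (Suc j) =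
      (src (whisker w) \<star>\<^sub>0 whisker v) \<star>\<^sub>1 elem_swap (whisker w) \<psi> 0 j"
proof -
  have W: "whisker w \<in> cells F 2" and V: "whisker v \<in> cells F 2" by (rule whisker_cells[OF w] whisker_cells[OF v])+
  note p = F_par(1)[OF V \<psi>(2)]
  show "elem_swap (whisker w) (whisker v \<star>\<^sub>1 \<psi>) 0 0 = swap w v \<star>\<^sub>1 (tgt (whisker w) \<star>\<^sub>0 \<psi>)"
    using W V \<psi> p t swap_bd[OF w v t]
    by (simp add: elem_swap_alt split_cons[OF v \<psi>] split_whisker[OF w] decomp_cmp[OF v \<psi>] decomp_whisker[OF w] Fps)
  assume j: "j < length (decomp \<psi>)"
  note sj = split_bd[OF \<psi>(1) j]
  have "swap w (decomp \<psi> ! j) \<in> cells F 3"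
    "src (swap w (decomp \<psi> ! j)) = (whisker w \<star>\<^sub>0 src (wh \<psi> j)) \<star>\<^sub>1 (tgt (whisker w) \<star>\<^sub>0 wh \<psi> j)"
    "tgt (swap w (decomp \<psi> ! j)) = (src (whisker w) \<star>\<^sub>0 wh \<psi> j) \<star>\<^sub>1 (whisker w \<star>\<^sub>0 tgt (wh \<psi> j))"
    using swap_bd[OF w sj(1)] sj p t unfolding wh_def by simp_all
  then show "elem_swap (whisker w) (whisker v \<star>\<^sub>1 \<psi>) 0 (Suc j) =
      (src (whisker w) \<star>\<^sub>0 whisker v) \<star>\<^sub>1 elem_swap (whisker w) \<psi> 0 j"
    using W V \<psi> p t sj
    by (simp add: elem_swap_alt split_cons[OF v \<psi>] split_whisker[OF w] decomp_cmp[OF v \<psi>] decomp_whisker[OF w] Fps)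
qed

end

section \<open>Recursion formulas for the interchangers\<close>

context gray_presentation
begin

lemma F_cell2_induct [consumes 1, case_names idc cmp]:
  assumes "\<phi> \<in> cells F 2"
    and "\<And>f. f \<in> cells F 1 \<Longrightarrow> Pr (idc F f)"
    and "\<And>w \<phi>. is_whisker w \<Longrightarrow> whisker w \<in> cells F 2 \<Longrightarrow> \<phi> \<in> cells F 2 \<Longrightarrow> tgt (whisker w) = src \<phi> \<Longrightarrow>
      (\<And>e. bd F e (src \<phi>) = bd F e (src (whisker w))) \<Longrightarrow> Pr \<phi> \<Longrightarrow> Pr (whisker w \<star>\<^sub>1 \<phi>)"
  shows "Pr \<phi>"
  using F_span2[OF assms(1)]
proof (induction rule: span2.induct)
  case (span2_idc f)
  then show ?case by (rule assms(2))
next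
  case (span2_cmp w \<phi>)
  from span2_cmp(1) obtain w' where w: "w = whisker w'" "is_whisker w'" by (rule F_whiskersE)
  show ?case unfolding w(1)
    by (rule assms(3)) (use span2_cmp w whisker_cells[OF w(2)] F_par(1)[OF whisker_cells[OF w(2)]] in auto)
qed

text \<open>Separating the list of swaps from its composite lets the recursion be proved by
  manipulation of lists.\<close>

definition swaps where "swaps \<phi> \<psi> =
  concat (map (\<lambda>i. map (elem_swap \<phi> \<psi> i) [0..<length (decomp \<psi>)]) (rev [0..<length (decomp \<phi>)]))"

lemma XX_swaps: "XX \<phi> \<psi> = foldl (\<star>\<^sub>2) (idc F ((\<phi> \<star>\<^sub>0 src \<psi>) \<star>\<^sub>1 (tgt \<phi> \<star>\<^sub>0 \<psi>))) (swaps \<phi> \<psi>)"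
  unfolding XX_def swaps_def by simp

lemma swaps_idc: "f \<in> cells F 1 \<Longrightarrow> swaps (idc F f) \<psi> = []" "f \<in> cells F 1 \<Longrightarrow> swaps \<phi> (idc F f) = []"
  by (simp_all add: swaps_def decomp_idc)

lemma swaps_cons_left:
  assumes w: "is_whisker w" and \<phi>: "\<phi> \<in> cells F 2" "tgt (whisker w) = src \<phi>"
    and \<psi>: "\<psi> \<in> cells F 2" "tgt (src \<phi>) = src (src \<psi>)"
  shows "swaps (whisker w \<star>\<^sub>1 \<phi>) \<psi> = map ((\<star>\<^sub>1) (whisker w \<star>\<^sub>0 src \<psi>)) (swaps \<phi> \<psi>) @
    map (\<lambda>A. A \<star>\<^sub>1 (\<phi> \<star>\<^sub>0 tgt \<psi>)) (swaps (whisker w) \<psi>)"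
proof -
  \<comment> \<open>The outer index runs downwards, so prepending \<open>w\<close> adds its swaps at
    the end of the list.\<close>
  have r: "rev [0..<Suc m] = map Suc (rev [0..<m]) @ [0]" for m
    by (simp add: rev_map upt_conv_Cons map_Suc_upt[symmetric] del: upt_Suc)
  note e = elem_swap_cons_left[OF w \<phi> \<psi>]
  have "map (elem_swap (whisker w \<star>\<^sub>1 \<phi>) \<psi> (Suc i)) [0..<length (decomp \<psi>)] =
    map ((\<star>\<^sub>1) (whisker w \<star>\<^sub>0 src \<psi>)) (map (elem_swap \<phi> \<psi> i) [0..<length (decomp \<psi>)])"
    if "i \<in> set (rev [0..<length (decomp \<phi>)])" for i
    using that e(2) by simp
  then have h1: "map ((\<lambda>i. map (elem_swap (whisker w \<star>\<^sub>1 \<phi>) \<psi> i) [0..<length (decomp \<psi>)]) \<circ> Suc) (rev [0..<length (decomp \<phi>)]) =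
    map (map ((\<star>\<^sub>1) (whisker w \<star>\<^sub>0 src \<psi>)) \<circ> (\<lambda>i. map (elem_swap \<phi> \<psi> i) [0..<length (decomp \<psi>)])) (rev [0..<length (decomp \<phi>)])"
    by (intro map_cong refl) (simp del: map_map)
  have h0: "map (elem_swap (whisker w \<star>\<^sub>1 \<phi>) \<psi> 0) [0..<length (decomp \<psi>)] =
    map (\<lambda>A. A \<star>\<^sub>1 (\<phi> \<star>\<^sub>0 tgt \<psi>)) (map (elem_swap (whisker w) \<psi> 0) [0..<length (decomp \<psi>)])"
    using e(1) by simp
  show ?thesis
    unfolding swaps_def decomp_cmp[OF w \<phi>] decomp_whisker[OF w] length_Cons list.size(3) r map_append
      concat_append map_concat map_map h1
    by (simp add: h0 del: map_map)
qed

lemma swaps_cons_right: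
  assumes w: "is_whisker w" and v: "is_whisker v" and \<psi>: "\<psi> \<in> cells F 2" "tgt (whisker v) = src \<psi>"
    and t: "tgt (src (whisker w)) = src (src (whisker v))"
  shows "swaps (whisker w) (whisker v \<star>\<^sub>1 \<psi>) = (swap w v \<star>\<^sub>1 (tgt (whisker w) \<star>\<^sub>0 \<psi>)) #
    map ((\<star>\<^sub>1) (src (whisker w) \<star>\<^sub>0 whisker v)) (swaps (whisker w) \<psi>)"
proof -
  have r: "[0..<Suc m] = 0 # map Suc [0..<m]" for m
    by (simp add: upt_conv_Cons map_Suc_upt[symmetric] del: upt_Suc)
  note e = elem_swap_cons_right[OF w v \<psi> t]
  show ?thesis
    by (simp add: swaps_def decomp_cmp[OF v \<psi>] decomp_whisker[OF w] r e upt_rec[of 0 1] del: upt_Suc)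
qed

lemma swaps_whisker:
  assumes w: "is_whisker w" and v: "is_whisker v"
    and t: "tgt (src (whisker w)) = src (src (whisker v))"
  shows "swaps (whisker w) (whisker v) = [swap w v]"
proof -
  have W: "whisker w \<in> cells F 2" "whisker v \<in> cells F 2" using w v whisker_cells by blast+
  then have i: "idc F (tgt (whisker v)) \<in> cells F 2" "tgt (whisker v) = src (idc F (tgt (whisker v)))"
    "tgt (whisker v) \<in> cells F 1"
    by (simp_all add: Fps)
  show ?thesis
    using swaps_cons_right[OF w v i(1,2) t] W t swap_bd[OF w v t] swaps_idc(2)[OF i(3)]
    by (simp add: Fps)
qed

abbreviation chainF where "chainF \<equiv> precat3.chain F"
abbreviation foldF where "foldF \<equiv> precat3.fold2 F"
lemmas chainF_simps = precat3.chain.simps[OF F_precat3] precat3.fold2.simps[OF F_precat3]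

text \<open>This is the row of swaps of a single moving whisker; in the general case one such row is
  appended for each whisker of the first argument.\<close>

lemma swaps_chain_whisker:
  assumes "\<psi> \<in> cells F 2" and w: "is_whisker w"
  shows "tgt (src (whisker w)) = src (src \<psi>) \<Longrightarrow>
    chainF ((whisker w \<star>\<^sub>0 src \<psi>) \<star>\<^sub>1 (tgt (whisker w) \<star>\<^sub>0 \<psi>)) (swaps (whisker w) \<psi>)
      ((src (whisker w) \<star>\<^sub>0 \<psi>) \<star>\<^sub>1 (whisker w \<star>\<^sub>0 tgt \<psi>))"
  using assms(1)
proof (induction rule: F_cell2_induct)
  case (idc g)
  then show ?case using whisker_cells[OF w] by (simp add: Fps swaps_idc chainF_simps)
next
  case (cmp v \<psi>)
  have W: "whisker w \<in> cells F 2" by (rule whisker_cells[OF w])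
  have t: "tgt (src (whisker w)) = src (src (whisker v))" using cmp by (simp add: Fps)
  note IH = cmp(6)
  have l: "src (whisker w) \<star>\<^sub>0 whisker v \<in> cells F 2"
    "tgt (src (whisker w) \<star>\<^sub>0 whisker v) = src ((whisker w \<star>\<^sub>0 src \<psi>) \<star>\<^sub>1 (tgt (whisker w) \<star>\<^sub>0 \<psi>))"
    using cmp(1-5) W t by (simp_all add: Fps)
  have "chainF ((whisker w \<star>\<^sub>0 src \<psi>) \<star>\<^sub>1 (tgt (whisker w) \<star>\<^sub>0 \<psi>)) (swaps (whisker w) \<psi>)
      ((src (whisker w) \<star>\<^sub>0 \<psi>) \<star>\<^sub>1 (whisker w \<star>\<^sub>0 tgt \<psi>))"
    using IH t cmp(5) by simp
  from precat3.chain_left[OF F_precat3 this l]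
  show ?case using cmp(1-5) W t swap_bd[OF w cmp(1) t]
    by (simp add: swaps_cons_right[OF w cmp(1,3,4) t] chainF_simps Fps)
qed

lemma swaps_chain:
  assumes "\<phi> \<in> cells F 2" and \<psi>: "\<psi> \<in> cells F 2"
  shows "tgt (src \<phi>) = src (src \<psi>) \<Longrightarrow>
    chainF ((\<phi> \<star>\<^sub>0 src \<psi>) \<star>\<^sub>1 (tgt \<phi> \<star>\<^sub>0 \<psi>)) (swaps \<phi> \<psi>) ((src \<phi> \<star>\<^sub>0 \<psi>) \<star>\<^sub>1 (\<phi> \<star>\<^sub>0 tgt \<psi>))"
  using assms(1)
proof (induction rule: F_cell2_induct)
  case (idc g)
  then show ?case using \<psi> by (simp add: Fps swaps_idc chainF_simps)
next
  case (cmp w \<phi>)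
  have t: "tgt (src (whisker w)) = src (src \<psi>)" using cmp by (simp add: Fps)
  have l: "whisker w \<star>\<^sub>0 src \<psi> \<in> cells F 2"
    "tgt (whisker w \<star>\<^sub>0 src \<psi>) = src ((\<phi> \<star>\<^sub>0 src \<psi>) \<star>\<^sub>1 (tgt \<phi> \<star>\<^sub>0 \<psi>))"
    "\<phi> \<star>\<^sub>0 tgt \<psi> \<in> cells F 2"
    "tgt ((whisker w \<star>\<^sub>0 src \<psi>) \<star>\<^sub>1 (tgt (whisker w) \<star>\<^sub>0 \<psi>)) = src (\<phi> \<star>\<^sub>0 tgt \<psi>)"
    using cmp(1-5) \<psi> t by (simp_all add: Fps)
  have t': "tgt (src \<phi>) = src (src \<psi>)" using t cmp(5) by simp
  have 1: "chainF ((\<phi> \<star>\<^sub>0 src \<psi>) \<star>\<^sub>1 (tgt \<phi> \<star>\<^sub>0 \<psi>)) (swaps \<phi> \<psi>) ((src \<phi> \<star>\<^sub>0 \<psi>) \<star>\<^sub>1 (\<phi> \<star>\<^sub>0 tgt \<psi>))"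
    by (rule cmp(6)[OF t'])
  from precat3.chain_left[OF F_precat3 1 l(1,2)]
    precat3.chain_right[OF F_precat3 swaps_chain_whisker[OF \<psi> cmp(1) t] l(3,4)]
  \<comment> \<open>The intermediate 2-cell is the one reached when \<open>\<phi>\<close> has passed
    \<open>\<psi>\<close> and \<open>w\<close> has not yet moved.\<close>
  show ?case using cmp(1-5) \<psi> t
      precat3.chain_append[OF F_precat3, of _ "map ((\<star>\<^sub>1) (whisker w \<star>\<^sub>0 src \<psi>)) (swaps \<phi> \<psi>)"
        "(whisker w \<star>\<^sub>0 src \<psi>) \<star>\<^sub>1 ((src \<phi> \<star>\<^sub>0 \<psi>) \<star>\<^sub>1 (\<phi> \<star>\<^sub>0 tgt \<psi>))"
        "map (\<lambda>A. A \<star>\<^sub>1 (\<phi> \<star>\<^sub>0 tgt \<psi>)) (swaps (whisker w) \<psi>)"]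
    by (simp add: swaps_cons_left[OF cmp(1,3,4) \<psi> t'] Fps)
qed

lemma XX_fold:
  assumes "\<phi> \<in> cells F 2" "\<psi> \<in> cells F 2" "tgt (src \<phi>) = src (src \<psi>)"
  shows "XX \<phi> \<psi> = foldF ((\<phi> \<star>\<^sub>0 src \<psi>) \<star>\<^sub>1 (tgt \<phi> \<star>\<^sub>0 \<psi>)) (swaps \<phi> \<psi>)"
  unfolding XX_swaps by (rule precat3.foldl_idc_fold2[OF F_precat3 swaps_chain[OF assms]])

lemma XX_bd:
  assumes "\<phi> \<in> cells F 2" "\<psi> \<in> cells F 2" "tgt (src \<phi>) = src (src \<psi>)"
  shows "XX \<phi> \<psi> \<in> cells F 3" "src (XX \<phi> \<psi>) = (\<phi> \<star>\<^sub>0 src \<psi>) \<star>\<^sub>1 (tgt \<phi> \<star>\<^sub>0 \<psi>)"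
    "tgt (XX \<phi> \<psi>) = (src \<phi> \<star>\<^sub>0 \<psi>) \<star>\<^sub>1 (\<phi> \<star>\<^sub>0 tgt \<psi>)"
  using precat3.fold2_bd[OF F_precat3 swaps_chain[OF assms]] by (simp_all add: XX_fold[OF assms])

lemma XX_idl: "f \<in> cells F 1 \<Longrightarrow> \<psi> \<in> cells F 2 \<Longrightarrow> tgt f = src (src \<psi>) \<Longrightarrow> XX (idc F f) \<psi> = idc F (f \<star>\<^sub>0 \<psi>)"
  by (simp add: XX_fold swaps_idc chainF_simps Fps)

lemma XX_idr: "\<phi> \<in> cells F 2 \<Longrightarrow> g \<in> cells F 1 \<Longrightarrow> tgt (src \<phi>) = src g \<Longrightarrow> XX \<phi> (idc F g) = idc F (\<phi> \<star>\<^sub>0 g)"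
  by (simp add: XX_fold swaps_idc chainF_simps Fps)

lemma XX_whisker:
  assumes w: "is_whisker w" and v: "is_whisker v"
    and t: "tgt (src (whisker w)) = src (src (whisker v))"
  shows "XX (whisker w) (whisker v) = swap w v"
  using swap_bd[OF w v t] XX_fold[OF whisker_cells[OF w] whisker_cells[OF v] t]
  by (simp add: swaps_whisker[OF assms] chainF_simps Fps)

text \<open>The list of swaps is a block for \<open>\<phi>\<close> followed by the row of
  \<open>w\<close>, each suitably whiskered; the formula is therefore strict, already in the free
  3-precategory.\<close>

lemma XX_consl:
  assumes w: "is_whisker w" and \<phi>: "\<phi> \<in> cells F 2" "tgt (whisker w) = src \<phi>"
    and \<psi>: "\<psi> \<in> cells F 2" and t: "tgt (src (whisker w)) = src (src \<psi>)"
  shows "XX (whisker w \<star>\<^sub>1 \<phi>) \<psi> =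
    ((whisker w \<star>\<^sub>0 src \<psi>) \<star>\<^sub>1 XX \<phi> \<psi>) \<star>\<^sub>2 (XX (whisker w) \<psi> \<star>\<^sub>1 (\<phi> \<star>\<^sub>0 tgt \<psi>))"
proof -
  have W: "whisker w \<in> cells F 2" by (rule whisker_cells[OF w])
  note p = F_par(1)[OF W \<phi>(2)]
  have t': "tgt (src \<phi>) = src (src \<psi>)" using t p by simp
  have l: "whisker w \<star>\<^sub>0 src \<psi> \<in> cells F 2"
    "tgt (whisker w \<star>\<^sub>0 src \<psi>) = src ((\<phi> \<star>\<^sub>0 src \<psi>) \<star>\<^sub>1 (tgt \<phi> \<star>\<^sub>0 \<psi>))"
    "\<phi> \<star>\<^sub>0 tgt \<psi> \<in> cells F 2"
    "tgt ((whisker w \<star>\<^sub>0 src \<psi>) \<star>\<^sub>1 (tgt (whisker w) \<star>\<^sub>0 \<psi>)) = src (\<phi> \<star>\<^sub>0 tgt \<psi>)"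
    and m: "whisker w \<star>\<^sub>1 \<phi> \<in> cells F 2" "tgt (src (whisker w \<star>\<^sub>1 \<phi>)) = src (src \<psi>)"
    using W \<phi> p \<psi> t by (simp_all add: Fps)
  note a = precat3.chain_left[OF F_precat3 swaps_chain[OF \<phi>(1) \<psi> t'] l(1,2)]
    precat3.chain_right[OF F_precat3 swaps_chain_whisker[OF \<psi> w t] l(3,4)]
  \<comment> \<open>The two lists meet in a 2-cell that each of them brackets in its own way; the
    second equation does the same for the starting 2-cell.\<close>
  have e: "(whisker w \<star>\<^sub>0 src \<psi>) \<star>\<^sub>1 ((src \<phi> \<star>\<^sub>0 \<psi>) \<star>\<^sub>1 (\<phi> \<star>\<^sub>0 tgt \<psi>)) =
      ((whisker w \<star>\<^sub>0 src \<psi>) \<star>\<^sub>1 (tgt (whisker w) \<star>\<^sub>0 \<psi>)) \<star>\<^sub>1 (\<phi> \<star>\<^sub>0 tgt \<psi>)"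
    "((whisker w \<star>\<^sub>1 \<phi>) \<star>\<^sub>0 src \<psi>) \<star>\<^sub>1 (tgt (whisker w \<star>\<^sub>1 \<phi>) \<star>\<^sub>0 \<psi>) =
      (whisker w \<star>\<^sub>0 src \<psi>) \<star>\<^sub>1 ((\<phi> \<star>\<^sub>0 src \<psi>) \<star>\<^sub>1 (tgt \<phi> \<star>\<^sub>0 \<psi>))"
    using W \<phi> p \<psi> t by (simp_all add: Fps)
  show ?thesis
    unfolding XX_fold[OF m(1) \<psi> m(2)] XX_fold[OF \<phi>(1) \<psi> t'] XX_fold[OF W \<psi> t] swaps_cons_left[OF w \<phi> \<psi> t'] e(2)
    using precat3.chain_append[OF F_precat3 conjunct1[OF a(1), unfolded e(1)] conjunct1[OF a(2)]] a e(1)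
    by simp
qed

lemma XX_consr:
  assumes w: "is_whisker w" and v: "is_whisker v" and \<psi>: "\<psi> \<in> cells F 2" "tgt (whisker v) = src \<psi>"
    and t: "tgt (src (whisker w)) = src (src (whisker v))"
  shows "XX (whisker w) (whisker v \<star>\<^sub>1 \<psi>) =
    (XX (whisker w) (whisker v) \<star>\<^sub>1 (tgt (whisker w) \<star>\<^sub>0 \<psi>)) \<star>\<^sub>2
    ((src (whisker w) \<star>\<^sub>0 whisker v) \<star>\<^sub>1 XX (whisker w) \<psi>)"
proof -
  have W: "whisker w \<in> cells F 2" "whisker v \<in> cells F 2" using w v whisker_cells by blast+
  note p = F_par(1)[OF W(2) \<psi>(2)]
  have t': "tgt (src (whisker w)) = src (src \<psi>)" using t p by simp
  have l: "src (whisker w) \<star>\<^sub>0 whisker v \<in> cells F 2"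
    "tgt (src (whisker w) \<star>\<^sub>0 whisker v) = src ((whisker w \<star>\<^sub>0 src \<psi>) \<star>\<^sub>1 (tgt (whisker w) \<star>\<^sub>0 \<psi>))"
    and m: "whisker v \<star>\<^sub>1 \<psi> \<in> cells F 2" "tgt (src (whisker w)) = src (src (whisker v \<star>\<^sub>1 \<psi>))"
    using W \<psi> p t by (simp_all add: Fps)
  note a = precat3.chain_left[OF F_precat3 swaps_chain_whisker[OF \<psi>(1) w t'] l]
  show ?thesis
    unfolding XX_fold[OF W(1) m] XX_fold[OF W(1) \<psi>(1) t'] XX_whisker[OF w v t] swaps_cons_right[OF w v \<psi> t]
    using a W \<psi> p t swap_bd[OF w v t] by (simp add: chainF_simps Fps)
qed

text \<open>The 1-cell \<open>e\<close> changes only the left component of the triple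
  \<open>w\<close>, which \<open>swap\<close> keeps outside the interchange generator.\<close>

lemma XX_wl:
  assumes w: "is_whisker w" and v: "is_whisker v" and t: "tgt (src (whisker w)) = src (src (whisker v))"
    and e: "e \<in> cells F 1" "tgt e = src (src (whisker w))"
  shows "XX (e \<star>\<^sub>0 whisker w) (whisker v) = e \<star>\<^sub>0 XX (whisker w) (whisker v)"
proof (cases w; cases v)
  fix f \<alpha> g f' \<beta> g' assume wv: "w = (f, \<alpha>, g)" "v = (f', \<beta>, g')"
  note w' = is_whiskerD[OF w wv(1)]
  note v' = is_whiskerD[OF v wv(2)]
  have t': "tgt g = src f'" "tgt e = src f" using t e(2) w' v' by (simp_all add: wv Fps)
  have i: "X \<alpha> (g \<star>\<^sub>0 f') \<beta> \<in> P3 P"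
    "src (gen3 (X \<alpha> (g \<star>\<^sub>0 f') \<beta>)) = (gen2 \<alpha> \<star>\<^sub>0 (g \<star>\<^sub>0 f') \<star>\<^sub>0 src (gen2 \<beta>)) \<star>\<^sub>1 (tgt (gen2 \<alpha>) \<star>\<^sub>0 (g \<star>\<^sub>0 f') \<star>\<^sub>0 gen2 \<beta>)"
    using interchange_bd[OF w'(1) v'(1), of "g \<star>\<^sub>0 f'"] w' v' t' by (simp_all add: Fps)
  have ew: "e \<star>\<^sub>0 whisker w = whisker (e \<star>\<^sub>0 f, \<alpha>, g)" "is_whisker (e \<star>\<^sub>0 f, \<alpha>, g)"
    using w' e(1) t' by (simp_all add: wv is_whisker_iff Fps del: is_whisker.simps)
  have "tgt (src (whisker (e \<star>\<^sub>0 f, \<alpha>, g))) = src (src (whisker v))"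
    unfolding ew(1)[symmetric] using whisker_cells[OF w] e t by (simp add: Fps)
  then show ?thesis
    unfolding ew(1) using XX_whisker[OF ew(2) v] XX_whisker[OF w v t] w' v' e t' gen3_cells[OF i(1)] i(2)
    by (simp add: wv Fps)
qed

lemma XX_wr:
  assumes w: "is_whisker w" and v: "is_whisker v" and t: "tgt (src (whisker w)) = src (src (whisker v))"
    and e: "e \<in> cells F 1" "tgt (src (whisker v)) = src e"
  shows "XX (whisker w) (whisker v \<star>\<^sub>0 e) = XX (whisker w) (whisker v) \<star>\<^sub>0 e"
proof (cases w; cases v)
  fix f \<alpha> g f' \<beta> g' assume wv: "w = (f, \<alpha>, g)" "v = (f', \<beta>, g')"
  note w' = is_whiskerD[OF w wv(1)]
  note v' = is_whiskerD[OF v wv(2)]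
  have t': "tgt g = src f'" "tgt g' = src e" using t e(2) w' v' by (simp_all add: wv Fps)
  have i: "X \<alpha> (g \<star>\<^sub>0 f') \<beta> \<in> P3 P"
    "src (gen3 (X \<alpha> (g \<star>\<^sub>0 f') \<beta>)) = (gen2 \<alpha> \<star>\<^sub>0 (g \<star>\<^sub>0 f') \<star>\<^sub>0 src (gen2 \<beta>)) \<star>\<^sub>1 (tgt (gen2 \<alpha>) \<star>\<^sub>0 (g \<star>\<^sub>0 f') \<star>\<^sub>0 gen2 \<beta>)"
    using interchange_bd[OF w'(1) v'(1), of "g \<star>\<^sub>0 f'"] w' v' t' by (simp_all add: Fps)
  have ew: "whisker v \<star>\<^sub>0 e = whisker (f', \<beta>, g' \<star>\<^sub>0 e)" "is_whisker (f', \<beta>, g' \<star>\<^sub>0 e)"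
    using v' e(1) t' by (simp_all add: wv is_whisker_iff Fps del: is_whisker.simps)
  have "tgt (src (whisker w)) = src (src (whisker (f', \<beta>, g' \<star>\<^sub>0 e)))"
    unfolding ew(1)[symmetric] using whisker_cells[OF v] e t by (simp add: Fps)
  then show ?thesis
    unfolding ew(1) using XX_whisker[OF w ew(2)] XX_whisker[OF w v t] w' v' e t' gen3_cells[OF i(1)] i(2)
    by (simp add: wv Fps)
qed

text \<open>Both sides are the same whiskered generator: its middle 1-cell is
  \<open>(g \<star>\<^sub>0 m) \<star>\<^sub>0 f'\<close> on the left and
  \<open>g \<star>\<^sub>0 (m \<star>\<^sub>0 f')\<close> on the right.\<close>

lemma XX_wm:
  assumes w: "is_whisker w" and v: "is_whisker v" and m: "m \<in> cells F 1"
    "tgt (src (whisker w)) = src m" "tgt m = src (src (whisker v))"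
  shows "XX (whisker w \<star>\<^sub>0 m) (whisker v) = XX (whisker w) (m \<star>\<^sub>0 whisker v)"
proof (cases w; cases v)
  fix f \<alpha> g f' \<beta> g' assume wv: "w = (f, \<alpha>, g)" "v = (f', \<beta>, g')"
  note w' = is_whiskerD[OF w wv(1)]
  note v' = is_whiskerD[OF v wv(2)]
  have t': "tgt g = src m" "tgt m = src f'" using m w' v' by (simp_all add: wv Fps)
  have ew: "whisker w \<star>\<^sub>0 m = whisker (f, \<alpha>, g \<star>\<^sub>0 m)" "is_whisker (f, \<alpha>, g \<star>\<^sub>0 m)"
    "m \<star>\<^sub>0 whisker v = whisker (m \<star>\<^sub>0 f', \<beta>, g')" "is_whisker (m \<star>\<^sub>0 f', \<beta>, g')"
    using w' v' m(1) t' by (simp_all add: wv is_whisker_iff Fps del: is_whisker.simps)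
  have "tgt (src (whisker (f, \<alpha>, g \<star>\<^sub>0 m))) = src (src (whisker v))"
    "tgt (src (whisker w)) = src (src (whisker (m \<star>\<^sub>0 f', \<beta>, g')))"
    unfolding ew(1,3)[symmetric] using whisker_cells[OF w] whisker_cells[OF v] m by (simp_all add: Fps)
  then show ?thesis
    unfolding ew(1,3) using XX_whisker[OF ew(2) v] XX_whisker[OF w ew(4)] w' v' m(1) t'
    by (simp add: wv Fps)
qed

end

section \<open>Passing to the presented precategory\<close>

context gray_presentation
begin

abbreviation Q where "Q \<equiv> presented3 P"
abbreviation q where "q \<equiv> qclass 3 F (pcong P)"

lemma F_prec: "precategory 3 F"
  using F_precat3 by (simp add: precat3_def)

lemma F_boundary: "precat_boundary 3 F"
  by unfold_locales (fact precategory.dm_le[OF F_prec] precategory.bd_cells[OF F_prec]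
    precategory.globular[OF F_prec] precategory.cmp_cells[OF F_prec] precategory.bd_cmp_less[OF F_prec]
    precategory.bd_cmp_greater[OF F_prec] precategory.src_cmp_eq[OF F_prec] precategory.tgt_cmp_eq[OF F_prec])+

lemma quotient_F: "quotient_by_congruence 3 F (pcong P)"
  using F_prec precat_boundary.presented_congruence(1)[OF F_boundary generators4]
  by (simp add: quotient_by_congruence_def quotient_by_congruence_axioms_def pcong_def)

lemma Q_precat3: "precat3 Q"
  using quotient_by_congruence.Q_precategory[OF quotient_F] by (simp add: precat3_def presented3_def)

lemmas q_cmp = quotient_by_congruence.cmp_q[OF quotient_F, folded presented3_def]
lemmas Q_cells = quotient_by_congruence.Q_cells[OF quotient_F, folded presented3_def]

lemma q_bd: "x \<in> cells F k \<Longrightarrow> bd Q e (q x) = q (bd F e x)"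
  using quotient_by_congruence.bd_q[OF quotient_F, folded presented3_def] by (simp add: cells_iff)

lemma q_idc: "x \<in> cells F k \<Longrightarrow> k < 3 \<Longrightarrow> idc Q (q x) = q (idc F x)"
  using quotient_by_congruence.idc_q[OF quotient_F, folded presented3_def] by (simp add: cells_iff)

lemma q_inj: "x \<in> cells F k \<Longrightarrow> y \<in> cells F k \<Longrightarrow> k < 3 \<Longrightarrow> q x = q y \<longleftrightarrow> x = y"
  using quotient_by_congruence.q_inj[OF quotient_F] by (simp add: cells_iff)

lemma q_cells: "x \<in> cells F k \<Longrightarrow> q x \<in> cells Q k"
  by (auto simp: Q_cells)

lemma rep_q: "x \<in> cells F k \<Longrightarrow> k < 3 \<Longrightarrow> rep (q x) = x"
  using quotient_by_congruence.rep_q_below[OF quotient_F] by (simp add: cells_iff)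

text \<open>Classes of 2-cells are singletons, so the representatives chosen in
  \<open>presented_XX\<close> are the cells themselves, with their decompositions in the free
  3-precategory.\<close>

lemma q_XX: "\<phi> \<in> cells F 2 \<Longrightarrow> \<psi> \<in> cells F 2 \<Longrightarrow> presented_XX (q \<phi>) (q \<psi>) = q (XX \<phi> \<psi>)"
  by (simp add: presented_XX_def rep_q)

lemma has_gen4_eq: "has_gen4 U V \<Longrightarrow> q U = q V"
proof -
  assume "has_gen4 U V"
  then obtain \<Gamma> where "\<Gamma> \<in> P4 P" "d4 P Src \<Gamma> = U" "d4 P Tgt \<Gamma> = V" by (auto simp: has_gen4_def)
  then have "(U, V) \<in> pcong P"
    using precat_boundary.presented_congruence(2)[OF F_boundary generators4, of \<Gamma>] by (simp add: pcong_def)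
  then show ?thesis
    using quotient_by_congruence.q_eq_top[OF quotient_F] quotient_by_congruence.R_cells[OF quotient_F] by blast
qed

text \<open>Together with \<open>Fps\<close> these rules turn statements on classes into statements
  on cells of the free 3-precategory: \<open>q\<close> is pulled out of the operations and removed
  from equations below dimension 3.\<close>

lemmas qs = q_bd[of _ 1] q_bd[of _ 2] q_bd[of _ 3] q_idc[of _ 0] q_idc[of _ 1] q_idc[of _ 2]
  q_inj[of _ 0] q_inj[of _ 1] q_inj[of _ 2] q_cells[of _ 1] q_cells[of _ 2] q_cells[of _ 3]
  q_cmp F_comp q_XX

section \<open>The quotient as an instance of the conditions on generators\<close>

lemma q_whiskersE:
  assumes "w \<in> whiskers Q (q ` gen2 ` P2 P)"
  obtains w' where "w = q (whisker w')" "is_whisker w'"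
  using assms
proof (cases rule: whiskers.cases)
  case (whisker b f g)
  then obtain \<alpha> f' g' where *: "b = q (gen2 \<alpha>)" "\<alpha> \<in> P2 P" "f = q f'" "g = q g'" "f' \<in> cells F 1"
    "g' \<in> cells F 1" "gen2 \<alpha> \<in> cells F 2" using gen2_cells by (auto simp: Q_cells)
  then have t: "tgt f' = src (src (gen2 \<alpha>))" "tgt (src (gen2 \<alpha>)) = src g'"
    using whisker by (simp_all add: qs Fps)
  have "w = q (gray_data.whisker P (f', \<alpha>, g'))" "is_whisker (f', \<alpha>, g')"
    using whisker(1) * t by (simp_all add: is_whisker_iff qs Fps del: is_whisker.simps)
  then show ?thesis by (rule that)
qed

lemma q_whisker: "is_whisker w \<Longrightarrow> q (whisker w) \<in> whiskers Q (q ` gen2 ` P2 P)"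
proof (cases w)
  case (fields f \<alpha> g)
  assume w0: "is_whisker w"
  note w = is_whiskerD[OF w0 fields]
  then have "cmp Q 0 (q f) (cmp Q 0 (q (gen2 \<alpha>)) (q g)) \<in> whiskers Q (q ` gen2 ` P2 P)"
    by (intro whiskers.whisker) (simp_all add: qs Fps)
  then show ?thesis using w by (simp add: fields qs Fps)
qed

lemma q_span2: "\<phi> \<in> cells F 2 \<Longrightarrow> q \<phi> \<in> span2 Q (q ` gen2 ` P2 P)"
proof (induction rule: F_cell2_induct)
  case (idc f)
  then have "idc Q (q f) \<in> span2 Q (q ` gen2 ` P2 P)" by (intro span2_idc) (simp add: qs)
  then show ?case using idc by (simp add: qs)
next
  case (cmp w \<phi>)
  then have "cmp Q 1 (q (whisker w)) (q \<phi>) \<in> span2 Q (q ` gen2 ` P2 P)"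
    by (intro span2_cmp q_whisker) (simp_all add: qs Fps)
  then show ?case using cmp by (simp add: qs)
qed

lemma q_span3: "A \<in> cells F 3 \<Longrightarrow> q A \<in> span3 Q (q ` gen3 ` P3 P)"
proof -
  assume "A \<in> cells F 3"
  then have "A \<in> span3 F (gen3 ` P3 P)" by (rule F_span3)
  then show ?thesis
  proof (induction rule: span3.induct)
    case (span3_gen A)
    then show ?case by (auto intro!: span3.span3_gen)
  next
    case (span3_idc \<phi>)
    then show ?case using span3.span3_idc[of "q \<phi>" Q] by (simp add: qs)
  next
    case (span3_cmp2 A A')
    then show ?case using span3.span3_cmp2[of "q A" Q _ "q A'"] by (simp add: qs Fps)
  next
    case (span3_left1 A e)
    then show ?case using span3.span3_left1[of "q A" Q _ "q e"] by (simp add: qs Fps)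
  next
    case (span3_right1 A e)
    then show ?case using span3.span3_right1[of "q A" Q _ "q e"] by (simp add: qs Fps)
  next
    case (span3_left2 A \<phi>)
    then show ?case using span3.span3_left2[of "q A" Q _ "q \<phi>"] by (simp add: qs Fps)
  next
    case (span3_right2 A \<phi>)
    then show ?case using span3.span3_right2[of "q A" Q _ "q \<phi>"] by (simp add: qs Fps)
  qed
qed

lemma Q_cellE: assumes "U \<in> cells Q k" obtains x where "U = q x" "x \<in> cells F k"
  using assms by (auto simp: Q_cells)

lemma Q_XX_bd:
  assumes *: "\<Phi> \<in> cells Q 2" "\<Psi> \<in> cells Q 2" "bd Q Tgt (bd Q Src \<Phi>) = bd Q Src (bd Q Src \<Psi>)"
  shows "presented_XX \<Phi> \<Psi> \<in> cells Q 3"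
    "bd Q Src (presented_XX \<Phi> \<Psi>) = cmp Q 1 (cmp Q 0 \<Phi> (bd Q Src \<Psi>)) (cmp Q 0 (bd Q Tgt \<Phi>) \<Psi>)"
    "bd Q Tgt (presented_XX \<Phi> \<Psi>) = cmp Q 1 (cmp Q 0 (bd Q Src \<Phi>) \<Psi>) (cmp Q 0 \<Phi> (bd Q Tgt \<Psi>))"
proof -
  obtain \<phi> \<psi> where c: "\<Phi> = q \<phi>" "\<Psi> = q \<psi>" "\<phi> \<in> cells F 2" "\<psi> \<in> cells F 2"
    using *(1,2) by (elim Q_cellE)
  then have t: "tgt (src \<phi>) = src (src \<psi>)" using *(3) by (simp add: qs Fps)
  show "presented_XX \<Phi> \<Psi> \<in> cells Q 3"
    "bd Q Src (presented_XX \<Phi> \<Psi>) = cmp Q 1 (cmp Q 0 \<Phi> (bd Q Src \<Psi>)) (cmp Q 0 (bd Q Tgt \<Phi>) \<Psi>)"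
    "bd Q Tgt (presented_XX \<Phi> \<Psi>) = cmp Q 1 (cmp Q 0 (bd Q Src \<Phi>) \<Psi>) (cmp Q 0 \<Phi> (bd Q Tgt \<Psi>))"
    using c t XX_bd[OF c(3,4) t] by (simp_all add: qs Fps)
qed

text \<open>Each condition is lifted to representing cells, settled there, and pushed down again;
  matching conditions lift because they are equations in dimensions below 3.\<close>

lemma Q_gray_core: "gray_core Q (q ` gen2 ` P2 P) (q ` gen3 ` P3 P) presented_XX"
proof (intro gray_core.intro[OF Q_precat3] gray_core_axioms.intro, goal_cases)
  case (1 b)
  then show ?case using gen2_cells by (auto intro: q_cells)
next
  case (2 A)
  then show ?case using gen3_cells by (auto intro: q_cells)
next
  case (3 \<phi>)
  then show ?case using q_span2 by (auto elim!: Q_cellE)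
next
  case (4 A)
  then show ?case using q_span3 by (auto elim!: Q_cellE)
next
  case (5 \<Phi> \<Psi>)
  then show ?case by (rule Q_XX_bd)
next
  case (6 \<Phi> \<Psi>)
  then show ?case by (rule Q_XX_bd)
next
  case (7 \<Phi> \<Psi>)
  then show ?case by (rule Q_XX_bd)
next
  case (8 f \<Psi>)
  obtain f' \<psi> where c: "f = q f'" "\<Psi> = q \<psi>" "f' \<in> cells F 1" "\<psi> \<in> cells F 2"
    using 8(1,2) by (elim Q_cellE)
  then have t: "tgt f' = src (src \<psi>)" using 8(3) by (simp add: qs Fps)
  then show ?case using c by (simp add: qs Fps XX_idl)
next
  case (9 \<Phi> f)
  obtain \<phi> f' where c: "\<Phi> = q \<phi>" "f = q f'" "\<phi> \<in> cells F 2" "f' \<in> cells F 1"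
    using 9(1,2) by (elim Q_cellE)
  then have t: "tgt (src \<phi>) = src f'" using 9(3) by (simp add: qs Fps)
  then show ?case using c by (simp add: qs Fps XX_idr)
next
  case (10 W \<Phi> \<Psi>)
  obtain w \<phi> \<psi> where c: "W = q (whisker w)" "is_whisker w" "\<Phi> = q \<phi>" "\<Psi> = q \<psi>" "\<phi> \<in> cells F 2" "\<psi> \<in> cells F 2"
    using 10(1-3) by (elim Q_cellE q_whiskersE)
  note W = whisker_cells[OF c(2)]
  have t: "tgt (whisker w) = src \<phi>" "tgt (src (whisker w)) = src (src \<psi>)" using 10(4,5) c W by (simp_all add: qs Fps)
  show ?case
    using c W t XX_consl[OF c(2,5) t(1) c(6) t(2)] F_par(1)[OF W t(1)] by (simp add: qs Fps XX_bd)
next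
  case (11 W V \<Psi>)
  obtain w v \<psi> where c: "W = q (whisker w)" "is_whisker w" "V = q (whisker v)" "is_whisker v" "\<Psi> = q \<psi>" "\<psi> \<in> cells F 2"
    using 11(1-3) by (elim Q_cellE q_whiskersE)
  note W = whisker_cells[OF c(2)] whisker_cells[OF c(4)]
  have t: "tgt (whisker v) = src \<psi>" "tgt (src (whisker w)) = src (src (whisker v))"
    using 11(4,5) c W by (simp_all add: qs Fps)
  show ?case
    using c W t XX_consr[OF c(2,4,6) t] F_par(1)[OF W(2) t(1)] by (simp add: qs Fps XX_bd)
next
  case (12 e W V)
  obtain w v f where c: "W = q (whisker w)" "is_whisker w" "V = q (whisker v)" "is_whisker v" "e = q f" "f \<in> cells F 1"
    using 12(1-3) by (elim Q_cellE q_whiskersE)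
  note W = whisker_cells[OF c(2)] whisker_cells[OF c(4)]
  have t: "tgt f = src (src (whisker w))" "tgt (src (whisker w)) = src (src (whisker v))"
    using 12(4,5) c W by (simp_all add: qs Fps)
  show ?case
    using c W t XX_wl[OF c(2,4) t(2) c(6) t(1)] by (simp add: qs Fps XX_bd)
next
  case (13 h W V)
  obtain w v f where c: "W = q (whisker w)" "is_whisker w" "V = q (whisker v)" "is_whisker v" "h = q f" "f \<in> cells F 1"
    using 13(1-3) by (elim Q_cellE q_whiskersE)
  note W = whisker_cells[OF c(2)] whisker_cells[OF c(4)]
  have t: "tgt (src (whisker v)) = src f" "tgt (src (whisker w)) = src (src (whisker v))"
    using 13(4,5) c W by (simp_all add: qs Fps)
  show ?case
    using c W t XX_wr[OF c(2,4) t(2) c(6) t(1)] by (simp add: qs Fps XX_bd)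
next
  case (14 m W V)
  obtain w v f where c: "W = q (whisker w)" "is_whisker w" "V = q (whisker v)" "is_whisker v" "m = q f" "f \<in> cells F 1"
    using 14(1-3) by (elim Q_cellE q_whiskersE)
  note W = whisker_cells[OF c(2)] whisker_cells[OF c(4)]
  have t: "tgt (src (whisker w)) = src f" "tgt f = src (src (whisker v))"
    using 14(4,5) c W by (simp_all add: qs Fps)
  show ?case
    using c W t XX_wm[OF c(2,4) c(6) t] by (simp add: qs Fps XX_bd)
next
  case (15 A A' e h e' h' \<chi>)
  obtain a a' f k f' k' \<theta> where c: "A = q (gen3 a)" "A' = q (gen3 a')" "a \<in> P3 P" "a' \<in> P3 P"
    "e = q f" "h = q k" "e' = q f'" "h' = q k'" "\<chi> = q \<theta>"
    "f \<in> cells F 1" "k \<in> cells F 1" "f' \<in> cells F 1" "k' \<in> cells F 1" "\<theta> \<in> cells F 2"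
    using 15(1-7) by (auto elim!: Q_cellE)
  note g = gen3_cells[OF c(3)] gen3_cells[OF c(4)]
  have t1: "tgt f = src (src (src (gen3 a)))" "tgt (src (src (gen3 a))) = src k"
    "tgt f' = src (src (src (gen3 a')))" "tgt (src (src (gen3 a'))) = src k'"
    using 15(8-11) c g by (simp_all add: qs Fps)
  have t2: "f \<star>\<^sub>0 (tgt (src (gen3 a)) \<star>\<^sub>0 k) = src \<theta>" "tgt \<theta> = f' \<star>\<^sub>0 (src (src (gen3 a')) \<star>\<^sub>0 k')"
    using 15(12,13) c g t1 by (simp_all add: qs Fps)
  \<comment> \<open>The 4-generator brackets its composites to the left while the condition to be
    proved nests them to the right; the final simplification reconciles the two.\<close>
  have "q (((f \<star>\<^sub>0 gen3 a \<star>\<^sub>0 k) \<star>\<^sub>1 \<theta> \<star>\<^sub>1 (f' \<star>\<^sub>0 src (gen3 a') \<star>\<^sub>0 k')) \<star>\<^sub>2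
         ((f \<star>\<^sub>0 tgt (gen3 a) \<star>\<^sub>0 k) \<star>\<^sub>1 \<theta> \<star>\<^sub>1 (f' \<star>\<^sub>0 gen3 a' \<star>\<^sub>0 k'))) =
    q (((f \<star>\<^sub>0 src (gen3 a) \<star>\<^sub>0 k) \<star>\<^sub>1 \<theta> \<star>\<^sub>1 (f' \<star>\<^sub>0 gen3 a' \<star>\<^sub>0 k')) \<star>\<^sub>2
         ((f \<star>\<^sub>0 gen3 a \<star>\<^sub>0 k) \<star>\<^sub>1 \<theta> \<star>\<^sub>1 (f' \<star>\<^sub>0 tgt (gen3 a') \<star>\<^sub>0 k')))"
    by (intro has_gen4_eq independence_gen[OF c(3,4) refl refl refl refl])
      (use c g t1 t2 in \<open>simp_all add: Fps F_comp\<close>)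
  then show ?case
    using c g t1 t2 by (simp add: qs Fps)
next
  case (16 A g b)
  obtain a m \<beta> where c: "A = q (gen3 a)" "a \<in> P3 P" "g = q m" "m \<in> cells F 1" "b = q (gen2 \<beta>)" "\<beta> \<in> P2 P"
    using 16(1-3) by (auto elim!: Q_cellE)
  note g = gen3_cells[OF c(2)] gen2_cells[OF c(6)]
  have t1: "tgt (src (src (gen3 a))) = src m" "tgt m = src (src (gen2 \<beta>))"
    using 16(4,5) c g by (simp_all add: qs Fps)
  have "q (((gen3 a \<star>\<^sub>0 m \<star>\<^sub>0 src (gen2 \<beta>)) \<star>\<^sub>1 (tgt (src (gen3 a)) \<star>\<^sub>0 m \<star>\<^sub>0 gen2 \<beta>)) \<star>\<^sub>2 XX (tgt (gen3 a)) (m \<star>\<^sub>0 gen2 \<beta>)) =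
    q (XX (src (gen3 a)) (m \<star>\<^sub>0 gen2 \<beta>) \<star>\<^sub>2 ((src (src (gen3 a)) \<star>\<^sub>0 m \<star>\<^sub>0 gen2 \<beta>) \<star>\<^sub>1 (gen3 a \<star>\<^sub>0 m \<star>\<^sub>0 tgt (gen2 \<beta>))))"
    by (intro has_gen4_eq naturality_gen_left[OF c(2,6,4) _ _ refl refl refl refl refl refl])
      (use c g t1 in \<open>simp_all add: F_join\<close>)
  \<comment> \<open>The boundaries of the interchangers are needed to push \<open>q\<close> through
    the composites in which they occur.\<close>
  then show ?case
    using c g t1 by (simp add: qs Fps XX_bd)
next
  case (17 b g A)
  obtain a m \<beta> where c: "A = q (gen3 a)" "a \<in> P3 P" "g = q m" "m \<in> cells F 1" "b = q (gen2 \<beta>)" "\<beta> \<in> P2 P"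
    using 17(1-3) by (auto elim!: Q_cellE)
  note g = gen3_cells[OF c(2)] gen2_cells[OF c(6)]
  have t1: "tgt (src (gen2 \<beta>)) = src m" "tgt m = src (src (src (gen3 a)))"
    using 17(4,5) c g by (simp_all add: qs Fps)
  have "q (((gen2 \<beta> \<star>\<^sub>0 m \<star>\<^sub>0 src (src (gen3 a))) \<star>\<^sub>1 (tgt (gen2 \<beta>) \<star>\<^sub>0 m \<star>\<^sub>0 gen3 a)) \<star>\<^sub>2 XX (gen2 \<beta> \<star>\<^sub>0 m) (tgt (gen3 a))) =
    q (XX (gen2 \<beta> \<star>\<^sub>0 m) (src (gen3 a)) \<star>\<^sub>2 ((src (gen2 \<beta>) \<star>\<^sub>0 m \<star>\<^sub>0 gen3 a) \<star>\<^sub>1 (gen2 \<beta> \<star>\<^sub>0 m \<star>\<^sub>0 tgt (src (gen3 a)))))"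
    by (intro has_gen4_eq naturality_gen_right[OF c(6,2,4) _ _ refl refl refl refl refl refl])
      (use c g t1 in \<open>simp_all add: F_join\<close>)
  then show ?case
    using c g t1 by (simp add: qs Fps XX_bd)
qed

end

theorem mainTheorem3:
  fixes P :: "('a, 'b, 'c, 'd, 'e) prepoly4"
    and X :: "'c \<Rightarrow> ('a, 'b, 'c, 'd) cell3 \<Rightarrow> 'c \<Rightarrow> 'd"
  assumes "gray_presentation P X"
  shows "lax_gray_category (presented3 P) (gray_data.presented_XX P X)"
  using gray_core.lax_gray[OF gray_presentation.Q_gray_core[OF assms]] .

end
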